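(* In the setting of the context, assume that, as $n\to\infty$, (1) $\|\Sigma_Y\|_{\ell_\infty}=O_p(1)$ and $\|\beta\|_{\ell_\infty}=O(1)$; (2) $\Lambda_{\max}(\Sigma_Z)+1/\Lambda_{\min}(\Sigma_Z)=O_p(1)$; (3) $\|\Sigma_X\|_{\ell_\infty}+1/\Lambda_{\min}(\Sigma_X)=O_p(1)$; (4) $s(\Theta_Z)=O_p(s_n)$ for some sequence $s_n\in[1,\infty)$. Let $(\lambda_n)_{n\ge1}$ be a sequence of positive-valued random variables such that (5) $\lambda_n^{-1}\|\hat\Sigma_{X,n}-\Sigma_X\|_{\ell_\infty}\to^p0$, $\lambda_n^{-1}\|\hat\Sigma_{YX,n}-\beta\hat\Sigma_{X,n}\|_{\ell_\infty}\to^p0$ and $\lambda_n^{-1}\|\breve\Sigma_{Z,n}-\Sigma_Z\|_{\ell_\infty}\to^p0$, where $\breve\Sigma_{Z,n}:=\hat\Sigma_{Y,n}-\hat\Sigma_{YX,n}\beta^\top-\beta\hat\Sigma_{YX,n}^\top+\beta\hat\Sigma_{X,n}\beta^\top$; (6) $(s_n+r)\lambda_n\to^p0$; (7) $P(\overline\Sigma_n\text{ is positive semidefinite})\to1$, where $\overline\Sigma_n:=\begin{pmatrix}\hat\Sigma_{X,n}&\hat\Sigma_{YX,n}^\top\\\hat\Sigma_{YX,n}&\hat\Sigma_{Y,n}\end{pmatrix}$. Then $\lambda_n^{-1}|||\hat\Theta_{Z,\lambda_n}-\Theta_Z|||_w=O_p(s_n)$ and $\lambda_n^{-1}|||\hat\Theta_{Z,\lambda_n}^{-1}-\Sigma_Z|||_2=O_p(s_n)$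 as $n\to\infty$ for any $w\in[1,\infty]$.
   Context: All objects (probability space, processes, dimensions $d=d_n\ge2$ and $r=r_n$, matrix $\beta$) may depend on $n\in\mathbb{N}$; the index is suppressed; $O_p$, $\to^p$ are as $n\to\infty$. $X$ is an $r$-dimensional and $Z$ a $d$-dimensional semimartingale on $[0,1]$ with $[Z,X]_1=0$, $\beta$ is a non-random $d\times r$ matrix and $Y=\beta X+Z$. $\Sigma_Y=[Y,Y]_1$, $\Sigma_X=[X,X]_1$, $\Sigma_Z=[Z,Z]_1$ (quadratic covariation matrices at time 1) are a.s. invertible; $\Theta_Z=\Sigma_Z^{-1}$; $\Sigma_{YX}=[Y,X]_1$. $\hat\Sigma_{Y,n},\hat\Sigma_{X,n},\hat\Sigma_{YX,n}$ are random variables (arbitrary estimators of $\Sigma_Y,\Sigma_X,\Sigma_{YX}$) with values in symmetric $d\times d$ matrices, positive semidefinite $r\times r$ matrices, and $\mathbb{R}^{d\times r}$, respectively. $\mathcal{S}_k^{++}$ denotes the positive definite $k\times k$ matrices. $\hat\Sigma_{X,n}^\dagger$ is an $\mathcal{S}_r^{++}$-valued random variable equal to $\hat\Sigma_{X,n}^{-1}$ whenever $\hat\Sigma_{X,n}$ is invertible; $\hat\beta_n=\hat\Sigma_{YX,n}\hat\Sigma_{X,n}^\dagger$; $\hat\Sigma_{Z,n}=\hat\Sigma_{Y,n}-\hat\beta_n\hat\Sigma_{X,n}\hat\beta_n^\top$. For $\lambda>0$ (possibly random), $\hat\Theta_{Z,\lambda}$ is an $\mathcal{S}_d^{++}$-valued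 random variable which equals $$\arg\min_{\Theta\in\mathcal{S}_d^{++}}\Big\{\mathrm{tr}(\Theta\hat\Sigma_{Z,n})-\log\det\Theta+\lambda\sum_{i\ne j}\sqrt{\hat\Sigma_{Z,n}^{ii}\hat\Sigma_{Z,n}^{jj}}\,|\Theta^{ij}|\Big\}$$ on the event where this problem has a unique solution. $\|A\|_{\ell_\infty}=\max_{i,j}|A^{ij}|$; $|||A|||_w=\sup\{\|Ax\|_{\ell_w}:\|x\|_{\ell_w}=1\}$; $\Lambda_{\max},\Lambda_{\min}$: largest/smallest eigenvalue; for symmetric $A$, $s(A)=\#\{(i,j):i\ne j,A^{ij}\ne0\}$. *)

theory Defs
  imports
    "HOL-Probability.Probability"
    "HOL-Library.Landau_Symbols"
    "Jordan_Normal_Form.Spectral_Radius"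
begin

unbundle no vec_syntax

subsection \<open>Stochastic orders along a sequence of probability spaces\<close>

text \<open>Outer measure agrees with the measure on measurable sets; it is used because
  \<^const>\<open>measure\<close> returns 0 on non-measurable sets, and quantities such as the smallest
  eigenvalue of an a.s. symmetric matrix are only determined up to a null set.\<close>

definition bigO_p :: "(nat \<Rightarrow> 'a measure) \<Rightarrow> (nat \<Rightarrow> 'a \<Rightarrow> real) \<Rightarrow> (nat \<Rightarrow> real) \<Rightarrow> bool" where
  "bigO_p M \<xi> a \<longleftrightarrow>
     (\<forall>\<epsilon>>0. \<exists>K. \<forall>\<^sub>F n in sequentially.
        outer_measure_of (M n) {\<omega> \<in> space (M n). K * a n < \<bar>\<xi> n \<omega>\<bar>} \<le> ennreal \<epsilon>)"

definition tendsto_zero_p :: "(nat \<Rightarrow> 'a measure) \<Rightarrow> (nat \<Rightarrow> 'a \<Rightarrow> real) \<Rightarrow> bool" where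
  "tendsto_zero_p M \<xi> \<longleftrightarrow>
     (\<forall>\<epsilon>>0. (\<lambda>n. outer_measure_of (M n) {\<omega> \<in> space (M n). \<epsilon> < \<bar>\<xi> n \<omega>\<bar>}) \<longlonglongrightarrow> 0)"

subsection \<open>Semimartingales on the unit interval and quadratic covariation\<close>

text \<open>Filtrations are indexed by the whole real line to match the library locale; only the
  times in \<open>[0,1]\<close> matter (extend by \<open>F 0\<close> and \<open>F 1\<close>).\<close>

definition stochastic_basis :: "'a measure \<Rightarrow> (real \<Rightarrow> 'a measure) \<Rightarrow> bool" where
  "stochastic_basis M F \<longleftrightarrow>
     prob_space M \<and> filtration (space M) F \<and> (\<forall>t. subalgebra M (F t)) \<and>
     (\<forall>t\<in>{0..<1}. sets (F t) = (\<Inter>s\<in>{t<..}. sets (F s)))"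

definition adapted :: "(real \<Rightarrow> 'a measure) \<Rightarrow> (real \<Rightarrow> 'a \<Rightarrow> real) \<Rightarrow> bool" where
  "adapted F X \<longleftrightarrow> (\<forall>t\<in>{0..1}. X t \<in> borel_measurable (F t))"

definition cadlag :: "(real \<Rightarrow> real) \<Rightarrow> bool" where
  "cadlag f \<longleftrightarrow>
     (\<forall>t\<in>{0..<1}. (f \<longlongrightarrow> f t) (at_right t)) \<and>
     (\<forall>t\<in>{0<..1}. \<exists>l. (f \<longlongrightarrow> l) (at_left t))"

definition grid :: "real \<Rightarrow> nat \<Rightarrow> (nat \<Rightarrow> real) \<Rightarrow> bool" where
  "grid t m p \<longleftrightarrow> p 0 = 0 \<and> p m = t \<and> (\<forall>i<m. p i \<le> p (Suc i))"

definition mesh :: "nat \<Rightarrow> (nat \<Rightarrow> real) \<Rightarrow> real" where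
  "mesh m p = (MAX i\<in>{..<m}. p (Suc i) - p i)"

definition bounded_variation :: "(real \<Rightarrow> real) \<Rightarrow> bool" where
  "bounded_variation f \<longleftrightarrow>
     (\<exists>C. \<forall>m p. grid 1 m p \<longrightarrow> (\<Sum>i<m. \<bar>f (p (Suc i)) - f (p i)\<bar>) \<le> C)"

definition martingale :: "'a measure \<Rightarrow> (real \<Rightarrow> 'a measure) \<Rightarrow> (real \<Rightarrow> 'a \<Rightarrow> real) \<Rightarrow> bool" where
  "martingale M F N \<longleftrightarrow>
     adapted F N \<and> (\<forall>t\<in>{0..1}. integrable M (N t)) \<and>
     (\<forall>s t. 0 \<le> s \<and> s \<le> t \<and> t \<le> 1 \<longrightarrow> (AE \<omega> in M. real_cond_exp M (F s) (N t) \<omega> = N s \<omega>))"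

text \<open>On the compact time interval a localizing sequence reaches the terminal time 1 after
  finitely many steps, almost surely.\<close>

definition local_martingale :: "'a measure \<Rightarrow> (real \<Rightarrow> 'a measure) \<Rightarrow> (real \<Rightarrow> 'a \<Rightarrow> real) \<Rightarrow> bool" where
  "local_martingale M F N \<longleftrightarrow>
     adapted F N \<and> (\<forall>\<omega>\<in>space M. cadlag (\<lambda>t. N t \<omega>)) \<and>
     (\<exists>\<tau> :: nat \<Rightarrow> 'a \<Rightarrow> real.
        (\<forall>k. stopping_time F (\<tau> k)) \<and>
        (\<forall>k. \<forall>\<omega>\<in>space M. \<tau> k \<omega> \<in> {0..1} \<and> \<tau> k \<omega> \<le> \<tau> (Suc k) \<omega>) \<and>
        (AE \<omega> in M. \<exists>k. \<tau> k \<omega> = 1) \<and>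
        (\<forall>k. martingale M F (\<lambda>t \<omega>. N (min t (\<tau> k \<omega>)) \<omega>)))"

definition finite_variation :: "'a measure \<Rightarrow> (real \<Rightarrow> 'a measure) \<Rightarrow> (real \<Rightarrow> 'a \<Rightarrow> real) \<Rightarrow> bool" where
  "finite_variation M F A \<longleftrightarrow>
     adapted F A \<and> (\<forall>\<omega>\<in>space M. cadlag (\<lambda>t. A t \<omega>) \<and> bounded_variation (\<lambda>t. A t \<omega>))"

definition semimartingale :: "'a measure \<Rightarrow> (real \<Rightarrow> 'a measure) \<Rightarrow> (real \<Rightarrow> 'a \<Rightarrow> real) \<Rightarrow> bool" where
  "semimartingale M F X \<longleftrightarrow>
     adapted F X \<and>
     (\<exists>N A. local_martingale M F N \<and> finite_variation M F A \<and>
        (\<forall>\<omega>\<in>space M. N 0 \<omega> = 0 \<and> A 0 \<omega> = 0) \<and>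
        (AE \<omega> in M. \<forall>t\<in>{0..1}. X t \<omega> = X 0 \<omega> + N t \<omega> + A t \<omega>))"

definition vec_semimartingale ::
    "'a measure \<Rightarrow> (real \<Rightarrow> 'a measure) \<Rightarrow> nat \<Rightarrow> (real \<Rightarrow> 'a \<Rightarrow> real vec) \<Rightarrow> bool" where
  "vec_semimartingale M F k X \<longleftrightarrow>
     (\<forall>t\<in>{0..1}. \<forall>\<omega>\<in>space M. X t \<omega> \<in> carrier_vec k) \<and>
     (\<forall>i<k. semimartingale M F (\<lambda>t \<omega>. X t \<omega> $ i))"

text \<open>\<open>quad_covariation M X Y t Q\<close>: the random variable \<open>Q\<close> is a version of \<open>[X,Y]\<^sub>t\<close>, the limit
  in probability of realized covariations along deterministic partitions of \<open>[0,t]\<close> whose mesh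
  tends to 0. For semimartingales it exists and is a.s. unique.\<close>

definition quad_covariation ::
    "'a measure \<Rightarrow> (real \<Rightarrow> 'a \<Rightarrow> real) \<Rightarrow> (real \<Rightarrow> 'a \<Rightarrow> real) \<Rightarrow> real \<Rightarrow> ('a \<Rightarrow> real) \<Rightarrow> bool" where
  "quad_covariation M X Y t Q \<longleftrightarrow>
     Q \<in> borel_measurable M \<and>
     (\<forall>m p. (\<forall>k. grid t (m k) (p k)) \<and> (\<lambda>k. mesh (m k) (p k)) \<longlonglongrightarrow> 0 \<longrightarrow>
        tendsto_zero_p (\<lambda>_. M)
          (\<lambda>k \<omega>. (\<Sum>i<m k. (X (p k (Suc i)) \<omega> - X (p k i) \<omega>) * (Y (p k (Suc i)) \<omega> - Y (p k i) \<omega>)) - Q \<omega>))"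

definition random_mat :: "'a measure \<Rightarrow> nat \<Rightarrow> nat \<Rightarrow> ('a \<Rightarrow> real mat) \<Rightarrow> bool" where
  "random_mat M p q A \<longleftrightarrow>
     (\<forall>\<omega>\<in>space M. A \<omega> \<in> carrier_mat p q) \<and>
     (\<forall>i<p. \<forall>j<q. (\<lambda>\<omega>. A \<omega> $$ (i, j)) \<in> borel_measurable M)"

text \<open>\<open>S\<close> is a version of the \<open>p \<times> q\<close> matrix \<open>[U,V]\<^sub>1\<close>.\<close>

definition qcov_mat ::
    "'a measure \<Rightarrow> nat \<Rightarrow> nat \<Rightarrow> (real \<Rightarrow> 'a \<Rightarrow> real vec) \<Rightarrow> (real \<Rightarrow> 'a \<Rightarrow> real vec) \<Rightarrow> ('a \<Rightarrow> real mat) \<Rightarrow> bool" where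
  "qcov_mat M p q U V S \<longleftrightarrow>
     random_mat M p q S \<and>
     (\<forall>i<p. \<forall>j<q. quad_covariation M (\<lambda>t \<omega>. U t \<omega> $ i) (\<lambda>t \<omega>. V t \<omega> $ j) 1 (\<lambda>\<omega>. S \<omega> $$ (i, j)))"

subsection \<open>Matrices\<close>

definition sym_mat :: "nat \<Rightarrow> real mat \<Rightarrow> bool" where
  "sym_mat k A \<longleftrightarrow> A \<in> carrier_mat k k \<and> transpose_mat A = A"

definition psd_mat :: "nat \<Rightarrow> real mat \<Rightarrow> bool" where
  "psd_mat k A \<longleftrightarrow> sym_mat k A \<and> (\<forall>x\<in>carrier_vec k. 0 \<le> scalar_prod x (A *\<^sub>v x))"

definition pd_mat :: "nat \<Rightarrow> real mat \<Rightarrow> bool" where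
  "pd_mat k A \<longleftrightarrow> sym_mat k A \<and> (\<forall>x\<in>carrier_vec k. x \<noteq> 0\<^sub>v k \<longrightarrow> 0 < scalar_prod x (A *\<^sub>v x))"

text \<open>Meaningful for invertible square matrices only.\<close>

definition mat_inv :: "real mat \<Rightarrow> real mat" where
  "mat_inv A = (THE B. B \<in> carrier_mat (dim_row A) (dim_row A) \<and> inverts_mat A B \<and> inverts_mat B A)"

definition mat_trace :: "real mat \<Rightarrow> real" where
  "mat_trace A = (\<Sum>i<dim_row A. A $$ (i, i))"

definition max_norm :: "real mat \<Rightarrow> real" where
  "max_norm A = Max (abs ` elements_mat A)"

definition Lambda_max :: "real mat \<Rightarrow> real" where
  "Lambda_max A = Max (spectrum A)"

definition Lambda_min :: "real mat \<Rightarrow> real" where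
  "Lambda_min A = Min (spectrum A)"

definition offdiag_nonzeros :: "real mat \<Rightarrow> nat" where
  "offdiag_nonzeros A =
     card {(i, j). i < dim_row A \<and> j < dim_col A \<and> i \<noteq> j \<and> A $$ (i, j) \<noteq> 0}"

definition lw_norm :: "ereal \<Rightarrow> real vec \<Rightarrow> real" where
  "lw_norm w x =
     (if w = \<infinity> then MAX i\<in>{..<dim_vec x}. \<bar>x $ i\<bar>
      else (\<Sum>i<dim_vec x. \<bar>x $ i\<bar> powr real_of_ereal w) powr (1 / real_of_ereal w))"

definition op_norm :: "ereal \<Rightarrow> real mat \<Rightarrow> real" where
  "op_norm w A = (SUP x\<in>{x \<in> carrier_vec (dim_col A). lw_norm w x = 1}. lw_norm w (A *\<^sub>v x))"

subsection \<open>The weighted graphical Lasso\<close>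

definition glasso_objective :: "nat \<Rightarrow> real mat \<Rightarrow> real \<Rightarrow> real mat \<Rightarrow> real" where
  "glasso_objective d S lam \<Theta> =
     mat_trace (\<Theta> * S) - ln (Determinant.det \<Theta>) +
     lam * (\<Sum>(i, j)\<in>{(i, j). i < d \<and> j < d \<and> i \<noteq> j}. sqrt (S $$ (i, i) * S $$ (j, j)) * \<bar>\<Theta> $$ (i, j)\<bar>)"

text \<open>The first conjunct says that the square roots in the objective are those of nonnegative
  numbers, i.e. that the problem is well-defined (\<^const>\<open>sqrt\<close> is an odd function on the reals).\<close>

definition glasso_solution :: "nat \<Rightarrow> real mat \<Rightarrow> real \<Rightarrow> real mat \<Rightarrow> bool" where
  "glasso_solution d S lam \<Theta> \<longleftrightarrow>
     (\<forall>i<d. \<forall>j<d. i \<noteq> j \<longrightarrow> 0 \<le> S $$ (i, i) * S $$ (j, j)) \<and>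
     pd_mat d \<Theta> \<and>
     (\<forall>\<Theta>'. pd_mat d \<Theta>' \<longrightarrow> glasso_objective d S lam \<Theta> \<le> glasso_objective d S lam \<Theta>')"

end

theory Submission
  imports Defs
begin

text \<open>The argument is deterministic on an event of outer probability close to one. There the
  residual estimator \<open>S = hatZ\<close> is positive semidefinite (Schur complement) and entrywise within
  \<open>\<delta> lam\<close> of \<open>SigZ\<close>, so the weighted graphical Lasso has a unique solution \<open>H\<close>. Its objective is
  compared with that at \<open>T = C (mat_inv SigZ) C\<close>, where the diagonal matrix \<open>C\<close> is chosen such that
  the inverse of \<open>T\<close> has the diagonal of \<open>S\<close>; the noise term then only involves off-diagonal
  entries and is absorbed by the penalty. The self-concordant lower bound on the Bregman divergence
  of \<open>- ln det\<close> turns this into a Frobenius error of order \<open>lam * sqrt s\<close> and an off-diagonal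
  \<open>\<ell>\<^sub>1\<close> error of order \<open>lam * s\<close>, and the latter dominates all operator norms by the Schur test.\<close>

text \<open>A direct comparison with \<open>mat_inv SigZ\<close> would leave one unpenalized noise
  term per diagonal entry, and their joint effect grows with the dimension. The rescaling by
  \<open>C\<close> removes them exactly; its own cost is a relative error per entry, charged to row
  sums of \<open>mat_inv SigZ\<close>, which the number of nonzeros controls. No a priori bound on
  \<open>H\<close> is available. The Bregman modulus \<open>x^2 / (2 * (1 + x))\<close> is quadratic
  near 0 but only linear far away, and the smallness of \<open>lam * s\<close> is what excludes the
  linear regime. The diagonal of \<open>H - T\<close> is never summed: a row sum contains one
  diagonal entry, and the Frobenius norm bounds that entry. The dimension \<open>r\<close> enters at
  two places, the invertibility of \<open>hatX\<close> (an entrywise error costs a factor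
  \<open>r\<close> in a quadratic form) and the passage from the oracle estimator to
  \<open>S\<close>. Both ask only for a small \<open>r * lam\<close>.\<close>

unbundle no inner_syntax

subsection \<open>Simultaneous diagonalization\<close>

lemma bilinear_sum:
  fixes A :: "real mat"
  assumes "A \<in> carrier_mat n m" "x \<in> carrier_vec n" "y \<in> carrier_vec m"
  shows "x \<bullet> (A *\<^sub>v y) = (\<Sum>i<n. \<Sum>j<m. x $ i * A $$ (i, j) * y $ j)"
  using assms
  by (auto simp: scalar_prod_def lessThan_atLeast0 sum_distrib_left mult.assoc intro!: sum.cong)

lemma scalar_prod_sum_lessThan:
  "y \<in> carrier_vec n \<Longrightarrow> x \<bullet> y = (\<Sum>i<n. x $ i * y $ i)"
  by (auto simp: scalar_prod_def lessThan_atLeast0)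

lemma bilinear_sym:
  fixes A :: "real mat"
  assumes "sym_mat n A" "x \<in> carrier_vec n" "y \<in> carrier_vec n"
  shows "x \<bullet> (A *\<^sub>v y) = y \<bullet> (A *\<^sub>v x)"
proof -
  have A: "A \<in> carrier_mat n n" and t: "transpose_mat A = A" using assms(1) by (auto simp: sym_mat_def)
  have "x \<bullet> (A *\<^sub>v y) = (transpose_mat A *\<^sub>v x) \<bullet> y"
    using transpose_vec_mult_scalar[OF A assms(3,2)] by simp
  also have "\<dots> = y \<bullet> (A *\<^sub>v x)" unfolding t
    by (rule comm_scalar_prod[of _ n]) (use A assms in auto)
  finally show ?thesis .
qed

lemma scalar_prod_self_nonneg: "0 \<le> x \<bullet> (x :: real vec)"
  by (auto simp: scalar_prod_def intro!: sum_nonneg)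

lemma scalar_prod_self_pos:
  fixes x :: "real vec"
  assumes "x \<in> carrier_vec n" "x \<noteq> 0\<^sub>v n"
  shows "0 < x \<bullet> x"
proof -
  obtain i where i: "i < n" "x $ i \<noteq> 0"
    using assms by (metis carrier_vecD eq_vecI index_zero_vec)
  have "0 < (\<Sum>i<n. x $ i * x $ i)"
    by (rule sum_pos2[of _ i]) (use i in \<open>auto simp: zero_less_mult_iff linorder_neq_iff\<close>)
  then show ?thesis using scalar_prod_sum_lessThan[OF assms(1)] by simp
qed

lemma Cauchy_Schwarz_vec:
  fixes x y :: "real vec"
  assumes "x \<in> carrier_vec n" "y \<in> carrier_vec n"
  shows "(x \<bullet> y)\<^sup>2 \<le> (x \<bullet> x) * (y \<bullet> y)"
  using Cauchy_Schwarz_ineq_sum[of "\<lambda>i. x $ i" "\<lambda>i. y $ i" "{..<n}"]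
  by (simp add: scalar_prod_sum_lessThan[OF assms(1)] scalar_prod_sum_lessThan[OF assms(2)] power2_eq_square)

text \<open>Vectors and matrices enter the two compactness arguments as coefficient functions under
  the product topology. With the singleton of 0 outside the index range, Tychonoff gives compactness
  although the index type is infinite.\<close>

lemma compact_box:
  fixes C :: "'i \<Rightarrow> real set"
  assumes "\<And>i. compact (C i)"
  shows "compact {f. \<forall>i. f i \<in> C i}"
proof -
  have "{f. \<forall>i. f i \<in> C i} = PiE UNIV C" by auto
  moreover have "compactin (product_topology (\<lambda>i. euclidean) UNIV) (PiE UNIV C)"
    using assms by (auto simp: compactin_PiE)
  ultimately show ?thesis by (simp add: euclidean_product_topology)
qed

text \<open>The quotient of the two forms is homogeneous of degree 0, so a maximum over the compact
  unit sphere of the kernel of \<open>L\<close> is a maximum over the whole kernel. \<open>L\<close>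
  encodes linear constraints, and \<open>v0\<close> ensures that they leave a nonzero vector.
  Scaling the maximizer to \<open>A\<close>-norm 1 turns the maximal quotient into the value of the
  form of \<open>B\<close>.\<close>

lemma exists_rayleigh_maximizer:
  fixes A B L :: "real mat"
  assumes A: "pd_mat n A" and B: "B \<in> carrier_mat n n" and L: "L \<in> carrier_mat n n"
    and v0: "v0 \<in> carrier_vec n" "v0 \<noteq> 0\<^sub>v n" "L *\<^sub>v v0 = 0\<^sub>v n"
  obtains v where "v \<in> carrier_vec n" "L *\<^sub>v v = 0\<^sub>v n" "v \<bullet> (A *\<^sub>v v) = 1"
    "\<And>y. y \<in> carrier_vec n \<Longrightarrow> L *\<^sub>v y = 0\<^sub>v n \<Longrightarrow> y \<bullet> (B *\<^sub>v y) \<le> (v \<bullet> (B *\<^sub>v v)) * (y \<bullet> (A *\<^sub>v y))"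
proof -
  have Ac: "A \<in> carrier_mat n n" using A by (auto simp: pd_mat_def sym_mat_def)
  define q where "q M f = (\<Sum>i<n. \<Sum>j<n. f i * M $$ (i, j) * f j)" for M :: "real mat" and f :: "nat \<Rightarrow> real"
  have q_eq: "q M f = vec n f \<bullet> (M *\<^sub>v vec n f)" if "M \<in> carrier_mat n n" for M f
    unfolding q_def by (subst bilinear_sum[OF that]) auto
  have q_cont: "continuous_on U (q M)" for U M
    unfolding q_def by (intro continuous_intros continuous_on_subset[OF continuous_on_product_coordinates]) auto
  define S where "S = {f. \<forall>i. f i \<in> (if i < n then {-1..1} else {0::real})} \<inter>
    ({f. (\<Sum>i<n. (f i)\<^sup>2) = 1} \<inter> (\<Inter>i\<in>{..<n}. {f. (\<Sum>j<n. L $$ (i, j) * f j) = 0}))"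
  have "compact S" unfolding S_def
    by (intro compact_Int_closed compact_box closed_Int closed_INT ballI closed_Collect_eq continuous_intros continuous_on_product_coordinates) auto
  have inS: "(\<lambda>i. if i < n then y $ i / sqrt (y \<bullet> y) else 0) \<in> S" 
    if y: "y \<in> carrier_vec n" "y \<noteq> 0\<^sub>v n" "L *\<^sub>v y = 0\<^sub>v n" for y
  proof -
    have pos: "0 < y \<bullet> y" using scalar_prod_self_pos y by auto
    have sum1: "(\<Sum>i<n. (y $ i / sqrt (y \<bullet> y))\<^sup>2) = 1"
    proof -
      have "(\<Sum>i<n. (y $ i / sqrt (y \<bullet> y))\<^sup>2) = (\<Sum>i<n. y $ i * y $ i) / (y \<bullet> y)"
        using pos by (simp add: power_divide sum_divide_distrib power2_eq_square)
      also have "(\<Sum>i<n. y $ i * y $ i) = y \<bullet> y" by (simp add: scalar_prod_sum_lessThan[OF y(1)])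
      finally show ?thesis using pos by simp
    qed
    have b: "\<bar>y $ i / sqrt (y \<bullet> y)\<bar> \<le> 1" if "i < n" for i
    proof -
      have "(y $ i / sqrt (y \<bullet> y))\<^sup>2 \<le> (\<Sum>i<n. (y $ i / sqrt (y \<bullet> y))\<^sup>2)"
        using that by (intro member_le_sum) auto
      then show ?thesis unfolding sum1 by (simp add: power2_le_iff_abs_le abs_square_le_1)
    qed
    have k: "(\<Sum>j<n. L $$ (i, j) * (y $ j / sqrt (y \<bullet> y))) = 0" if "i < n" for i
    proof -
      have "(L *\<^sub>v y) $ i = 0" using y that by simp
      then have "(\<Sum>j<n. L $$ (i, j) * y $ j) = 0" using that L y(1)
        by (auto simp: scalar_prod_def lessThan_atLeast0)
      then show ?thesis by (simp add: sum_divide_distrib[symmetric])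
    qed
    show ?thesis unfolding S_def using sum1 b k by (auto simp: abs_le_iff simp del: abs_divide)
  qed
  have nz: "vec n f \<noteq> 0\<^sub>v n" if "f \<in> S" for f
  proof
    assume z: "vec n f = 0\<^sub>v n"
    have "f i = 0" if "i < n" for i using arg_cong[OF z, of "\<lambda>v. v $ i"] that by simp
    then have "(\<Sum>i<n. (f i)\<^sup>2) = 0" by simp
    then show False using that unfolding S_def by auto
  qed
  have qA: "0 < q A f" if "f \<in> S" for f
    using A nz[OF that] unfolding q_eq[OF Ac] pd_mat_def by auto
  have "continuous_on S (\<lambda>f. q B f / q A f)"
    using qA by (intro continuous_intros q_cont) force
  then obtain f where f: "f \<in> S" and max: "\<And>g. g \<in> S \<Longrightarrow> q B g / q A g \<le> q B f / q A f"
    using continuous_attains_sup[OF \<open>compact S\<close>, of "\<lambda>f. q B f / q A f"] inS[OF v0] by blast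
  define u where "u = vec n f"
  define c where "c = 1 / sqrt (q A f)"
  define v where "v = c \<cdot>\<^sub>v u"
  have u: "u \<in> carrier_vec n" unfolding u_def by simp
  have v: "v \<in> carrier_vec n" unfolding v_def using u by simp
  have Lu: "L *\<^sub>v u = 0\<^sub>v n"
  proof (rule eq_vecI)
    fix i assume "i < dim_vec (0\<^sub>v n :: real vec)"
    then have i: "i < n" by simp
    have "(\<Sum>j<n. L $$ (i, j) * f j) = 0" using f i unfolding S_def by auto
    then show "(L *\<^sub>v u) $ i = 0\<^sub>v n $ i" using i L unfolding u_def
      by (auto simp: scalar_prod_def lessThan_atLeast0)
  qed (use L in auto)
  have scale: "v \<bullet> (M *\<^sub>v v) = c\<^sup>2 * q M f" if "M \<in> carrier_mat n n" for M
    unfolding v_def q_eq[OF that] u_def[symmetric] using that u 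
    by (simp add: mult_mat_vec[OF that u] power2_eq_square)
  show ?thesis
  proof
    show "v \<in> carrier_vec n" by fact
    show "L *\<^sub>v v = 0\<^sub>v n" unfolding v_def using mult_mat_vec[OF L u] Lu by auto
    show "v \<bullet> (A *\<^sub>v v) = 1" unfolding scale[OF Ac] c_def using qA[OF f] by (simp add: power_divide)
    fix y :: "real vec" assume y: "y \<in> carrier_vec n" "L *\<^sub>v y = 0\<^sub>v n"
    show "y \<bullet> (B *\<^sub>v y) \<le> v \<bullet> (B *\<^sub>v v) * (y \<bullet> (A *\<^sub>v y))"
    proof (cases "y = 0\<^sub>v n")
      case True
      then show ?thesis using B Ac by simp
    next
      case False
      let ?g = "\<lambda>i. if i < n then y $ i / sqrt (y \<bullet> y) else 0"
      have pos: "0 < y \<bullet> y" using scalar_prod_self_pos y False by auto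
      have e: "q M ?g = (y \<bullet> (M *\<^sub>v y)) / (y \<bullet> y)" if "M \<in> carrier_mat n n" for M
      proof -
        have "vec n ?g = (1 / sqrt (y \<bullet> y)) \<cdot>\<^sub>v y" using y by (intro eq_vecI) auto
        then show ?thesis unfolding q_eq[OF that] using pos y that 
          by (simp add: mult_mat_vec[OF that y(1)])
      qed
      have yA: "0 < y \<bullet> (A *\<^sub>v y)" using A y False unfolding pd_mat_def by auto
      have "q B ?g / q A ?g \<le> q B f / q A f" by (rule max[OF inS[OF y(1) False y(2)]])
      then have "(y \<bullet> (B *\<^sub>v y)) / (y \<bullet> (A *\<^sub>v y)) \<le> q B f / q A f"
        unfolding e[OF B] e[OF Ac] using pos by simp
      then have "(y \<bullet> (B *\<^sub>v y)) / (y \<bullet> (A *\<^sub>v y)) \<le> v \<bullet> (B *\<^sub>v v)"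
        unfolding scale[OF B] c_def using qA[OF f] by (simp add: power_divide)
      then show ?thesis using yA by (simp add: field_simps)
    qed
  qed
qed

text \<open>The first-order condition at an extremum, in algebraic form. It is applied to a Rayleigh
  maximizer perturbed in a fixed direction.\<close>

lemma quadratic_nonneg_linear_zero:
  fixes b c :: real
  assumes "\<And>t. 0 \<le> t * b + t\<^sup>2 * c"
  shows "b = 0"
proof (rule ccontr)
  assume "b \<noteq> 0"
  \<comment> \<open>\<open>e\<close> is positive and at least \<open>c\<close>, and the chosen
    \<open>t\<close> minimizes \<open>t * b + t^2 * e\<close>; the minimum is negative unless
    \<open>b = 0\<close>.\<close>
  define e where "e = \<bar>c\<bar> + 1"
  define t where "t = - b / (2 * e)"
  have p: "0 < e" "c \<le> e" unfolding e_def by auto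
  have "t * b + t\<^sup>2 * c \<le> t * b + t\<^sup>2 * e"
    using p by (intro add_left_mono mult_left_mono) auto
  also have "\<dots> = - b\<^sup>2 / (4 * e)" unfolding t_def using p
    by (simp add: field_simps power2_eq_square)
  also have "\<dots> < 0" using \<open>b \<noteq> 0\<close> p by (simp add: field_simps)
  finally show False using assms[of t] by simp
qed

lemma bilinear_add_smult:
  fixes A :: "real mat"
  assumes A: "sym_mat n A" and x: "x \<in> carrier_vec n" and y: "y \<in> carrier_vec n"
  shows "(x + t \<cdot>\<^sub>v y) \<bullet> (A *\<^sub>v (x + t \<cdot>\<^sub>v y)) =
    x \<bullet> (A *\<^sub>v x) + 2 * t * (x \<bullet> (A *\<^sub>v y)) + t\<^sup>2 * (y \<bullet> (A *\<^sub>v y))"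
proof -
  have Ac: "A \<in> carrier_mat n n" using A by (auto simp: sym_mat_def)
  have "(x + t \<cdot>\<^sub>v y) \<bullet> (A *\<^sub>v (x + t \<cdot>\<^sub>v y)) = (x + t \<cdot>\<^sub>v y) \<bullet> (A *\<^sub>v x + t \<cdot>\<^sub>v (A *\<^sub>v y))"
    using mult_add_distrib_mat_vec[OF Ac x, of "t \<cdot>\<^sub>v y"] y mult_mat_vec[OF Ac y] by simp
  also have "\<dots> = x \<bullet> (A *\<^sub>v x) + t * (x \<bullet> (A *\<^sub>v y)) + (t * (y \<bullet> (A *\<^sub>v x)) + t * (t * (y \<bullet> (A *\<^sub>v y))))"
    using x y Ac by (simp add: scalar_prod_add_distrib[of _ n] add_scalar_prod_distrib[of _ n] distrib_left)
  also have "y \<bullet> (A *\<^sub>v x) = x \<bullet> (A *\<^sub>v y)" by (rule bilinear_sym[OF A y x])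
  finally show ?thesis by (simp add: power2_eq_square algebra_simps)
qed

lemma psd_Cauchy_Schwarz:
  assumes A: "psd_mat n A" and x: "x \<in> carrier_vec n" and y: "y \<in> carrier_vec n"
  shows "(x \<bullet> (A *\<^sub>v y))\<^sup>2 \<le> (x \<bullet> (A *\<^sub>v x)) * (y \<bullet> (A *\<^sub>v y))"
proof -
  have s: "sym_mat n A" using A by (simp add: psd_mat_def)
  have nn: "0 \<le> z \<bullet> (A *\<^sub>v z)" if "z \<in> carrier_vec n" for z using A that by (simp add: psd_mat_def)
  let ?a = "x \<bullet> (A *\<^sub>v x)" and ?b = "x \<bullet> (A *\<^sub>v y)" and ?c = "y \<bullet> (A *\<^sub>v y)"
  have ineq: "0 \<le> ?a + 2 * t * ?b + t\<^sup>2 * ?c" for t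
    using nn[of "x + t \<cdot>\<^sub>v y"] x y unfolding bilinear_add_smult[OF s x y] by simp
  show ?thesis
  proof (cases "?c = 0")
    case True
    have "?b = 0"
    proof (rule ccontr)
      assume b: "?b \<noteq> 0"
      \<comment> \<open>With \<open>?c = 0\<close> the form is affine in \<open>t\<close>, and this
        argument makes it equal to -1.\<close>
      have "2 * (-(?a + 1) / (2 * ?b)) * ?b = -(?a + 1)" using b by (simp add: field_simps)
      then show False using ineq[of "-(?a + 1) / (2 * ?b)"] unfolding True by linarith
    qed
    then show ?thesis using True by simp
  next
    case False
    then have c: "0 < ?c" using nn[OF y] by simp
    have "0 \<le> ?a + 2 * (- ?b / ?c) * ?b + (- ?b / ?c)\<^sup>2 * ?c" by (rule ineq)
    also have "\<dots> = ?a - ?b\<^sup>2 / ?c" using c by (simp add: field_simps power2_eq_square)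
    finally show ?thesis using c by (simp add: field_simps)
  qed
qed

text \<open>The constraint vectors become the rows of a square matrix padded with zero rows. Since
  \<open>k < n\<close>, row \<open>k\<close> is zero, so the determinant vanishes and the kernel is
  nontrivial. The matrix is returned too, because the Rayleigh maximization takes its constraints in
  the form of a kernel.\<close>

lemma exists_nonzero_orthogonal:
  fixes w :: "nat \<Rightarrow> real vec"
  assumes k: "k < n" and w: "\<And>i. i < k \<Longrightarrow> w i \<in> carrier_vec n"
  obtains L v where "L \<in> carrier_mat n n" "v \<in> carrier_vec n" "v \<noteq> 0\<^sub>v n" "L *\<^sub>v v = 0\<^sub>v n"
    "\<And>y. y \<in> carrier_vec n \<Longrightarrow> L *\<^sub>v y = 0\<^sub>v n \<longleftrightarrow> (\<forall>i<k. w i \<bullet> y = 0)"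
proof -
  define c where "c i = (if i < k then w i else 0\<^sub>v n)" for i
  define L where "L = mat\<^sub>r n n (\<lambda>i. if i = k then 0\<^sub>v n else c i)"
  have c: "c i \<in> carrier_vec n" for i unfolding c_def using w by auto
  have L: "L \<in> carrier_mat n n" unfolding L_def by auto
  have "det L = 0" unfolding L_def by (rule det_row_0[OF k]) (use c in auto)
  then obtain v where v: "v \<in> carrier_vec n" "v \<noteq> 0\<^sub>v n" "L *\<^sub>v v = 0\<^sub>v n"
    using det_0_iff_vec_prod_zero[OF L] by auto
  have "L *\<^sub>v y = 0\<^sub>v n \<longleftrightarrow> (\<forall>i<k. w i \<bullet> y = 0)" if y: "y \<in> carrier_vec n" for y
  proof -
    have r: "(L *\<^sub>v y) $ i = (if i < k then w i \<bullet> y else 0)" if "i < n" for i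
      using that L k y c unfolding L_def c_def by (auto simp: row_mat_of_row_fun)
    show ?thesis
    proof
      assume z: "L *\<^sub>v y = 0\<^sub>v n"
      show "\<forall>i<k. w i \<bullet> y = 0" using r k unfolding z by (metis index_zero_vec(1) less_trans)
    next
      assume "\<forall>i<k. w i \<bullet> y = 0"
      then show "L *\<^sub>v y = 0\<^sub>v n" using r L by (intro eq_vecI) auto
    qed
  qed
  then show ?thesis using that L v by blast
qed

text \<open>The vectors are found one at a time by maximizing the Rayleigh quotient of \<open>B\<close> relative
  to \<open>A\<close> on the \<open>A\<close>-orthogonal complement of the previous ones.\<close>

lemma exists_jointly_orthogonal:
  fixes A B :: "real mat"
  assumes A: "pd_mat n A" and B: "sym_mat n B" and "k \<le> n"
  shows "\<exists>x :: nat \<Rightarrow> real vec. (\<forall>i<k. x i \<in> carrier_vec n) \<and>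
    (\<forall>i<k. \<forall>j<k. x i \<bullet> (A *\<^sub>v x j) = (if i = j then 1 else 0)) \<and>
    (\<forall>i<k. \<forall>j<k. i \<noteq> j \<longrightarrow> x i \<bullet> (B *\<^sub>v x j) = 0) \<and>
    (\<forall>y\<in>carrier_vec n. (\<forall>i<k. x i \<bullet> (A *\<^sub>v y) = 0) \<longrightarrow> (\<forall>i<k. x i \<bullet> (B *\<^sub>v y) = 0))"
  using \<open>k \<le> n\<close>
proof (induction k)
  case 0
  then show ?case by simp
next
  case (Suc k)
  from Suc.IH[OF Suc_leD[OF Suc.prems]] obtain x :: "nat \<Rightarrow> real vec" where X: "\<forall>i<k. x i \<in> carrier_vec n"
    "\<forall>i<k. \<forall>j<k. x i \<bullet> (A *\<^sub>v x j) = (if i = j then 1 else 0)"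
    "\<forall>i<k. \<forall>j<k. i \<noteq> j \<longrightarrow> x i \<bullet> (B *\<^sub>v x j) = 0"
    "\<forall>y\<in>carrier_vec n. (\<forall>i<k. x i \<bullet> (A *\<^sub>v y) = 0) \<longrightarrow> (\<forall>i<k. x i \<bullet> (B *\<^sub>v y) = 0)"
    by (elim exE conjE)
  have xc: "\<And>i. i < k \<Longrightarrow> x i \<in> carrier_vec n"
    and xA: "\<And>i j. i < k \<Longrightarrow> j < k \<Longrightarrow> x i \<bullet> (A *\<^sub>v x j) = (if i = j then 1 else 0)"
    and xB: "\<And>i j. i < k \<Longrightarrow> j < k \<Longrightarrow> i \<noteq> j \<Longrightarrow> x i \<bullet> (B *\<^sub>v x j) = 0"
    using X(1-3) by blast+
  \<comment> \<open>This invariant drives the induction: the next vector is chosen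
    \<open>A\<close>-orthogonal to the earlier ones only, and inherits
    \<open>B\<close>-orthogonality from here.\<close>
  have xV: "x i \<bullet> (B *\<^sub>v y) = 0"
    if "y \<in> carrier_vec n" "\<And>i. i < k \<Longrightarrow> x i \<bullet> (A *\<^sub>v y) = 0" "i < k" for y i
    using X(4) that by blast
  have sA: "sym_mat n A" and Ac: "A \<in> carrier_mat n n" and Bc: "B \<in> carrier_mat n n"
    using A B by (auto simp: pd_mat_def sym_mat_def)
  have w: "A *\<^sub>v x i \<in> carrier_vec n" if "i < k" for i using Ac xc that by simp
  obtain L v0 where L: "L \<in> carrier_mat n n" and v0: "v0 \<in> carrier_vec n" "v0 \<noteq> 0\<^sub>v n" "L *\<^sub>v v0 = 0\<^sub>v n"
    and Lk: "\<And>y. y \<in> carrier_vec n \<Longrightarrow> L *\<^sub>v y = 0\<^sub>v n \<longleftrightarrow> (\<forall>i<k. (A *\<^sub>v x i) \<bullet> y = 0)"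
    by (rule exists_nonzero_orthogonal[of k n "\<lambda>i. A *\<^sub>v x i"]) (use Suc.prems w in auto)
  have Lk': "L *\<^sub>v y = 0\<^sub>v n \<longleftrightarrow> (\<forall>i<k. x i \<bullet> (A *\<^sub>v y) = 0)" if y: "y \<in> carrier_vec n" for y
  proof -
    have "(A *\<^sub>v x i) \<bullet> y = x i \<bullet> (A *\<^sub>v y)" if "i < k" for i
      using comm_scalar_prod[of "A *\<^sub>v x i" n y] bilinear_sym[OF sA y xc[OF that]] Ac xc[OF that] y by simp
    then show ?thesis using Lk[OF y] by auto
  qed
  obtain v where v: "v \<in> carrier_vec n" and Lv: "L *\<^sub>v v = 0\<^sub>v n" and v1: "v \<bullet> (A *\<^sub>v v) = 1"
    and max: "\<And>y. y \<in> carrier_vec n \<Longrightarrow> L *\<^sub>v y = 0\<^sub>v n \<Longrightarrow> y \<bullet> (B *\<^sub>v y) \<le> (v \<bullet> (B *\<^sub>v v)) * (y \<bullet> (A *\<^sub>v y))"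
    using exists_rayleigh_maximizer[OF A Bc L v0] by metis
  let ?m = "v \<bullet> (B *\<^sub>v v)"
  \<comment> \<open>Perturbing the maximizer inside the constraint space yields the generalized
    eigenvalue equation, tested against that space. It extends the invariant to the new vector
    \<open>v\<close>.\<close>
  have stat: "v \<bullet> (B *\<^sub>v y) = ?m * (v \<bullet> (A *\<^sub>v y))" if y: "y \<in> carrier_vec n" and Ly: "L *\<^sub>v y = 0\<^sub>v n" for y
  proof -
    have "0 \<le> t * (2 * (?m * (v \<bullet> (A *\<^sub>v y)) - v \<bullet> (B *\<^sub>v y))) + t\<^sup>2 * (?m * (y \<bullet> (A *\<^sub>v y)) - y \<bullet> (B *\<^sub>v y))" for t
    proof -
      have z: "v + t \<cdot>\<^sub>v y \<in> carrier_vec n" using v y by simp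
      have "L *\<^sub>v (v + t \<cdot>\<^sub>v y) = 0\<^sub>v n"
        using mult_add_distrib_mat_vec[OF L v, of "t \<cdot>\<^sub>v y"] mult_mat_vec[OF L y] y Lv Ly by auto
      from max[OF z this] show ?thesis
        unfolding bilinear_add_smult[OF sA v y] bilinear_add_smult[OF B v y] v1
        by (simp add: algebra_simps)
    qed
    from quadratic_nonneg_linear_zero[OF this] show ?thesis by simp
  qed
  define x' where "x' i = (if i < k then x i else v)" for i
  have vk: "x i \<bullet> (A *\<^sub>v v) = 0" "v \<bullet> (A *\<^sub>v x i) = 0" "x i \<bullet> (B *\<^sub>v v) = 0" "v \<bullet> (B *\<^sub>v x i) = 0" if "i < k" for i
  proof -
    show 1: "x i \<bullet> (A *\<^sub>v v) = 0" using Lk'[OF v] Lv that by simp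
    show "v \<bullet> (A *\<^sub>v x i) = 0" using bilinear_sym[OF sA v xc[OF that]] 1 by simp
    show 2: "x i \<bullet> (B *\<^sub>v v) = 0" using xV[OF v _ that] Lk'[OF v] Lv by simp
    show "v \<bullet> (B *\<^sub>v x i) = 0" using bilinear_sym[OF B v xc[OF that]] 2 by simp
  qed
  show ?case
  proof (intro exI[of _ x'] conjI allI impI ballI)
    fix i assume "i < Suc k"
    then show "x' i \<in> carrier_vec n" unfolding x'_def using xc v by auto
  next
    fix i j assume "i < Suc k" "j < Suc k"
    then show "x' i \<bullet> (A *\<^sub>v x' j) = (if i = j then 1 else 0)"
      unfolding x'_def using xA vk v1 by (auto simp: less_Suc_eq)
  next
    fix i j assume "i < Suc k" "j < Suc k" "i \<noteq> j"
    then show "x' i \<bullet> (B *\<^sub>v x' j) = 0"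
      unfolding x'_def using xB vk by (auto simp: less_Suc_eq)
  next
    fix y :: "real vec" and i assume y: "y \<in> carrier_vec n" and o: "\<forall>i<Suc k. x' i \<bullet> (A *\<^sub>v y) = 0" and i: "i < Suc k"
    have o1: "x i \<bullet> (A *\<^sub>v y) = 0" if "i < k" for i using o[rule_format, of i] that unfolding x'_def by simp
    have o2: "v \<bullet> (A *\<^sub>v y) = 0" using o[rule_format, of k] unfolding x'_def by simp
    show "x' i \<bullet> (B *\<^sub>v y) = 0"
    proof (cases "i < k")
      case True
      then show ?thesis unfolding x'_def using xV[OF y o1 True] by simp
    next
      case False
      then show ?thesis unfolding x'_def using stat[OF y] Lk'[OF y] o1 o2 by simp
    qed
  qed
qed

lemma index_congruence:
  fixes A :: "real mat"
  assumes P: "P \<in> carrier_mat n m" and A: "A \<in> carrier_mat n n" and "i < m" "j < m"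
  shows "(transpose_mat P * A * P) $$ (i, j) = col P i \<bullet> (A *\<^sub>v col P j)"
proof -
  have "transpose_mat P * A * P = transpose_mat P * (A * P)"
    by (rule assoc_mult_mat[of _ m n _ n _ m]) (use assms in auto)
  then show ?thesis using assms by (auto simp: col_mult2[OF A P] mult_mat_vec_def)
qed

lemma simultaneous_diagonalization:
  fixes A B :: "real mat"
  assumes A: "pd_mat n A" and B: "sym_mat n B"
  obtains P \<mu> where "P \<in> carrier_mat n n" "transpose_mat P * A * P = 1\<^sub>m n"
    "transpose_mat P * B * P = mat n n (\<lambda>(i, j). if i = j then \<mu> i else 0)"
    "\<And>i. i < n \<Longrightarrow> \<mu> i = col P i \<bullet> (B *\<^sub>v col P i)"
proof -
  obtain x :: "nat \<Rightarrow> real vec" where xc: "\<And>i. i < n \<Longrightarrow> x i \<in> carrier_vec n"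
    and xA: "\<And>i j. i < n \<Longrightarrow> j < n \<Longrightarrow> x i \<bullet> (A *\<^sub>v x j) = (if i = j then 1 else 0)"
    and xB: "\<And>i j. i < n \<Longrightarrow> j < n \<Longrightarrow> i \<noteq> j \<Longrightarrow> x i \<bullet> (B *\<^sub>v x j) = 0"
    using exists_jointly_orthogonal[OF A B order_refl] by metis
  have Ac: "A \<in> carrier_mat n n" and Bc: "B \<in> carrier_mat n n"
    using A B by (auto simp: pd_mat_def sym_mat_def)
  define P where "P = mat n n (\<lambda>(i, j). x j $ i)"
  have P: "P \<in> carrier_mat n n" unfolding P_def by simp
  have col: "col P j = x j" if "j < n" for j using xc[OF that] that unfolding P_def by (intro eq_vecI) auto
  show ?thesis
  proof (rule that[of P "\<lambda>i. x i \<bullet> (B *\<^sub>v x i)"])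
    show "transpose_mat P * A * P = 1\<^sub>m n"
      by (rule eq_matI) (use P Ac in \<open>auto simp: index_congruence[OF P Ac] col xA simp del: index_mult_mat(1) assoc_mult_mat\<close>)
    show "transpose_mat P * B * P = mat n n (\<lambda>(i, j). if i = j then x i \<bullet> (B *\<^sub>v x i) else 0)"
      by (rule eq_matI) (use P Bc in \<open>auto simp: index_congruence[OF P Bc] col xB simp del: index_mult_mat(1) assoc_mult_mat\<close>)
  qed (use P col in auto)
qed

subsection \<open>Strong convexity of the log-determinant\<close>

definition frob_sq :: "real mat \<Rightarrow> real" where
  "frob_sq A = (\<Sum>i<dim_row A. \<Sum>j<dim_col A. (A $$ (i, j))\<^sup>2)"

lemma frob_sq_transpose: "frob_sq (transpose_mat A) = frob_sq A"
  unfolding frob_sq_def by (simp, subst sum.swap) auto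

lemma frob_sq_cols: "frob_sq A = (\<Sum>j<dim_col A. col A j \<bullet> col A j)"
  unfolding frob_sq_def scalar_prod_def
  by (subst sum.swap) (auto intro!: sum.cong simp: power2_eq_square lessThan_atLeast0)

lemma frob_sq_mult_le:
  assumes G: "G \<in> carrier_mat n m" and A: "A \<in> carrier_mat m k"
    and bound: "\<And>y. y \<in> carrier_vec m \<Longrightarrow> (G *\<^sub>v y) \<bullet> (G *\<^sub>v y) \<le> a * (y \<bullet> y)"
  shows "frob_sq (G * A) \<le> a * frob_sq A"
proof -
  have "frob_sq (G * A) = (\<Sum>j<k. (G *\<^sub>v col A j) \<bullet> (G *\<^sub>v col A j))"
    unfolding frob_sq_cols using G A 
    by (auto intro!: sum.cong simp: col_mult2[OF G A] mult_mat_vec_def)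
  also have "\<dots> \<le> (\<Sum>j<k. a * (col A j \<bullet> col A j))"
    by (rule sum_mono, rule bound) (use A in auto)
  also have "\<dots> = a * frob_sq A" unfolding frob_sq_cols using A by (simp add: sum_distrib_left)
  finally show ?thesis .
qed

text \<open>With \<open>z = R x\<close>, the square norm of \<open>z\<close> is the product of
  \<open>transpose R z\<close> with \<open>x\<close>. Cauchy-Schwarz and the bound on the transpose
  then leave a factor \<open>z \<bullet> z\<close> to cancel, which is why the case of a vanishing
  \<open>z\<close> is separate.\<close>

lemma sq_bound_transpose:
  fixes R :: "real mat"
  assumes R: "R \<in> carrier_mat n m" and a: "0 \<le> a"
    and bound: "\<And>y. y \<in> carrier_vec n \<Longrightarrow> (transpose_mat R *\<^sub>v y) \<bullet> (transpose_mat R *\<^sub>v y) \<le> a * (y \<bullet> y)"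
    and x: "x \<in> carrier_vec m"
  shows "(R *\<^sub>v x) \<bullet> (R *\<^sub>v x) \<le> a * (x \<bullet> x)"
proof -
  let ?z = "R *\<^sub>v x" let ?w = "transpose_mat R *\<^sub>v ?z"
  have z: "?z \<in> carrier_vec n" and w: "?w \<in> carrier_vec m" using R x by auto
  have "?z \<bullet> ?z = ?w \<bullet> x" using transpose_vec_mult_scalar[OF R x z] by simp
  then have "(?z \<bullet> ?z)\<^sup>2 \<le> (?w \<bullet> ?w) * (x \<bullet> x)" using Cauchy_Schwarz_vec[OF w x] by simp
  also have "\<dots> \<le> (a * (?z \<bullet> ?z)) * (x \<bullet> x)"
    by (rule mult_right_mono[OF bound[OF z] scalar_prod_self_nonneg])
  finally have le: "(?z \<bullet> ?z) * (?z \<bullet> ?z) \<le> (?z \<bullet> ?z) * (a * (x \<bullet> x))"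
    by (simp add: power2_eq_square algebra_simps)
  show ?thesis
  proof (cases "?z \<bullet> ?z = 0")
    case True
    then show ?thesis using a scalar_prod_self_nonneg[of x] by simp
  next
    case False
    then have "0 < ?z \<bullet> ?z" using scalar_prod_self_nonneg[of ?z] by linarith
    then show ?thesis using le by simp
  qed
qed

lemma mat_trace_comm:
  assumes "A \<in> carrier_mat n m" "B \<in> carrier_mat m n"
  shows "mat_trace (A * B) = mat_trace (B * A)"
proof -
  have "mat_trace (A * B) = (\<Sum>i<n. \<Sum>j<m. A $$ (i, j) * B $$ (j, i))"
    unfolding mat_trace_def using assms by (auto simp: scalar_prod_def lessThan_atLeast0 intro!: sum.cong)
  also have "\<dots> = (\<Sum>j<m. \<Sum>i<n. B $$ (j, i) * A $$ (i, j))" by (subst sum.swap) (simp add: mult.commute)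
  also have "\<dots> = mat_trace (B * A)"
    unfolding mat_trace_def using assms by (auto simp: scalar_prod_def lessThan_atLeast0 intro!: sum.cong)
  finally show ?thesis .
qed

lemma mat_trace_mult_sum:
  assumes "A \<in> carrier_mat n m" "B \<in> carrier_mat m n"
  shows "mat_trace (A * B) = (\<Sum>i<n. \<Sum>j<m. A $$ (i, j) * B $$ (j, i))"
  unfolding mat_trace_def using assms by (auto simp: scalar_prod_def lessThan_atLeast0 intro!: sum.cong)

lemma pd_one: "pd_mat n (1\<^sub>m n)"
  unfolding pd_mat_def sym_mat_def using scalar_prod_self_pos by auto

lemma det_diag_mat:
  "det (mat n n (\<lambda>(i, j). if i = j then \<mu> i else 0)) = (\<Prod>i<n. \<mu> i :: real)"
proof -
  let ?D = "mat n n (\<lambda>(i, j). if i = j then \<mu> i else 0)"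
  have "det ?D = prod_list (diag_mat ?D)"
    by (rule det_upper_triangular[of _ n]) auto
  also have "\<dots> = (\<Prod>i<n. \<mu> i)" by (simp add: prod_list_diag_prod lessThan_atLeast0)
  finally show ?thesis .
qed

lemma det_congruence:
  fixes A :: "real mat"
  assumes "P \<in> carrier_mat n n" "A \<in> carrier_mat n n"
  shows "det (transpose_mat P * A * P) = (det P)\<^sup>2 * det A"
proof -
  have "det (transpose_mat P * A * P) = det (transpose_mat P * A) * det P"
    by (rule det_mult[of _ n]) (use assms in auto)
  also have "det (transpose_mat P * A) = det (transpose_mat P) * det A"
    by (rule det_mult[of _ n]) (use assms in auto)
  also have "det (transpose_mat P) = det P" by (rule det_transpose[OF assms(1)])
  finally show ?thesis by (simp add: power2_eq_square)
qed

lemma pd_congruence_pos: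
  assumes A: "pd_mat n A" and B: "pd_mat n B" and P: "P \<in> carrier_mat n n"
    and PA: "transpose_mat P * A * P = 1\<^sub>m n" and i: "i < n"
  shows "0 < col P i \<bullet> (B *\<^sub>v col P i)"
proof -
  have Ac: "A \<in> carrier_mat n n" using A by (auto simp: pd_mat_def sym_mat_def)
  have "col P i \<bullet> (A *\<^sub>v col P i) = 1"
    using index_congruence[OF P Ac i i] i unfolding PA by simp
  then have "col P i \<noteq> 0\<^sub>v n" using Ac by auto
  then show ?thesis using B P i unfolding pd_mat_def by auto
qed

lemma pd_det_pos:
  assumes B: "pd_mat n B"
  shows "0 < det B"
proof -
  have s: "sym_mat n B" and Bc: "B \<in> carrier_mat n n" using B by (auto simp: pd_mat_def sym_mat_def)
  obtain P \<mu> where P: "P \<in> carrier_mat n n" and PA: "transpose_mat P * 1\<^sub>m n * P = 1\<^sub>m n"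
    and PB: "transpose_mat P * B * P = mat n n (\<lambda>(i, j). if i = j then \<mu> i else 0)"
    and mu: "\<And>i. i < n \<Longrightarrow> \<mu> i = col P i \<bullet> (B *\<^sub>v col P i)"
    by (rule simultaneous_diagonalization[OF pd_one s]) (rule that)
  have "(det P)\<^sup>2 = 1" using det_congruence[OF P, of "1\<^sub>m n"] unfolding PA by simp
  then have "det B = (\<Prod>i<n. \<mu> i)"
    using det_congruence[OF P Bc] unfolding PB det_diag_mat by simp
  then show ?thesis using mu pd_congruence_pos[OF pd_one B P PA] by (auto intro!: prod_pos)
qed

section \<open>Scalar quadratic bounds for the logarithm\<close>

lemma ln_quadratic_bound_pos:
  fixes u :: real
  assumes "0 \<le> u"
  shows "ln (1 + u) + u\<^sup>2 / (2 * (1 + u)) \<le> u"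
proof -
  \<comment> \<open>The gap between the two sides vanishes at 0 and has derivative
    \<open>x^2 / (2 * (1 + x)^2)\<close>.\<close>
  define f where "f u = u - ln (1 + u) - u\<^sup>2 / (2 * (1 + u))" for u :: real
  have "f 0 \<le> f u"
  proof (rule DERIV_nonneg_imp_nondecreasing[OF assms])
    fix x :: real assume x: "0 \<le> x" "x \<le> u"
    have "(f has_real_derivative (1 - 1 / (1 + x) - (2 * x * (2 * (1 + x)) - x\<^sup>2 * 2) / (2 * (1 + x))\<^sup>2)) (at x)"
      unfolding f_def using x by (auto intro!: derivative_eq_intros simp: power2_eq_square)
    moreover have "1 - 1 / (1 + x) - (2 * x * (2 * (1 + x)) - x\<^sup>2 * 2) / (2 * (1 + x))\<^sup>2 = x\<^sup>2 / (2 * (1 + x)\<^sup>2)"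
      using x by (simp add: divide_simps) (simp add: power2_eq_square algebra_simps)
    ultimately show "\<exists>y. (f has_real_derivative y) (at x) \<and> 0 \<le> y" by (metis zero_le_divide_iff zero_le_mult_iff zero_le_numeral zero_le_power2)
  qed
  then show ?thesis unfolding f_def by simp
qed

lemma ln_quadratic_bound_neg:
  fixes u :: real
  assumes "-1 < u" "u \<le> 0"
  shows "ln (1 + u) + u\<^sup>2 / 2 \<le> u"
proof -
  define f where "f u = u - ln (1 + u) - u\<^sup>2 / 2" for u :: real
  have "f 0 \<le> f u"
  proof (rule DERIV_nonpos_imp_nonincreasing[OF assms(2)])
    fix x :: real assume x: "u \<le> x" "x \<le> 0"
    have "(f has_real_derivative (1 - 1 / (1 + x) - x)) (at x)"
      unfolding f_def using x assms by (auto intro!: derivative_eq_intros)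
    moreover have "1 - 1 / (1 + x) - x = - x\<^sup>2 / (1 + x)"
      using x assms by (simp add: field_simps power2_eq_square)
    moreover have "- x\<^sup>2 / (1 + x) \<le> 0" using x assms by (simp add: divide_nonpos_pos)
    ultimately show "\<exists>y. (f has_real_derivative y) (at x) \<and> y \<le> 0" by metis
  qed
  then show ?thesis unfolding f_def by simp
qed

text \<open>One denominator \<open>1 + x\<close>, common to all deviations of size at most
  \<open>x\<close>, allows these bounds to be added over all eigenvalues.\<close>

lemma ln_quadratic_bound:
  fixes \<mu> x :: real
  assumes "0 < \<mu>" "\<bar>\<mu> - 1\<bar> \<le> x"
  shows "ln \<mu> + (\<mu> - 1)\<^sup>2 / (2 * (1 + x)) \<le> \<mu> - 1"
proof (cases "1 \<le> \<mu>")
  case True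
  have "(\<mu> - 1)\<^sup>2 / (2 * (1 + x)) \<le> (\<mu> - 1)\<^sup>2 / (2 * (1 + (\<mu> - 1)))"
    using assms True by (intro divide_left_mono) auto
  then show ?thesis using ln_quadratic_bound_pos[of "\<mu> - 1"] True by simp
next
  case False
  have "(\<mu> - 1)\<^sup>2 / (2 * (1 + x)) \<le> (\<mu> - 1)\<^sup>2 / 2"
    using assms by (intro divide_left_mono) auto
  moreover have "ln \<mu> + (\<mu> - 1)\<^sup>2 / 2 \<le> \<mu> - 1"
    using ln_quadratic_bound_neg[of "\<mu> - 1"] False assms by simp
  ultimately show ?thesis by linarith
qed

text \<open>Strong convexity of \<open>- ln det\<close> in a global, self-concordant form: the modulus
  \<open>x\<^sup>2 / (2 * (1 + x))\<close> needs no a priori bound on \<open>B\<close>.\<close>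

lemma ln_det_bregman:
  fixes A B Ai :: "real mat"
  assumes A: "pd_mat n A" and B: "pd_mat n B" and Ai: "Ai \<in> carrier_mat n n" "A * Ai = 1\<^sub>m n"
    and a: "0 \<le> a" "\<And>y. y \<in> carrier_vec n \<Longrightarrow> y \<bullet> (A *\<^sub>v y) \<le> a * (y \<bullet> y)"
  obtains x where "0 \<le> x" "frob_sq (B - A) \<le> a\<^sup>2 * x\<^sup>2"
    "ln (det B) - ln (det A) + x\<^sup>2 / (2 * (1 + x)) \<le> mat_trace (Ai * (B - A))"
proof -
  have Ac: "A \<in> carrier_mat n n" and At: "transpose_mat A = A" and sB: "sym_mat n B" and Bc: "B \<in> carrier_mat n n"
    using A B by (auto simp: pd_mat_def sym_mat_def)
  obtain P \<mu> where P: "P \<in> carrier_mat n n" and PA: "transpose_mat P * A * P = 1\<^sub>m n"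
    and PB: "transpose_mat P * B * P = mat n n (\<lambda>(i, j). if i = j then \<mu> i else 0)"
    and mu: "\<And>i. i < n \<Longrightarrow> \<mu> i = col P i \<bullet> (B *\<^sub>v col P i)"
    by (rule simultaneous_diagonalization[OF A sB]) (rule that)
  let ?T = "transpose_mat P"
  have T: "?T \<in> carrier_mat n n" using P by simp
  have pos: "0 < \<mu> i" if "i < n" for i using mu[OF that] pd_congruence_pos[OF A B P PA that] by simp
  \<comment> \<open>This is the Frobenius norm of \<open>A^(-1/2) (B - A) A^(-1/2)\<close>, the
    local norm of \<open>B - A\<close> at \<open>A\<close>: the numbers \<open>\<mu> i - 1\<close>
    are the eigenvalues of that matrix.\<close>
  define x where "x = sqrt (\<Sum>i<n. (\<mu> i - 1)\<^sup>2)"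
  have x0: "0 \<le> x" unfolding x_def by (simp add: sum_nonneg)
  have x2: "x\<^sup>2 = (\<Sum>i<n. (\<mu> i - 1)\<^sup>2)" unfolding x_def by (simp add: sum_nonneg)
  have dA: "0 < det A" and dB: "0 < det B" using pd_det_pos A B by auto
  have d1: "(det P)\<^sup>2 * det A = 1" using det_congruence[OF P Ac] unfolding PA by simp
  have d2: "(det P)\<^sup>2 * det B = (\<Prod>i<n. \<mu> i)"
    using det_congruence[OF P Bc] unfolding PB det_diag_mat by simp
  have "det B = det A * (\<Prod>i<n. \<mu> i)"
    using d1 d2 by (metis mult.assoc mult.commute mult.right_neutral)
  moreover have "0 < (\<Prod>i<n. \<mu> i)" using pos by (auto intro: prod_pos)
  ultimately have "ln (det B) = ln (det A) + ln (\<Prod>i<n. \<mu> i)"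
    using dA ln_mult_pos by metis
  also have "ln (\<Prod>i<n. \<mu> i) = (\<Sum>i<n. ln (\<mu> i))" using pos by (intro ln_prod) force+
  finally have ldet: "ln (det B) - ln (det A) = (\<Sum>i<n. ln (\<mu> i))" by simp
  have N: "B - A \<in> carrier_mat n n" by (rule minus_carrier_mat[OF Ac])
  have "?T * A * P = 1\<^sub>m n \<Longrightarrow> P * (?T * A) = 1\<^sub>m n"
    by (rule mat_mult_left_right_inverse) (use T Ac P in auto)
  then have PTA: "P * ?T * A = 1\<^sub>m n" using PA assoc_mult_mat[OF P T Ac] by simp
  have AiP: "Ai = P * ?T"
  proof -
    have "P * ?T * (A * Ai) = P * ?T * A * Ai"
      using assoc_mult_mat[of "P * ?T" n n A n Ai n] P T Ac Ai by simp
    then show ?thesis unfolding PTA Ai(2) using Ai(1) P T by simp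
  qed
  have E: "?T * (B - A) * P = mat n n (\<lambda>(i, j). if i = j then \<mu> i - 1 else 0)"
  proof -
    have "?T * (B - A) * P = (?T * B - ?T * A) * P" using mult_minus_distrib_mat[OF T Bc Ac] by simp
    also have "\<dots> = ?T * B * P - ?T * A * P" by (rule minus_mult_distrib_mat[of _ n n]) (use T Bc Ac P in auto)
    finally show ?thesis unfolding PA PB by (auto intro!: eq_matI)
  qed
  let ?E = "?T * (B - A) * P"
  have Ec: "?E \<in> carrier_mat n n" using T N P by auto
  have tr: "mat_trace (Ai * (B - A)) = (\<Sum>i<n. \<mu> i - 1)"
  proof -
    have "mat_trace (Ai * (B - A)) = mat_trace (P * (?T * (B - A)))" unfolding AiP using assoc_mult_mat[OF P T N] by simp
    also have "\<dots> = mat_trace ?E" by (rule mat_trace_comm[of _ n n]) (use P T N in auto)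
    finally show ?thesis unfolding E by (simp add: mat_trace_def)
  qed
  have each: "ln (\<mu> i) + (\<mu> i - 1)\<^sup>2 / (2 * (1 + x)) \<le> \<mu> i - 1" if "i < n" for i
  proof (rule ln_quadratic_bound[OF pos[OF that]])
    have "(\<mu> i - 1)\<^sup>2 \<le> x\<^sup>2" unfolding x2 using that by (intro member_le_sum) auto
    then show "\<bar>\<mu> i - 1\<bar> \<le> x" using x0 by (simp add: abs_le_square_iff[symmetric])
  qed
  have "(\<Sum>i<n. ln (\<mu> i)) + x\<^sup>2 / (2 * (1 + x)) = (\<Sum>i<n. ln (\<mu> i) + (\<mu> i - 1)\<^sup>2 / (2 * (1 + x)))"
    unfolding x2 by (simp add: sum.distrib sum_divide_distrib)
  also have "\<dots> \<le> (\<Sum>i<n. \<mu> i - 1)" by (rule sum_mono) (use each in auto)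
  finally have main: "ln (det B) - ln (det A) + x\<^sup>2 / (2 * (1 + x)) \<le> mat_trace (Ai * (B - A))"
    unfolding tr ldet .
  \<comment> \<open>\<open>R\<close> is the inverse transpose of \<open>P\<close> and satisfies
    \<open>R * transpose_mat R = A\<close>. Hence \<open>B - A\<close> is a diagonal matrix between
    \<open>R\<close> and its transpose, and each of the two factors costs \<open>a\<close> in
    squared Frobenius norm.\<close>
  define R where "R = A * P"
  have R: "R \<in> carrier_mat n n" unfolding R_def using Ac P by simp
  have Rt: "transpose_mat R = ?T * A" unfolding R_def using transpose_mult[OF Ac P] At by simp
  have AP: "A * (P * ?T) = 1\<^sub>m n" using Ai AiP by simp
  have RRt: "R * transpose_mat R = A"
  proof -
    have "R * transpose_mat R = A * (P * (?T * A))" unfolding Rt unfolding R_def by (rule assoc_mult_mat) (use Ac P T in auto)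
    also have "\<dots> = A * 1\<^sub>m n" using PTA assoc_mult_mat[OF P T Ac] by simp
    finally show ?thesis using Ac by simp
  qed
  have NR: "B - A = R * (?E * transpose_mat R)"
  proof -
    have "R * (?E * transpose_mat R) = A * P * (?T * (B - A) * P * (?T * A))" unfolding Rt unfolding R_def ..
    also have "\<dots> = A * P * (?T * ((B - A) * (P * (?T * A))))"
      using T N P Ac by (simp add: assoc_mult_mat[of _ n n _ n _ n])
    also have "P * (?T * A) = 1\<^sub>m n" using PTA assoc_mult_mat[OF P T Ac] by simp
    also have "(B - A) * 1\<^sub>m n = B - A" by (rule right_mult_one_mat[OF N])
    also have "A * P * (?T * (B - A)) = A * (P * ?T) * (B - A)"
      using T N P Ac by (simp add: assoc_mult_mat[of _ n n _ n _ n])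
    also have "\<dots> = B - A" unfolding AP by (rule left_mult_one_mat[OF N])
    finally show ?thesis by simp
  qed
  have bt: "(transpose_mat R *\<^sub>v y) \<bullet> (transpose_mat R *\<^sub>v y) \<le> a * (y \<bullet> y)" if y: "y \<in> carrier_vec n" for y
  proof -
    have w: "transpose_mat R *\<^sub>v y \<in> carrier_vec n" using R y by simp
    have "(transpose_mat R *\<^sub>v y) \<bullet> (transpose_mat R *\<^sub>v y) = y \<bullet> (R *\<^sub>v (transpose_mat R *\<^sub>v y))"
      by (rule transpose_vec_mult_scalar[OF R w y])
    also have "R *\<^sub>v (transpose_mat R *\<^sub>v y) = A *\<^sub>v y"
      using assoc_mult_mat_vec[of R n n "transpose_mat R" n y] R y RRt by simp
    finally show ?thesis using a(2)[OF y] by simp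
  qed
  have b: "(R *\<^sub>v y) \<bullet> (R *\<^sub>v y) \<le> a * (y \<bullet> y)" if y: "y \<in> carrier_vec n" for y
    by (rule sq_bound_transpose[OF R a(1) bt y])
  have ER: "?E * transpose_mat R \<in> carrier_mat n n"
    by (rule mult_carrier_mat[OF Ec]) (use R in simp)
  have "frob_sq (B - A) \<le> a * frob_sq (?E * transpose_mat R)"
    by (subst NR, rule frob_sq_mult_le[OF R ER b])
  also have "frob_sq (?E * transpose_mat R) = frob_sq (R * transpose_mat ?E)"
    by (subst frob_sq_transpose[symmetric]) (use transpose_mult[OF Ec, of "transpose_mat R" n] R in simp)
  also have "a * frob_sq (R * transpose_mat ?E) \<le> a * (a * frob_sq (transpose_mat ?E))"
    by (rule mult_left_mono[OF frob_sq_mult_le[OF R _ b] a(1)]) (use Ec in auto)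
  also have "frob_sq (transpose_mat ?E) = x\<^sup>2"
  proof -
    have "frob_sq ?E = (\<Sum>i<n. \<Sum>j<n. if i = j then (\<mu> i - 1)\<^sup>2 else 0)"
      unfolding E frob_sq_def by (simp add: if_distrib[of "\<lambda>x. x\<^sup>2"] cong: if_cong)
    then show ?thesis unfolding frob_sq_transpose x2 by simp
  qed
  finally have "frob_sq (B - A) \<le> a\<^sup>2 * x\<^sup>2" by (simp add: power2_eq_square)
  then show ?thesis using that x0 main by blast
qed

subsection \<open>Existence and uniqueness of the graphical Lasso solution\<close>

lemma inverse_exists_det:
  fixes A :: "real mat"
  assumes A: "A \<in> carrier_mat n n" and d: "det A \<noteq> 0"
  obtains B where "B \<in> carrier_mat n n" "A * B = 1\<^sub>m n" "B * A = 1\<^sub>m n"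
  using det_non_zero_imp_unit[OF A d, of undefined] unfolding Units_def ring_mat_def by auto

lemma unit_bilinear:
  fixes A :: "real mat"
  assumes "A \<in> carrier_mat n m" "i < n" "j < m"
  shows "unit_vec n i \<bullet> (A *\<^sub>v unit_vec m j) = A $$ (i, j)"
  using assms by (simp add: scalar_prod_left_unit scalar_prod_right_unit)

lemma psd_diag_nonneg:
  assumes "psd_mat n S" "i < n"
  shows "0 \<le> S $$ (i, i)"
  using assms unit_bilinear[of S n n i i] unfolding psd_mat_def sym_mat_def
  by (metis unit_vec_carrier)

lemma pd_diag_pos:
  assumes "pd_mat n S" "i < n"
  shows "0 < S $$ (i, i)"
proof -
  have "S \<in> carrier_mat n n" using assms by (auto simp: pd_mat_def sym_mat_def)
  moreover have "unit_vec n i \<noteq> (0\<^sub>v n :: real vec)" using assms(2)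
    by (metis index_unit_vec(1) index_zero_vec(1) one_neq_zero)
  ultimately show ?thesis
    using assms unit_bilinear[of S n n i i] unfolding pd_mat_def by (metis unit_vec_carrier)
qed

lemma pd_imp_psd: "pd_mat n A \<Longrightarrow> psd_mat n A"
  unfolding pd_mat_def psd_mat_def sym_mat_def
  by (metis less_eq_real_def scalar_prod_left_zero mult_mat_vec_carrier)

lemma psd_entry_bound:
  assumes S: "psd_mat n S" and ij: "i < n" "j < n"
  shows "\<bar>S $$ (i, j)\<bar> \<le> sqrt (S $$ (i, i) * S $$ (j, j))"
proof -
  have "S \<in> carrier_mat n n" using S by (auto simp: psd_mat_def sym_mat_def)
  then have "(S $$ (i, j))\<^sup>2 \<le> S $$ (i, i) * S $$ (j, j)"
    using psd_Cauchy_Schwarz[OF S, of "unit_vec n i" "unit_vec n j"] ij by (simp add: unit_bilinear)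
  then show ?thesis by (metis real_sqrt_abs real_sqrt_le_iff)
qed

lemma sym_index:
  assumes "sym_mat n A" "i < n" "j < n"
  shows "A $$ (i, j) = A $$ (j, i)"
  using assms unfolding sym_mat_def by (metis carrier_matD index_transpose_mat(1))

lemma psd_entry_le_trace:
  assumes S: "psd_mat n S" and ij: "i < n" "j < n"
  shows "\<bar>S $$ (i, j)\<bar> \<le> (\<Sum>i<n. S $$ (i, i))"
proof -
  have le: "S $$ (k, k) \<le> (\<Sum>i<n. S $$ (i, i))" if "k < n" for k
    using that psd_diag_nonneg[OF S] by (intro member_le_sum) auto
  have nn: "0 \<le> (\<Sum>i<n. S $$ (i, i))" using psd_diag_nonneg[OF S] by (auto intro: sum_nonneg)
  have "sqrt (S $$ (i, i) * S $$ (j, j)) \<le> sqrt ((\<Sum>i<n. S $$ (i, i)) * (\<Sum>i<n. S $$ (i, i)))"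
    using le ij nn psd_diag_nonneg[OF S] by (intro real_sqrt_le_mono mult_mono) auto
  then show ?thesis using psd_entry_bound[OF S ij] nn by simp
qed

text \<open>In an orthonormal eigenbasis of \<open>T\<close> the trace becomes a sum of eigenvalues
  of \<open>T\<close> times values of the quadratic form of \<open>S\<close>.\<close>

lemma mat_trace_psd_nonneg:
  assumes T: "pd_mat n T" and S: "psd_mat n S"
  shows "0 \<le> mat_trace (T * S)"
proof -
  have s: "sym_mat n T" and Tc: "T \<in> carrier_mat n n" and Sc: "S \<in> carrier_mat n n"
    using T S by (auto simp: pd_mat_def psd_mat_def sym_mat_def)
  obtain P \<mu> where P: "P \<in> carrier_mat n n" and PA: "transpose_mat P * 1\<^sub>m n * P = 1\<^sub>m n"
    and PB: "transpose_mat P * T * P = mat n n (\<lambda>(i, j). if i = j then \<mu> i else 0)"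
    and mu: "\<And>i. i < n \<Longrightarrow> \<mu> i = col P i \<bullet> (T *\<^sub>v col P i)"
    by (rule simultaneous_diagonalization[OF pd_one s]) (rule that)
  let ?Q = "transpose_mat P"
  have Q: "?Q \<in> carrier_mat n n" using P by simp
  have QP: "?Q * P = 1\<^sub>m n" using PA Q by simp
  have PQ: "P * ?Q = 1\<^sub>m n" by (rule mat_mult_left_right_inverse[OF Q P QP])
  have "T * S = P * (?Q * T * P) * (?Q * S)"
  proof -
    have "P * (?Q * T * P) * (?Q * S) = (P * ?Q) * (T * ((P * ?Q) * S))"
      using P Q Tc Sc by (simp add: assoc_mult_mat[of _ n n _ n _ n])
    also have "\<dots> = T * S" unfolding PQ using Tc Sc by simp
    finally show ?thesis by simp
  qed
  then have "mat_trace (T * S) = mat_trace (P * ((?Q * T * P) * (?Q * S)))"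
    using P Q Tc Sc by (simp add: assoc_mult_mat[of _ n n _ n _ n])
  also have "\<dots> = mat_trace (((?Q * T * P) * (?Q * S)) * P)"
    by (rule mat_trace_comm[of _ n n]) (use P Q Tc Sc in auto)
  also have "\<dots> = mat_trace ((?Q * T * P) * (?Q * S * P))"
    using P Q Tc Sc by (simp add: assoc_mult_mat[of _ n n _ n _ n])
  also have "\<dots> = (\<Sum>i<n. \<Sum>j<n. (?Q * T * P) $$ (i, j) * (?Q * S * P) $$ (j, i))"
    by (rule mat_trace_mult_sum) (use P Q Tc Sc in auto)
  also have "\<dots> = (\<Sum>i<n. \<Sum>j<n. if i = j then \<mu> i * (?Q * S * P) $$ (j, i) else 0)"
    unfolding PB by (intro sum.cong refl) auto
  also have "\<dots> = (\<Sum>i<n. \<mu> i * (col P i \<bullet> (S *\<^sub>v col P i)))"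
    by (simp add: index_congruence[OF P Sc] del: assoc_mult_mat index_mult_mat(1))
  also have "\<dots> \<ge> 0"
    using mu pd_congruence_pos[OF pd_one T P PA] S P
    by (auto intro!: sum_nonneg mult_nonneg_nonneg simp: psd_mat_def order.strict_implies_order)
  finally show ?thesis .
qed

text \<open>By Cauchy-Schwarz for the form of \<open>S\<close>, a vector on which the form vanishes
  lies in the kernel of \<open>S\<close>, and a nonzero determinant leaves only the zero vector
  there.\<close>

lemma psd_det_imp_pd:
  assumes S: "psd_mat n S" and d: "det S \<noteq> 0"
  shows "pd_mat n S"
proof -
  have Sc: "S \<in> carrier_mat n n" and s: "sym_mat n S" using S by (auto simp: psd_mat_def sym_mat_def)
  have "0 < x \<bullet> (S *\<^sub>v x)" if x: "x \<in> carrier_vec n" "x \<noteq> 0\<^sub>v n" for x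
  proof (rule ccontr)
    assume "\<not> ?thesis"
    then have z: "x \<bullet> (S *\<^sub>v x) = 0" using S x by (auto simp: psd_mat_def intro: antisym)
    let ?y = "S *\<^sub>v x"
    have y: "?y \<in> carrier_vec n" using Sc x by simp
    have "(?y \<bullet> ?y)\<^sup>2 \<le> 0" using psd_Cauchy_Schwarz[OF S y x(1)] z by simp
    then have "?y \<bullet> ?y = 0" by simp
    then have "?y = 0\<^sub>v n" using scalar_prod_self_pos[OF y] by force
    then show False using det_0_iff_vec_prod_zero[OF Sc] d x by blast
  qed
  then show ?thesis using s by (auto simp: pd_mat_def)
qed

text \<open>The Leibniz expansion has \<open>fact n\<close> terms, each a product of
  \<open>n\<close> entries bounded by the trace. Such a crude bound suffices: under the logarithm,
  any power of the trace loses against the trace itself.\<close>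

lemma det_le_trace_power:
  assumes S: "psd_mat n S"
  shows "det S \<le> fact n * (\<Sum>i<n. S $$ (i, i)) ^ n"
proof -
  let ?T = "\<Sum>i<n. S $$ (i, i)"
  have Sc: "S \<in> carrier_mat n n" using S by (auto simp: psd_mat_def sym_mat_def)
  have nn: "0 \<le> ?T" using psd_diag_nonneg[OF S] by (auto intro: sum_nonneg)
  have "det S \<le> (\<Sum>p\<in>{p. p permutes {0..<n}}. ?T ^ n)"
    unfolding det_def'[OF Sc]
  proof (rule sum_mono)
    fix p assume p: "p \<in> {p. p permutes {0..<n}}"
    have "signof p * (\<Prod>i = 0..<n. S $$ (i, p i)) \<le> \<bar>signof p * (\<Prod>i = 0..<n. S $$ (i, p i))\<bar>" by simp
    also have "\<dots> = (\<Prod>i = 0..<n. \<bar>S $$ (i, p i)\<bar>)"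
      by (simp add: abs_mult sign_def abs_prod)
    also have "\<dots> \<le> (\<Prod>i = 0..<n. ?T)"
    proof (rule prod_mono)
      fix i assume i: "i \<in> {0..<n}"
      then have "p i < n" using p by (metis atLeastLessThan_iff mem_Collect_eq permutes_in_image)
      then show "0 \<le> \<bar>S $$ (i, p i)\<bar> \<and> \<bar>S $$ (i, p i)\<bar> \<le> ?T" using psd_entry_le_trace[OF S] i by auto
    qed
    finally show "signof p * (\<Prod>i = 0..<n. S $$ (i, p i)) \<le> ?T ^ n" by simp
  qed
  also have "\<dots> = fact n * ?T ^ n" by (simp add: card_permutations)
  finally show ?thesis .
qed

section \<open>Coercivity of the objective and existence of a minimizer\<close>

definition offdiag :: "nat \<Rightarrow> (nat \<times> nat) set" where
  "offdiag n = {(i, j). i < n \<and> j < n \<and> i \<noteq> j}"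

lemma finite_offdiag [simp]: "finite (offdiag n)"
  by (rule finite_subset[of _ "{..<n} \<times> {..<n}"]) (auto simp: offdiag_def)

lemma sum_diag_offdiag:
  fixes f :: "nat \<Rightarrow> nat \<Rightarrow> real"
  shows "(\<Sum>i<n. \<Sum>j<n. f i j) = (\<Sum>i<n. f i i) + (\<Sum>(i, j)\<in>offdiag n. f i j)"
proof -
  have "(\<Sum>i<n. \<Sum>j<n. f i j) = (\<Sum>p\<in>{..<n} \<times> {..<n}. case p of (i, j) \<Rightarrow> f i j)"
    by (simp add: sum.cartesian_product)
  also have "{..<n} \<times> {..<n} = (\<lambda>i. (i, i)) ` {..<n} \<union> offdiag n" by (auto simp: offdiag_def)
  also have "(\<Sum>p\<in>(\<lambda>i. (i, i)) ` {..<n} \<union> offdiag n. case p of (i, j) \<Rightarrow> f i j) =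
      (\<Sum>p\<in>(\<lambda>i. (i, i)) ` {..<n}. case p of (i, j) \<Rightarrow> f i j) + (\<Sum>(i, j)\<in>offdiag n. f i j)"
    by (rule sum.union_disjoint) (use finite_offdiag[of n] in \<open>auto simp: offdiag_def\<close>)
  also have "(\<Sum>p\<in>(\<lambda>i. (i, i)) ` {..<n}. case p of (i, j) \<Rightarrow> f i j) = (\<Sum>i<n. f i i)"
    by (subst sum.reindex) (auto simp: inj_on_def)
  finally show ?thesis .
qed

lemma glasso_objective_sum:
  assumes "T \<in> carrier_mat n n" "S \<in> carrier_mat n n"
  shows "glasso_objective n S lam T = (\<Sum>i<n. \<Sum>j<n. T $$ (i, j) * S $$ (j, i)) - ln (det T) +
     lam * (\<Sum>(i, j)\<in>offdiag n. sqrt (S $$ (i, i) * S $$ (j, j)) * \<bar>T $$ (i, j)\<bar>)"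
  unfolding glasso_objective_def mat_trace_mult_sum[OF assms] offdiag_def ..

text \<open>Positive semidefiniteness of \<open>S\<close> gives \<open>\<bar>S\<^sub>i\<^sub>j\<bar> \<le> sqrt (S\<^sub>i\<^sub>i S\<^sub>j\<^sub>j)\<close>, so a fraction \<open>t\<close> of the
  trace term can be traded against the penalty, leaving a multiple of the trace of \<open>T\<close>.\<close>

lemma glasso_objective_lower:
  assumes T: "pd_mat n T" and S: "psd_mat n S" and \<sigma>: "\<And>i. i < n \<Longrightarrow> \<sigma> \<le> S $$ (i, i)"
    and t: "0 \<le> t" "t \<le> 1" "t \<le> lam"
  shows "t * \<sigma> * (\<Sum>i<n. T $$ (i, i)) - ln (det T) \<le> glasso_objective n S lam T"
proof -
  have s: "sym_mat n S" and Tc: "T \<in> carrier_mat n n" and Sc: "S \<in> carrier_mat n n"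
    using T S by (auto simp: pd_mat_def psd_mat_def sym_mat_def)
  let ?tr = "\<Sum>i<n. \<Sum>j<n. T $$ (i, j) * S $$ (j, i)"
  let ?pen = "\<Sum>(i, j)\<in>offdiag n. sqrt (S $$ (i, i) * S $$ (j, j)) * \<bar>T $$ (i, j)\<bar>"
  have tr0: "0 \<le> ?tr" using mat_trace_psd_nonneg[OF T S] mat_trace_mult_sum[OF Tc Sc] by simp
  have pen0: "0 \<le> ?pen" by (intro sum_nonneg) (auto simp: offdiag_def psd_diag_nonneg[OF S])
  have "- ?pen \<le> (\<Sum>(i, j)\<in>offdiag n. T $$ (i, j) * S $$ (j, i))"
    unfolding sum_negf[symmetric]
  proof (rule sum_mono, clarify)
    fix i j assume "(i, j) \<in> offdiag n"
    then have ij: "i < n" "j < n" by (auto simp: offdiag_def)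
    have "\<bar>T $$ (i, j) * S $$ (j, i)\<bar> \<le> sqrt (S $$ (i, i) * S $$ (j, j)) * \<bar>T $$ (i, j)\<bar>"
      unfolding abs_mult using psd_entry_bound[OF S ij] sym_index[OF s ij]
      by (simp only: mult.commute[of "\<bar>T $$ (i, j)\<bar>"] mult_right_mono abs_ge_zero)
    then show "- (sqrt (S $$ (i, i) * S $$ (j, j)) * \<bar>T $$ (i, j)\<bar>) \<le> T $$ (i, j) * S $$ (j, i)" by linarith
  qed
  moreover have "\<sigma> * (\<Sum>i<n. T $$ (i, i)) \<le> (\<Sum>i<n. T $$ (i, i) * S $$ (i, i))"
    unfolding sum_distrib_left using \<sigma> pd_diag_pos[OF T]
    by (intro sum_mono) (simp add: mult.commute mult_left_mono less_imp_le)
  ultimately have "\<sigma> * (\<Sum>i<n. T $$ (i, i)) \<le> ?tr + ?pen" unfolding sum_diag_offdiag by linarith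
  then have "t * (\<sigma> * (\<Sum>i<n. T $$ (i, i))) \<le> t * (?tr + ?pen)" by (rule mult_left_mono[OF _ t(1)])
  also have "\<dots> \<le> ?tr + lam * ?pen"
    using mult_right_mono[OF t(2) tr0] mult_right_mono[OF t(3) pen0] by (simp add: distrib_left)
  finally show ?thesis unfolding glasso_objective_sum[OF Tc Sc] by (simp add: mult.assoc)
qed

text \<open>Coercivity reduced to one variable: here \<open>T\<close> stands for a trace and
  \<open>D\<close> for a determinant, and a linear function outgrows
  \<open>n * ln T\<close>.\<close>

lemma trace_bounded_of_log_bound:
  fixes c C :: real
  assumes c: "0 < c" and n: "0 < n"
  obtains T0 where "\<And>T D. 0 < T \<Longrightarrow> 0 < D \<Longrightarrow> D \<le> fact n * T ^ n \<Longrightarrow> c * T - ln D \<le> C \<Longrightarrow> T \<le> T0"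
proof -
  \<comment> \<open>At this scale the tangent bound on \<open>n * ln T\<close> uses up exactly half
    of the linear term \<open>c * T\<close>.\<close>
  define \<alpha> where "\<alpha> = c / (2 * real n)"
  have \<alpha>: "0 < \<alpha>" unfolding \<alpha>_def using c n by simp
  define T0 where "T0 = 2 * (C + ln (fact n) - real n - real n * ln \<alpha>) / c"
  have "T \<le> T0" if T: "0 < T" and D: "0 < D" "D \<le> fact n * T ^ n" "c * T - ln D \<le> C" for T D :: real
  proof -
    have "ln D \<le> ln (fact n * T ^ n)" using D by simp
    also have "\<dots> = ln (fact n) + real n * ln T" using T by (simp add: ln_mult ln_realpow)
    finally have 1: "ln D \<le> ln (fact n) + real n * ln T" .
    have "ln \<alpha> + ln T \<le> \<alpha> * T - 1" using ln_le_minus_one[of "\<alpha> * T"] \<alpha> T by (simp add: ln_mult)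
    then have "real n * (ln \<alpha> + ln T) \<le> real n * (\<alpha> * T - 1)" by (rule mult_left_mono) simp
    also have "\<dots> = c * T / 2 - real n" unfolding \<alpha>_def using n by (simp add: field_simps)
    finally have "c * T / 2 \<le> C + ln (fact n) - real n - real n * ln \<alpha>"
      using 1 D(3) by (simp add: distrib_left)
    then show ?thesis unfolding T0_def using c by (simp add: field_simps)
  qed
  then show ?thesis using that by blast
qed

text \<open>On the sublevel set of the value at the identity matrix, the trace is bounded above and
  the determinant is bounded away from 0. This places the sublevel set in a compact set on which the
  objective is continuous, so a minimum over the compact set is a global one.\<close>

lemma glasso_exists:
  assumes n: "0 < n" and S: "psd_mat n S" and diag: "\<And>i. i < n \<Longrightarrow> 0 < S $$ (i, i)" and lam: "0 < lam"
  shows "\<exists>T. glasso_solution n S lam T"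
proof -
  have Sc: "S \<in> carrier_mat n n" using S by (auto simp: psd_mat_def sym_mat_def)
  define \<sigma> where "\<sigma> = Min ((\<lambda>i. S $$ (i, i)) ` {..<n})"
  have \<sigma>0: "0 < \<sigma>" unfolding \<sigma>_def using n diag by (subst Min_gr_iff) auto
  have \<sigma>: "\<sigma> \<le> S $$ (i, i)" if "i < n" for i unfolding \<sigma>_def using that by (intro Min_le) auto
  define t where "t = min 1 lam"
  have t: "0 \<le> t" "t \<le> 1" "t \<le> lam" "0 < t" unfolding t_def using lam by auto
  let ?f = "glasso_objective n S lam"
  define C where "C = ?f (1\<^sub>m n)"
  have low: "t * \<sigma> * (\<Sum>i<n. T $$ (i, i)) - ln (det T) \<le> ?f T" if "pd_mat n T" for T
    by (rule glasso_objective_lower[OF that S \<sigma> t(1-3)])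
  obtain T0 where T0: "\<And>T D. 0 < T \<Longrightarrow> 0 < D \<Longrightarrow> D \<le> fact n * T ^ n \<Longrightarrow> t * \<sigma> * T - ln D \<le> C \<Longrightarrow> T \<le> T0"
    by (rule trace_bounded_of_log_bound[of "t * \<sigma>" n C]) (use t \<sigma>0 n in auto)
  have sub: "(\<Sum>i<n. T $$ (i, i)) \<le> T0 \<and> exp (- C) \<le> det T" if T: "pd_mat n T" and le: "?f T \<le> C" for T
  proof -
    have tp: "0 < (\<Sum>i<n. T $$ (i, i))" using n pd_diag_pos[OF T] by (intro sum_pos) auto
    \<comment> \<open>The trace term is positive, so dropping it leaves a bound on the determinant
      alone.\<close>
    have "- ln (det T) \<le> C" using low[OF T] le mult_pos_pos[OF mult_pos_pos[OF t(4) \<sigma>0] tp] by linarith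
    then have "exp (- C) \<le> exp (ln (det T))" by simp
    then have "exp (- C) \<le> det T" using pd_det_pos[OF T] by simp
    moreover have "(\<Sum>i<n. T $$ (i, i)) \<le> T0"
      using T0[OF tp pd_det_pos[OF T] det_le_trace_power[OF pd_imp_psd[OF T]]] low[OF T] le by linarith
    ultimately show ?thesis by simp
  qed
  let ?m = "\<lambda>f :: nat \<times> nat \<Rightarrow> real. mat n n f"
  have perm: "p i < n" if "p permutes {0..<n}" "i < n" for p i
    using that by (metis atLeastLessThan_iff permutes_in_image zero_le)
  have det_m: "det (?m f) = (\<Sum>p\<in>{p. p permutes {0..<n}}. signof p * (\<Prod>i = 0..<n. f (i, p i)))" for f
    by (subst det_def'[of _ n]) (auto intro!: sum.cong prod.cong simp: perm)
  have coord: "continuous_on U (\<lambda>f. f p)" for U and p :: "nat \<times> nat" and f :: "nat \<times> nat \<Rightarrow> real"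
    by (rule continuous_on_subset[OF continuous_on_product_coordinates]) auto
  have det_cont: "continuous_on U (\<lambda>f. det (?m f))" for U
    unfolding det_m by (intro continuous_intros coord)
  have quad_m: "x \<bullet> (?m f *\<^sub>v x) = (\<Sum>i<n. \<Sum>j<n. x $ i * f (i, j) * x $ j)" if "x \<in> carrier_vec n" for x f
    by (subst bilinear_sum[of _ n n]) (use that in auto)
  \<comment> \<open>Semidefiniteness is a family of closed conditions, one for each vector, and
    positive definiteness is recovered from the determinant bound. So \<open>U\<close> is closed
    without leaving the open cone.\<close>
  define U where "U = {f :: nat \<times> nat \<Rightarrow> real. \<forall>p. f p \<in> (if p \<in> {..<n} \<times> {..<n} then {-T0..T0} else {0})} \<inter>
    ((\<Inter>p\<in>{..<n} \<times> {..<n}. {f. f p = f (snd p, fst p)}) \<inter>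
     ((\<Inter>x\<in>carrier_vec n. {f. 0 \<le> (\<Sum>i<n. \<Sum>j<n. x $ i * f (i, j) * x $ j)}) \<inter>
      {f. exp (- C) \<le> det (?m f)}))"
  have "compact U" unfolding U_def
    by (intro compact_Int_closed compact_box closed_Int closed_INT ballI closed_Collect_eq closed_Collect_le
        continuous_intros coord det_cont) auto
  have pdU: "pd_mat n (?m f)" if "f \<in> U" for f
  proof (rule psd_det_imp_pd)
    have "0 < det (?m f)" using that unfolding U_def by (auto intro: less_le_trans[OF exp_gt_zero])
    then show "det (?m f) \<noteq> 0" by simp
    have "sym_mat n (?m f)" using that unfolding U_def sym_mat_def by (auto intro!: eq_matI)
    then show "psd_mat n (?m f)" using that quad_m unfolding U_def psd_mat_def by auto
  qed
  have inU: "\<exists>f\<in>U. ?m f = T" if T: "pd_mat n T" and le: "?f T \<le> C" for T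
  proof -
    define f where "f p = (if p \<in> {..<n} \<times> {..<n} then T $$ p else 0)" for p
    have Tc: "T \<in> carrier_mat n n" and s: "sym_mat n T" using T by (auto simp: pd_mat_def sym_mat_def)
    have mf: "?m f = T" using Tc by (intro eq_matI) (auto simp: f_def)
    have b: "\<bar>T $$ (i, j)\<bar> \<le> T0" if "i < n" "j < n" for i j
      using psd_entry_le_trace[OF pd_imp_psd[OF T] that] sub[OF T le] by linarith
    have "f \<in> U" unfolding U_def
    proof (intro IntI)
      show "f \<in> {f. \<forall>p. f p \<in> (if p \<in> {..<n} \<times> {..<n} then {-T0..T0} else {0})}"
        using b unfolding f_def by (auto simp: abs_le_iff minus_le_iff)
      show "f \<in> (\<Inter>p\<in>{..<n} \<times> {..<n}. {f. f p = f (snd p, fst p)})"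
        using sym_index[OF s] unfolding f_def by auto
      show "f \<in> (\<Inter>x\<in>carrier_vec n. {f. 0 \<le> (\<Sum>i<n. \<Sum>j<n. x $ i * f (i, j) * x $ j)})"
        using pd_imp_psd[OF T] unfolding psd_mat_def mf[symmetric] by (auto simp: quad_m)
      show "f \<in> {f. exp (- C) \<le> det (?m f)}" using sub[OF T le] mf by simp
    qed
    then show ?thesis using mf by blast
  qed
  have obj_m: "?f (?m f) = (\<Sum>i<n. \<Sum>j<n. f (i, j) * S $$ (j, i)) - ln (det (?m f)) +
     lam * (\<Sum>p\<in>offdiag n. sqrt (S $$ (fst p, fst p) * S $$ (snd p, snd p)) * \<bar>f p\<bar>)" for f
    by (subst glasso_objective_sum[OF _ Sc]) (auto intro!: sum.cong simp: offdiag_def)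
  have "continuous_on U (\<lambda>f. ?f (?m f))"
    unfolding obj_m
  proof (intro continuous_intros coord det_cont)
    show "\<forall>f\<in>U. det (?m f) \<noteq> 0" using pdU pd_det_pos by force
  qed
  moreover obtain f0 where "f0 \<in> U" using inU[OF pd_one] unfolding C_def by auto
  ultimately obtain f where f: "f \<in> U" and min: "\<And>g. g \<in> U \<Longrightarrow> ?f (?m f) \<le> ?f (?m g)"
    using continuous_attains_inf[OF \<open>compact U\<close>, of "\<lambda>f. ?f (?m f)"] by blast
  have fC: "?f (?m f) \<le> C" using inU[OF pd_one] min unfolding C_def by fastforce
  have "?f (?m f) \<le> ?f T" if T: "pd_mat n T" for T
  proof (cases "?f T \<le> C")
    case True
    then show ?thesis using inU[OF T True] min by auto
  qed (use fC in linarith)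
  then have "glasso_solution n S lam (?m f)"
    unfolding glasso_solution_def using pdU[OF f] psd_diag_nonneg[OF S] by auto
  then show ?thesis by blast
qed

lemma quad_form_le_sum_abs:
  fixes A :: "real mat"
  assumes A: "A \<in> carrier_mat n n" and y: "y \<in> carrier_vec n"
  shows "y \<bullet> (A *\<^sub>v y) \<le> (\<Sum>i<n. \<Sum>j<n. \<bar>A $$ (i, j)\<bar>) * (y \<bullet> y)"
proof -
  have sq: "\<bar>y $ i\<bar> * \<bar>y $ j\<bar> \<le> y \<bullet> y" if "i < n" "j < n" for i j
  proof -
    have le: "y $ k * y $ k \<le> y \<bullet> y" if "k < n" for k
      unfolding scalar_prod_sum_lessThan[OF y] using that by (intro member_le_sum) auto
    have "2 * (\<bar>y $ i\<bar> * \<bar>y $ j\<bar>) \<le> y $ i * y $ i + y $ j * y $ j"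
      using zero_le_power2[of "\<bar>y $ i\<bar> - \<bar>y $ j\<bar>"] by (simp add: power2_eq_square algebra_simps)
    then show ?thesis using le[OF that(1)] le[OF that(2)] by linarith
  qed
  have "y \<bullet> (A *\<^sub>v y) \<le> (\<Sum>i<n. \<Sum>j<n. \<bar>A $$ (i, j)\<bar> * (y \<bullet> y))"
    unfolding bilinear_sum[OF A y y]
  proof (intro sum_mono)
    fix i j assume ij: "i \<in> {..<n}" "j \<in> {..<n}"
    have "y $ i * A $$ (i, j) * y $ j \<le> \<bar>A $$ (i, j)\<bar> * (\<bar>y $ i\<bar> * \<bar>y $ j\<bar>)"
      using abs_ge_self[of "y $ i * A $$ (i, j) * y $ j"] by (simp add: abs_mult ac_simps)
    also have "\<dots> \<le> \<bar>A $$ (i, j)\<bar> * (y \<bullet> y)" using sq ij by (intro mult_left_mono) auto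
    finally show "y $ i * A $$ (i, j) * y $ j \<le> \<bar>A $$ (i, j)\<bar> * (y \<bullet> y)" .
  qed
  then show ?thesis by (simp add: sum_distrib_right)
qed

lemma frob_sq_diff_zero:
  assumes "A \<in> carrier_mat n m" "B \<in> carrier_mat n m" "frob_sq (A - B) \<le> 0"
  shows "A = B"
proof (rule eq_matI)
  fix i j assume "i < dim_row B" "j < dim_col B"
  then have ij: "i < n" "j < m" using assms by auto
  have "((A - B) $$ (i, j))\<^sup>2 \<le> (\<Sum>j<m. ((A - B) $$ (i, j))\<^sup>2)" using ij by (intro member_le_sum) auto
  also have "\<dots> \<le> (\<Sum>i<n. \<Sum>j<m. ((A - B) $$ (i, j))\<^sup>2)"
    using ij by (intro member_le_sum[where f="\<lambda>i. \<Sum>j<m. ((A - B) $$ (i, j))\<^sup>2"]) (auto intro: sum_nonneg)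
  also have "\<dots> \<le> 0" using assms unfolding frob_sq_def by simp
  finally show "A $$ (i, j) = B $$ (i, j)" using ij assms by simp
qed (use assms in auto)

text \<open>The Bregman bound at the midpoint \<open>T\<close> is applied to both minimizers. The
  linear terms cancel because \<open>T1 - T\<close> and \<open>T2 - T\<close> are opposite, the
  penalty is convex, and so both moduli must vanish. The sign of the penalty weights comes from the
  well-definedness clause of \<open>glasso_solution\<close>, not from a property of
  \<open>S\<close>.\<close>

lemma glasso_unique:
  assumes S: "S \<in> carrier_mat n n" and lam: "0 \<le> lam"
    and sol: "glasso_solution n S lam T1" "glasso_solution n S lam T2"
  shows "T1 = T2"
proof -
  have pd: "pd_mat n T1" "pd_mat n T2" using sol by (auto simp: glasso_solution_def)
  then have c: "T1 \<in> carrier_mat n n" "T2 \<in> carrier_mat n n" by (auto simp: pd_mat_def sym_mat_def)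
  define T where "T = (1/2) \<cdot>\<^sub>m (T1 + T2)"
  have Tc: "T \<in> carrier_mat n n" unfolding T_def using c by simp
  have Tij: "T $$ (i, j) = (T1 $$ (i, j) + T2 $$ (i, j)) / 2" if "i < n" "j < n" for i j
    unfolding T_def using that c by simp
  have "T $$ (j, i) = T $$ (i, j)" if "i < n" "j < n" for i j
    using Tij[OF that] Tij[OF that(2,1)] sym_index[of n T1, OF _ that] sym_index[of n T2, OF _ that] pd
    by (simp add: pd_mat_def)
  then have symT: "sym_mat n T" using Tc unfolding sym_mat_def by (auto intro!: eq_matI)
  have qT: "x \<bullet> (T *\<^sub>v x) = (x \<bullet> (T1 *\<^sub>v x) + x \<bullet> (T2 *\<^sub>v x)) / 2" if x: "x \<in> carrier_vec n" for x
    unfolding bilinear_sum[OF Tc x x] bilinear_sum[OF c(1) x x] bilinear_sum[OF c(2) x x] sum.distrib[symmetric] sum_divide_distrib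
    by (intro sum.cong refl) (simp add: Tij field_simps)
  have pdT: "pd_mat n T" unfolding pd_mat_def
  proof (intro conjI ballI impI)
    show "sym_mat n T" by (rule symT)
    fix x :: "real vec" assume x: "x \<in> carrier_vec n" "x \<noteq> 0\<^sub>v n"
    then have "0 < x \<bullet> (T1 *\<^sub>v x)" "0 < x \<bullet> (T2 *\<^sub>v x)" using pd unfolding pd_mat_def by blast+
    then show "0 < x \<bullet> (T *\<^sub>v x)" unfolding qT[OF x(1)] by simp
  qed
  obtain Ti where Ti: "Ti \<in> carrier_mat n n" "T * Ti = 1\<^sub>m n"
    by (rule inverse_exists_det[OF Tc less_imp_neq[OF pd_det_pos[OF pdT], symmetric]]) (rule that)
  \<comment> \<open>Any finite bound on the form of \<open>T\<close> will do, since it gets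
    multiplied by a modulus that turns out to be 0.\<close>
  define a where "a = (\<Sum>i<n. \<Sum>j<n. \<bar>T $$ (i, j)\<bar>)"
  have a: "0 \<le> a" unfolding a_def by (auto intro!: sum_nonneg)
  have ab: "y \<bullet> (T *\<^sub>v y) \<le> a * (y \<bullet> y)" if "y \<in> carrier_vec n" for y
    unfolding a_def by (rule quad_form_le_sum_abs[OF Tc that])
  obtain x1 where x1: "0 \<le> x1" "frob_sq (T1 - T) \<le> a\<^sup>2 * x1\<^sup>2"
    "ln (det T1) - ln (det T) + x1\<^sup>2 / (2 * (1 + x1)) \<le> mat_trace (Ti * (T1 - T))"
    by (rule ln_det_bregman[OF pdT pd(1) Ti a ab])
  obtain x2 where x2: "0 \<le> x2" "frob_sq (T2 - T) \<le> a\<^sup>2 * x2\<^sup>2"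
    "ln (det T2) - ln (det T) + x2\<^sup>2 / (2 * (1 + x2)) \<le> mat_trace (Ti * (T2 - T))"
    by (rule ln_det_bregman[OF pdT pd(2) Ti a ab])
  have "mat_trace (Ti * (T1 - T)) + mat_trace (Ti * (T2 - T)) =
      (\<Sum>i<n. \<Sum>j<n. Ti $$ (i, j) * (T1 - T) $$ (j, i) + Ti $$ (i, j) * (T2 - T) $$ (j, i))"
    using Ti(1) c Tc by (subst (1 2) mat_trace_mult_sum[of _ n n]) (auto simp: sum.distrib)
  also have "\<dots> = 0" using c Tc by (intro sum.neutral ballI) (auto simp: Tij field_simps)
  finally have tr0: "mat_trace (Ti * (T1 - T)) + mat_trace (Ti * (T2 - T)) = 0" .
  let ?w = "\<lambda>i j. sqrt (S $$ (i, i) * S $$ (j, j))"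
  let ?pen = "\<lambda>T. \<Sum>(i, j)\<in>offdiag n. ?w i j * \<bar>T $$ (i, j)\<bar>"
  have "2 * ?pen T \<le> ?pen T1 + ?pen T2"
    unfolding sum_distrib_left sum.distrib[symmetric]
  proof (rule sum_mono, clarify)
    fix i j assume "(i, j) \<in> offdiag n"
    then have ij: "i < n" "j < n" "i \<noteq> j" by (auto simp: offdiag_def)
    then have w: "0 \<le> ?w i j" using sol(1) by (simp add: glasso_solution_def)
    have "2 * \<bar>T $$ (i, j)\<bar> \<le> \<bar>T1 $$ (i, j)\<bar> + \<bar>T2 $$ (i, j)\<bar>" using Tij[OF ij(1,2)] by simp
    then have "?w i j * (2 * \<bar>T $$ (i, j)\<bar>) \<le> ?w i j * (\<bar>T1 $$ (i, j)\<bar> + \<bar>T2 $$ (i, j)\<bar>)"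
      by (rule mult_left_mono[OF _ w])
    then show "2 * (?w i j * \<bar>T $$ (i, j)\<bar>) \<le> ?w i j * \<bar>T1 $$ (i, j)\<bar> + ?w i j * \<bar>T2 $$ (i, j)\<bar>"
      by (simp add: distrib_left)
  qed
  then have "lam * (2 * ?pen T) \<le> lam * (?pen T1 + ?pen T2)" by (rule mult_left_mono[OF _ lam])
  then have pen: "2 * (lam * ?pen T) \<le> lam * ?pen T1 + lam * ?pen T2" by (simp add: distrib_left)
  have lin: "2 * (\<Sum>i<n. \<Sum>j<n. T $$ (i, j) * S $$ (j, i)) =
    (\<Sum>i<n. \<Sum>j<n. T1 $$ (i, j) * S $$ (j, i)) + (\<Sum>i<n. \<Sum>j<n. T2 $$ (i, j) * S $$ (j, i))"
    unfolding sum_distrib_left sum.distrib[symmetric] by (intro sum.cong) (auto simp: Tij field_simps)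
  have opt: "glasso_objective n S lam T1 \<le> glasso_objective n S lam T" "glasso_objective n S lam T2 \<le> glasso_objective n S lam T"
    using sol pdT unfolding glasso_solution_def by blast+
  have h: "0 \<le> x1\<^sup>2 / (2 * (1 + x1))" "0 \<le> x2\<^sup>2 / (2 * (1 + x2))" using x1(1) x2(1) by simp_all
  have "x1\<^sup>2 / (2 * (1 + x1)) + x2\<^sup>2 / (2 * (1 + x2)) \<le> 0"
    using opt x1(3) x2(3) tr0 pen lin
    unfolding glasso_objective_sum[OF Tc S] glasso_objective_sum[OF c(1) S] glasso_objective_sum[OF c(2) S]
    by linarith
  then have "x1\<^sup>2 / (2 * (1 + x1)) = 0" "x2\<^sup>2 / (2 * (1 + x2)) = 0" using h by linarith+
  then have "x1 = 0" "x2 = 0" using x1(1) x2(1) by auto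
  then have "T1 = T" "T2 = T" using x1(2) x2(2) frob_sq_diff_zero[OF c(1) Tc] frob_sq_diff_zero[OF c(2) Tc] by auto
  then show ?thesis by simp
qed

subsection \<open>Inverses of positive definite matrices\<close>

lemma mat_inv_eqI:
  assumes "A \<in> carrier_mat n n" "B \<in> carrier_mat n n" "A * B = 1\<^sub>m n"
  shows "mat_inv A = B"
proof -
  have BA: "B * A = 1\<^sub>m n" by (rule mat_mult_left_right_inverse[OF assms])
  show ?thesis unfolding mat_inv_def
  proof (rule the_equality)
    show "B \<in> carrier_mat (dim_row A) (dim_row A) \<and> inverts_mat A B \<and> inverts_mat B A"
      using assms BA by (auto simp: inverts_mat_def)
    fix C assume C: "C \<in> carrier_mat (dim_row A) (dim_row A) \<and> inverts_mat A C \<and> inverts_mat C A"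
    then have Cc: "C \<in> carrier_mat n n" and CA: "C * A = 1\<^sub>m n" using assms by (auto simp: inverts_mat_def)
    have "C = C * (A * B)" using assms(3) Cc by simp
    also have "\<dots> = C * A * B" using assoc_mult_mat[OF Cc assms(1,2)] by simp
    finally show "C = B" unfolding CA using assms by simp
  qed
qed

lemma pd_mat_inv:
  assumes A: "pd_mat n A"
  shows "mat_inv A \<in> carrier_mat n n" "A * mat_inv A = 1\<^sub>m n" "mat_inv A * A = 1\<^sub>m n"
proof -
  have Ac: "A \<in> carrier_mat n n" using A by (auto simp: pd_mat_def sym_mat_def)
  obtain B where B: "B \<in> carrier_mat n n" "A * B = 1\<^sub>m n" "B * A = 1\<^sub>m n"
    by (rule inverse_exists_det[OF Ac less_imp_neq[OF pd_det_pos[OF A], symmetric]]) (rule that)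
  have "mat_inv A = B" by (rule mat_inv_eqI[OF Ac B(1,2)])
  then show "mat_inv A \<in> carrier_mat n n" "A * mat_inv A = 1\<^sub>m n" "mat_inv A * A = 1\<^sub>m n" using B by auto
qed

lemma invertible_mat_det:
  fixes A :: "real mat"
  assumes A: "A \<in> carrier_mat n n" and "invertible_mat A"
  shows "det A \<noteq> 0"
proof -
  obtain B where B: "inverts_mat A B" "inverts_mat B A" using assms(2) by (auto simp: invertible_mat_def)
  have AB: "A * B = 1\<^sub>m n" and BA: "B * A = 1\<^sub>m (dim_row B)" using B A by (auto simp: inverts_mat_def)
  have "dim_col B = n" using arg_cong[OF AB, of dim_col] by simp
  moreover have "dim_row B = n" using arg_cong[OF BA, of dim_col] A by simp
  ultimately have "B \<in> carrier_mat n n" by auto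
  then have "det A * det B = 1" using det_mult[OF A, of B] AB by simp
  then show ?thesis by auto
qed

lemma pd_invertible: "pd_mat n A \<Longrightarrow> invertible_mat A"
  using pd_mat_inv[of n A] unfolding invertible_mat_def inverts_mat_def pd_mat_def sym_mat_def
  by (auto intro!: exI[of _ "mat_inv A"])

text \<open>Cauchy-Schwarz for the form of \<open>A\<close> at the vectors \<open>A z\<close> and
  \<open>z\<close> has the square of the wanted quantity on its left side; one factor then
  cancels.\<close>

lemma psd_sq_bound:
  assumes A: "psd_mat n A" and K: "0 \<le> K"
    and up: "\<And>y. y \<in> carrier_vec n \<Longrightarrow> y \<bullet> (A *\<^sub>v y) \<le> K * (y \<bullet> y)" and z: "z \<in> carrier_vec n"
  shows "(A *\<^sub>v z) \<bullet> (A *\<^sub>v z) \<le> K\<^sup>2 * (z \<bullet> z)"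
proof -
  let ?u = "A *\<^sub>v z"
  have u: "?u \<in> carrier_vec n" using A z by (auto simp: psd_mat_def sym_mat_def)
  have "(?u \<bullet> ?u)\<^sup>2 \<le> (?u \<bullet> (A *\<^sub>v ?u)) * (z \<bullet> (A *\<^sub>v z))" by (rule psd_Cauchy_Schwarz[OF A u z])
  also have "\<dots> \<le> (K * (?u \<bullet> ?u)) * (K * (z \<bullet> z))"
    using up[OF u] up[OF z] A u z K scalar_prod_self_nonneg[of ?u]
    by (intro mult_mono) (auto simp: psd_mat_def)
  finally have le: "(?u \<bullet> ?u) * (?u \<bullet> ?u) \<le> (?u \<bullet> ?u) * (K\<^sup>2 * (z \<bullet> z))"
    by (simp add: power2_eq_square algebra_simps)
  show ?thesis
  proof (cases "?u \<bullet> ?u = 0")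
    case True
    then show ?thesis using scalar_prod_self_nonneg[of z] by simp
  next
    case False
    then have "0 < ?u \<bullet> ?u" using scalar_prod_self_nonneg[of ?u] by linarith
    then show ?thesis using le by simp
  qed
qed

lemma inverse_pd:
  assumes A: "pd_mat n A" and B: "B \<in> carrier_mat n n" "A * B = 1\<^sub>m n"
  shows "pd_mat n B"
proof -
  have Ac: "A \<in> carrier_mat n n" and At: "transpose_mat A = A" using A by (auto simp: pd_mat_def sym_mat_def)
  have BA: "B * A = 1\<^sub>m n" by (rule mat_mult_left_right_inverse[OF Ac B])
  have "transpose_mat B * A = 1\<^sub>m n" using transpose_mult[OF Ac B(1)] B(2) At by simp
  then have "transpose_mat B = transpose_mat B * A * B"
    using assoc_mult_mat[of "transpose_mat B" n n A n B n] B Ac by simp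
  then have Bt: "transpose_mat B = B" using \<open>transpose_mat B * A = 1\<^sub>m n\<close> B by simp
  have "0 < y \<bullet> (B *\<^sub>v y)" if y: "y \<in> carrier_vec n" "y \<noteq> 0\<^sub>v n" for y
  proof -
    let ?z = "B *\<^sub>v y"
    have z: "?z \<in> carrier_vec n" using B y by simp
    have Az: "A *\<^sub>v ?z = y" using assoc_mult_mat_vec[OF Ac B(1) y(1)] B(2) y by simp
    have "A *\<^sub>v 0\<^sub>v n = 0\<^sub>v n" using Ac by (intro eq_vecI) auto
    then have "?z \<noteq> 0\<^sub>v n" using y Az by metis
    then have "0 < ?z \<bullet> (A *\<^sub>v ?z)" using A z by (auto simp: pd_mat_def)
    then show ?thesis unfolding Az using comm_scalar_prod[OF z y(1)] by simp
  qed
  then show ?thesis using B Bt by (auto simp: pd_mat_def sym_mat_def)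
qed

text \<open>For \<open>z = B y\<close> the lower bound on \<open>A\<close> reads
  \<open>z \<bullet> z \<le> K * (y \<bullet> z)\<close>. Cauchy-Schwarz for \<open>y\<close> and
  \<open>z\<close>, with a factor \<open>y \<bullet> z\<close> cancelled, finishes the argument
  without any spectral theory of the inverse.\<close>

lemma inverse_quad_upper:
  assumes A: "pd_mat n A" and B: "B \<in> carrier_mat n n" "A * B = 1\<^sub>m n" and K: "0 < K"
    and low: "\<And>y. y \<in> carrier_vec n \<Longrightarrow> y \<bullet> y \<le> K * (y \<bullet> (A *\<^sub>v y))" and y: "y \<in> carrier_vec n"
  shows "y \<bullet> (B *\<^sub>v y) \<le> K * (y \<bullet> y)"
proof -
  let ?z = "B *\<^sub>v y"
  have Ac: "A \<in> carrier_mat n n" using A by (auto simp: pd_mat_def sym_mat_def)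
  have z: "?z \<in> carrier_vec n" using B y by simp
  have Az: "A *\<^sub>v ?z = y" using assoc_mult_mat_vec[OF Ac B(1) y] B(2) y by simp
  have c: "?z \<bullet> y = y \<bullet> ?z" by (rule comm_scalar_prod[OF z y])
  have zz: "?z \<bullet> ?z \<le> K * (y \<bullet> ?z)" using low[OF z] unfolding Az c .
  have "(y \<bullet> ?z)\<^sup>2 \<le> (y \<bullet> y) * (?z \<bullet> ?z)" by (rule Cauchy_Schwarz_vec[OF y z])
  also have "\<dots> \<le> (y \<bullet> y) * (K * (y \<bullet> ?z))" by (rule mult_left_mono[OF zz scalar_prod_self_nonneg])
  finally have le: "(y \<bullet> ?z) * (y \<bullet> ?z) \<le> (y \<bullet> ?z) * (K * (y \<bullet> y))"
    by (simp add: power2_eq_square algebra_simps)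
  have "0 \<le> K * (y \<bullet> ?z)" using zz scalar_prod_self_nonneg[of ?z] by linarith
  then have "0 \<le> y \<bullet> ?z" using K by (simp add: zero_le_mult_iff)
  show ?thesis
  proof (cases "y \<bullet> ?z = 0")
    case True
    then show ?thesis using K scalar_prod_self_nonneg[of y] by simp
  next
    case False
    then show ?thesis using le \<open>0 \<le> y \<bullet> ?z\<close> by simp
  qed
qed

text \<open>With \<open>z = B y\<close>, the upper bound on \<open>A\<close> gives a factor
  \<open>K^2\<close> between the square norms of \<open>y = A z\<close> and \<open>z\<close>, and
  the lower bound gives one more \<open>K\<close>. This direct route explains the cube.\<close>

lemma inverse_quad_lower:
  assumes A: "pd_mat n A" and B: "B \<in> carrier_mat n n" "A * B = 1\<^sub>m n" and K: "0 < K"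
    and low: "\<And>y. y \<in> carrier_vec n \<Longrightarrow> y \<bullet> y \<le> K * (y \<bullet> (A *\<^sub>v y))"
    and up: "\<And>y. y \<in> carrier_vec n \<Longrightarrow> y \<bullet> (A *\<^sub>v y) \<le> K * (y \<bullet> y)" and y: "y \<in> carrier_vec n"
  shows "y \<bullet> y \<le> K ^ 3 * (y \<bullet> (B *\<^sub>v y))"
proof -
  let ?z = "B *\<^sub>v y"
  have Ac: "A \<in> carrier_mat n n" using A by (auto simp: pd_mat_def sym_mat_def)
  have z: "?z \<in> carrier_vec n" using B y by simp
  have Az: "A *\<^sub>v ?z = y" using assoc_mult_mat_vec[OF Ac B(1) y] B(2) y by simp
  have c: "?z \<bullet> y = y \<bullet> ?z" by (rule comm_scalar_prod[OF z y])
  have "y \<bullet> y \<le> K\<^sup>2 * (?z \<bullet> ?z)"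
    using psd_sq_bound[OF pd_imp_psd[OF A] less_imp_le[OF K] up z] unfolding Az .
  also have "\<dots> \<le> K\<^sup>2 * (K * (y \<bullet> ?z))" using low[OF z] unfolding Az c by (intro mult_left_mono) auto
  finally show ?thesis by (simp add: power2_eq_square power3_eq_cube mult.assoc)
qed

subsection \<open>Extreme eigenvalues\<close>

text \<open>The maximizer of the unconstrained Rayleigh quotient satisfies the first-order condition
  in every direction; tested on unit vectors, that condition is the eigenvalue equation.\<close>

lemma sym_max_eigenvalue:
  assumes B: "sym_mat n B" and n: "0 < n"
  obtains v m where "eigenvector B v m" "\<And>y. y \<in> carrier_vec n \<Longrightarrow> y \<bullet> (B *\<^sub>v y) \<le> m * (y \<bullet> y)"
proof -
  have Bc: "B \<in> carrier_mat n n" using B by (auto simp: sym_mat_def)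
  have u: "unit_vec n 0 \<in> carrier_vec n" "unit_vec n 0 \<noteq> (0\<^sub>v n :: real vec)"
    using n by (simp, metis index_unit_vec(1) index_zero_vec(1) one_neq_zero)
  \<comment> \<open>The zero matrix as constraint leaves the whole space.\<close>
  have zero: "0\<^sub>m n n *\<^sub>v y = (0\<^sub>v n :: real vec)" if "y \<in> carrier_vec n" for y
    using that by (intro eq_vecI) (auto simp: scalar_prod_def)
  obtain v where v: "v \<in> carrier_vec n" "v \<bullet> (1\<^sub>m n *\<^sub>v v) = 1"
    and max: "\<And>y. y \<in> carrier_vec n \<Longrightarrow> 0\<^sub>m n n *\<^sub>v y = 0\<^sub>v n \<Longrightarrow> y \<bullet> (B *\<^sub>v y) \<le> (v \<bullet> (B *\<^sub>v v)) * (y \<bullet> (1\<^sub>m n *\<^sub>v y))"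
    by (rule exists_rayleigh_maximizer[OF pd_one Bc zero_carrier_mat u zero[OF u(1)]]) (rule that)
  let ?m = "v \<bullet> (B *\<^sub>v v)"
  have v1: "v \<bullet> v = 1" using v by simp
  have max: "y \<bullet> (B *\<^sub>v y) \<le> ?m * (y \<bullet> y)" if "y \<in> carrier_vec n" for y
    using max[OF that zero[OF that]] that by simp
  have one: "sym_mat n (1\<^sub>m n)" by (simp add: sym_mat_def)
  have stat: "v \<bullet> (B *\<^sub>v y) = ?m * (v \<bullet> y)" if y: "y \<in> carrier_vec n" for y
  proof -
    have "0 \<le> t * (2 * (?m * (v \<bullet> y) - v \<bullet> (B *\<^sub>v y))) + t\<^sup>2 * (?m * (y \<bullet> y) - y \<bullet> (B *\<^sub>v y))" for t
    proof -
      have z: "v + t \<cdot>\<^sub>v y \<in> carrier_vec n" using v y by simp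
      have "(v + t \<cdot>\<^sub>v y) \<bullet> (v + t \<cdot>\<^sub>v y) = v \<bullet> v + 2 * t * (v \<bullet> y) + t\<^sup>2 * (y \<bullet> y)"
        using bilinear_add_smult[OF one v(1) y, of t] z v y by simp
      then show ?thesis using max[OF z] unfolding bilinear_add_smult[OF B v(1) y] v1 by (simp add: algebra_simps)
    qed
    from quadratic_nonneg_linear_zero[OF this] show ?thesis by simp
  qed
  have "B *\<^sub>v v = ?m \<cdot>\<^sub>v v"
  proof (rule eq_vecI)
    fix i assume "i < dim_vec (?m \<cdot>\<^sub>v v)"
    then have i: "i < n" using v by simp
    have "(B *\<^sub>v v) $ i = unit_vec n i \<bullet> (B *\<^sub>v v)" using Bc v i by (simp add: scalar_prod_left_unit)
    also have "\<dots> = v \<bullet> (B *\<^sub>v unit_vec n i)" by (rule bilinear_sym[OF B _ v(1)]) simp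
    also have "\<dots> = ?m * (v \<bullet> unit_vec n i)" by (rule stat) simp
    also have "v \<bullet> unit_vec n i = v $ i" using v i by (simp add: scalar_prod_right_unit)
    finally show "(B *\<^sub>v v) $ i = (?m \<cdot>\<^sub>v v) $ i" using v i by simp
  qed (use Bc v in auto)
  then have "eigenvector B v ?m" using v v1 Bc unfolding eigenvector_def by auto
  then show ?thesis using that max by blast
qed

lemma Lambda_max_bound:
  assumes B: "sym_mat n B" and n: "0 < n"
  shows "Lambda_max B \<in> spectrum B" "y \<in> carrier_vec n \<Longrightarrow> y \<bullet> (B *\<^sub>v y) \<le> Lambda_max B * (y \<bullet> y)"
proof -
  have Bc: "B \<in> carrier_mat n n" using B by (auto simp: sym_mat_def)
  obtain v m where v: "eigenvector B v m" and le: "\<And>y. y \<in> carrier_vec n \<Longrightarrow> y \<bullet> (B *\<^sub>v y) \<le> m * (y \<bullet> y)"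
    by (rule sym_max_eigenvalue[OF B n]) (rule that)
  have m: "m \<in> spectrum B" using v by (auto simp: spectrum_def eigenvalue_def)
  have fin: "finite (spectrum B)" using card_finite_spectrum[OF Bc] by simp
  show "Lambda_max B \<in> spectrum B" unfolding Lambda_max_def using fin m by (intro Max_in) auto
  have "m \<le> Lambda_max B" unfolding Lambda_max_def using fin m by simp
  then have "m * (y \<bullet> y) \<le> Lambda_max B * (y \<bullet> y)" by (rule mult_right_mono[OF _ scalar_prod_self_nonneg])
  then show "y \<bullet> (B *\<^sub>v y) \<le> Lambda_max B * (y \<bullet> y)" if "y \<in> carrier_vec n" using le[OF that] by linarith
qed

lemma Lambda_min_bound:
  assumes B: "sym_mat n B" and n: "0 < n"
  shows "Lambda_min B \<in> spectrum B" "y \<in> carrier_vec n \<Longrightarrow> Lambda_min B * (y \<bullet> y) \<le> y \<bullet> (B *\<^sub>v y)"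
proof -
  have Bc: "B \<in> carrier_mat n n" and Bt: "transpose_mat B = B" using B by (auto simp: sym_mat_def)
  have neg: "(- B) *\<^sub>v x = - (B *\<^sub>v x)" if "x \<in> carrier_vec n" for x
    using Bc that by (simp add: uminus_mult_mat_vec)
  have "sym_mat n (- B)" using Bc Bt unfolding sym_mat_def by (simp add: transpose_uminus)
  then obtain v m where v: "eigenvector (- B) v m" and le: "\<And>y. y \<in> carrier_vec n \<Longrightarrow> y \<bullet> ((- B) *\<^sub>v y) \<le> m * (y \<bullet> y)"
    by (rule sym_max_eigenvalue[OF _ n]) (rule that)
  have vc: "v \<in> carrier_vec n" "v \<noteq> 0\<^sub>v n" "(- B) *\<^sub>v v = m \<cdot>\<^sub>v v" using v Bc unfolding eigenvector_def by auto
  have "- (B *\<^sub>v v) = m \<cdot>\<^sub>v v" using neg[OF vc(1)] vc(3) by simp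
  then have "B *\<^sub>v v = - (m \<cdot>\<^sub>v v)" using uminus_uminus_vec[of "B *\<^sub>v v"] by simp
  also have "\<dots> = (- m) \<cdot>\<^sub>v v" by (intro eq_vecI) auto
  finally have "eigenvector B v (- m)" using vc Bc unfolding eigenvector_def by auto
  then have m: "- m \<in> spectrum B" by (auto simp: spectrum_def eigenvalue_def)
  have fin: "finite (spectrum B)" using card_finite_spectrum[OF Bc] by simp
  show "Lambda_min B \<in> spectrum B" unfolding Lambda_min_def using fin m by (intro Min_in) auto
  have "Lambda_min B \<le> - m" unfolding Lambda_min_def using fin m by simp
  then have "Lambda_min B * (y \<bullet> y) \<le> - m * (y \<bullet> y)" by (rule mult_right_mono[OF _ scalar_prod_self_nonneg])
  moreover have "y \<bullet> ((- B) *\<^sub>v y) = - (y \<bullet> (B *\<^sub>v y))" if "y \<in> carrier_vec n"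
    using neg[OF that] that Bc by simp
  ultimately show "Lambda_min B * (y \<bullet> y) \<le> y \<bullet> (B *\<^sub>v y)" if "y \<in> carrier_vec n" using le[OF that] that by simp
qed

lemma pd_spectrum_pos:
  assumes A: "pd_mat n A" and m: "m \<in> spectrum A"
  shows "0 < m"
proof -
  have Ac: "A \<in> carrier_mat n n" using A by (auto simp: pd_mat_def sym_mat_def)
  obtain v where v: "v \<in> carrier_vec n" "v \<noteq> 0\<^sub>v n" "A *\<^sub>v v = m \<cdot>\<^sub>v v"
    using m Ac unfolding spectrum_def eigenvalue_def eigenvector_def by auto
  have "0 < v \<bullet> (A *\<^sub>v v)" using A v by (auto simp: pd_mat_def)
  then have "0 < m * (v \<bullet> v)" unfolding v(3) using v by simp
  then show ?thesis using scalar_prod_self_pos[OF v(1,2)] by (simp add: zero_less_mult_iff)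
qed

subsection \<open>Operator norms\<close>

text \<open>Jensen's inequality for the weights \<open>u j / R\<close>, where \<open>R\<close> is
  their total mass; undoing the normalization leaves \<open>R powr (p - 1)\<close>, which is at most
  \<open>B powr (p - 1)\<close>. Indices with \<open>v j = 0\<close> are removed first, so that
  convexity of the power is used at positive arguments only.\<close>

lemma weighted_powr_le:
  fixes u v :: "'b \<Rightarrow> real"
  assumes fin: "finite J" and u: "\<And>j. j \<in> J \<Longrightarrow> 0 \<le> u j" and v: "\<And>j. j \<in> J \<Longrightarrow> 0 \<le> v j"
    and p: "1 \<le> p" and B: "(\<Sum>j\<in>J. u j) \<le> B"
  shows "(\<Sum>j\<in>J. u j * v j) powr p \<le> B powr (p - 1) * (\<Sum>j\<in>J. u j * v j powr p)"
proof -
  define I where "I = {j \<in> J. v j \<noteq> 0}"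
  have I: "finite I" "I \<subseteq> J" using fin by (auto simp: I_def)
  have vp: "0 < v j" if "j \<in> I" for j using that v[of j] by (auto simp: I_def)
  define R where "R = (\<Sum>j\<in>I. u j)"
  have R0: "0 \<le> R" unfolding R_def using u I by (auto intro: sum_nonneg)
  have RB: "R \<le> B" using B sum_mono2[OF fin I(2), of u] u unfolding R_def by fastforce
  have e1: "(\<Sum>j\<in>J. u j * v j) = (\<Sum>j\<in>I. u j * v j)"
    by (rule sum.mono_neutral_right) (use fin I_def in auto)
  have e2: "(\<Sum>j\<in>J. u j * v j powr p) = (\<Sum>j\<in>I. u j * v j powr p)"
    by (rule sum.mono_neutral_right) (use fin I_def in auto)
  have nn: "0 \<le> (\<Sum>j\<in>I. u j * v j powr p)" using u I by (auto intro!: sum_nonneg)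
  show ?thesis
  proof (cases "R = 0")
    case True
    then have "u j = 0" if "j \<in> I" for j
      using that u I sum_nonneg_eq_0_iff[OF I(1), of u] unfolding R_def by blast
    then have "(\<Sum>j\<in>I. u j * v j) = 0" by simp
    then show ?thesis unfolding e1 e2 using nn p by simp
  next
    case False
    then have Rp: "0 < R" using R0 by simp
    then have Ine: "I \<noteq> {}" unfolding R_def by auto
    have "(\<Sum>j\<in>I. (u j / R) *\<^sub>R v j) powr p \<le> (\<Sum>j\<in>I. (u j / R) * v j powr p)"
    proof (rule convex_on_sum[OF I(1) Ine powr_convex])
      show "(\<Sum>j\<in>I. u j / R) = 1" using Rp by (simp add: sum_divide_distrib[symmetric] R_def[symmetric])
    qed (use p u I vp Rp in auto)
    then have J: "(\<Sum>j\<in>I. u j / R * v j) powr p \<le> (\<Sum>j\<in>I. u j * v j powr p) / R"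
      by (simp add: sum_divide_distrib)
    have "(\<Sum>j\<in>I. u j * v j) = R * (\<Sum>j\<in>I. u j / R * v j)"
      using Rp by (simp add: sum_distrib_left)
    then have "(\<Sum>j\<in>I. u j * v j) powr p = R powr p * (\<Sum>j\<in>I. u j / R * v j) powr p"
      using Rp u vp I by (subst powr_mult[symmetric]) auto
    also have "\<dots> \<le> R powr p * ((\<Sum>j\<in>I. u j * v j powr p) / R)"
      by (rule mult_left_mono[OF J]) simp
    also have "\<dots> = R powr (p - 1) * (\<Sum>j\<in>I. u j * v j powr p)"
      using Rp by (simp add: powr_diff)
    also have "\<dots> \<le> B powr (p - 1) * (\<Sum>j\<in>I. u j * v j powr p)"
      using RB Rp p nn by (intro mult_right_mono powr_mono2) auto
    finally show ?thesis unfolding e1 e2 .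
  qed
qed

lemma abs_mult_mat_vec_le:
  fixes A :: "real mat"
  assumes "A \<in> carrier_mat n m" "x \<in> carrier_vec m" "i < n"
  shows "\<bar>(A *\<^sub>v x) $ i\<bar> \<le> (\<Sum>j<m. \<bar>A $$ (i, j)\<bar> * \<bar>x $ j\<bar>)"
proof -
  have "(A *\<^sub>v x) $ i = (\<Sum>j<m. A $$ (i, j) * x $ j)"
    using assms by (simp add: scalar_prod_def lessThan_atLeast0)
  then show ?thesis using sum_abs[of "\<lambda>j. A $$ (i, j) * x $ j" "{..<m}"] by (simp add: abs_mult)
qed

lemma lw_norm_nonneg:
  assumes "0 < dim_vec x"
  shows "0 \<le> lw_norm w x"
proof (cases "w = \<infinity>")
  case True
  have "0 \<le> \<bar>x $ 0\<bar>" by simp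
  also have "\<dots> \<le> (MAX i\<in>{..<dim_vec x}. \<bar>x $ i\<bar>)" using assms by (intro Max_ge) auto
  finally show ?thesis using True by (simp add: lw_norm_def)
qed (simp add: lw_norm_def)

lemma lw_norm_unit_vec:
  assumes n: "0 < n"
  shows "lw_norm w (unit_vec n 0) = 1"
proof (cases "w = \<infinity>")
  case True
  have "(MAX i\<in>{..<n}. \<bar>unit_vec n 0 $ i :: real\<bar>) = 1"
    by (rule Max_eqI) (use n in \<open>auto simp: unit_vec_def intro!: image_eqI[of _ _ 0]\<close>)
  then show ?thesis using True by (simp add: lw_norm_def)
next
  case False
  have "(\<Sum>i<n. \<bar>unit_vec n 0 $ i :: real\<bar> powr real_of_ereal w) = (\<Sum>i<n. if i = 0 then 1 else 0)"
    by (rule sum.cong) (auto simp: unit_vec_def)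
  then show ?thesis using False n by (simp add: lw_norm_def)
qed

text \<open>A real \<open>SUP\<close> is informative only over a nonempty set that is bounded above:
  a unit vector provides the first property, the hypothesis \<open>le\<close> the second. The same
  unit vector shows that the supremum is nonnegative.\<close>

lemma op_norm_le:
  assumes A: "A \<in> carrier_mat n n" and n: "0 < n"
    and le: "\<And>x. x \<in> carrier_vec n \<Longrightarrow> lw_norm w x = 1 \<Longrightarrow> lw_norm w (A *\<^sub>v x) \<le> B"
  shows "\<bar>op_norm w A\<bar> \<le> B"
proof -
  let ?X = "{x \<in> carrier_vec (dim_col A). lw_norm w x = 1}"
  have ne: "unit_vec n 0 \<in> ?X" using A lw_norm_unit_vec[OF n] by simp
  have b: "lw_norm w (A *\<^sub>v x) \<le> B" if "x \<in> ?X" for x using le that A by auto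
  have up: "op_norm w A \<le> B" unfolding op_norm_def by (rule cSUP_least) (use ne b in auto)
  have "0 \<le> lw_norm w (A *\<^sub>v unit_vec n 0)" by (rule lw_norm_nonneg) (use A n in simp)
  also have "\<dots> \<le> op_norm w A" unfolding op_norm_def
    by (rule cSUP_upper[OF ne]) (use b in \<open>auto intro!: bdd_aboveI2\<close>)
  finally show ?thesis using up by simp
qed

text \<open>This is the Schur test. For finite \<open>w\<close>, Jensen's inequality in each row
  yields a factor \<open>B powr (w - 1)\<close> from the row sum; after the order of summation is
  exchanged, the column sums contribute the last factor \<open>B\<close>.\<close>

lemma op_norm_le_row_col_sums:
  assumes A: "A \<in> carrier_mat n n" and n: "0 < n" and w: "1 \<le> w"
    and row: "\<And>i. i < n \<Longrightarrow> (\<Sum>j<n. \<bar>A $$ (i, j)\<bar>) \<le> B"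
    and col: "\<And>j. j < n \<Longrightarrow> (\<Sum>i<n. \<bar>A $$ (i, j)\<bar>) \<le> B"
  shows "\<bar>op_norm w A\<bar> \<le> B"
proof (rule op_norm_le[OF A n])
  fix x :: "real vec" assume x: "x \<in> carrier_vec n" and x1: "lw_norm w x = 1"
  have "0 \<le> (\<Sum>j<n. \<bar>A $$ (0, j)\<bar>)" by (simp add: sum_nonneg)
  then have B0: "0 \<le> B" using row[OF n] by linarith
  show "lw_norm w (A *\<^sub>v x) \<le> B"
  proof (cases "w = \<infinity>")
    case True
    have xj: "\<bar>x $ j\<bar> \<le> 1" if "j < n" for j
    proof -
      have "\<bar>x $ j\<bar> \<le> (MAX i\<in>{..<n}. \<bar>x $ i\<bar>)" using that by (intro Max_ge) auto
      then show ?thesis using x1 True x by (simp add: lw_norm_def)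
    qed
    have "\<bar>(A *\<^sub>v x) $ i\<bar> \<le> B" if i: "i < n" for i
    proof -
      have "\<bar>(A *\<^sub>v x) $ i\<bar> \<le> (\<Sum>j<n. \<bar>A $$ (i, j)\<bar> * \<bar>x $ j\<bar>)" by (rule abs_mult_mat_vec_le[OF A x i])
      also have "\<dots> \<le> (\<Sum>j<n. \<bar>A $$ (i, j)\<bar> * 1)" by (intro sum_mono mult_left_mono) (use xj in auto)
      finally show ?thesis using row[OF i] by simp
    qed
    then have "(MAX i\<in>{..<n}. \<bar>(A *\<^sub>v x) $ i\<bar>) \<le> B" using n by (intro Max.boundedI) auto
    then show ?thesis using True A by (simp add: lw_norm_def)
  next
    case False
    define p where "p = real_of_ereal w"
    have wp: "w = ereal p" using w False unfolding p_def by (cases w) auto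
    then have p: "1 \<le> p" using w by simp
    have "(\<Sum>i<n. \<bar>x $ i\<bar> powr p) powr (1 / p) = 1" using x1 x wp by (simp add: lw_norm_def)
    then have "((\<Sum>i<n. \<bar>x $ i\<bar> powr p) powr (1 / p)) powr p = 1" by simp
    then have xs: "(\<Sum>i<n. \<bar>x $ i\<bar> powr p) = 1"
      using p by (simp add: powr_powr sum_nonneg)
    have each: "\<bar>(A *\<^sub>v x) $ i\<bar> powr p \<le> B powr (p - 1) * (\<Sum>j<n. \<bar>A $$ (i, j)\<bar> * \<bar>x $ j\<bar> powr p)" if i: "i < n" for i
    proof -
      have "\<bar>(A *\<^sub>v x) $ i\<bar> powr p \<le> (\<Sum>j<n. \<bar>A $$ (i, j)\<bar> * \<bar>x $ j\<bar>) powr p"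
        using abs_mult_mat_vec_le[OF A x i] p by (intro powr_mono2) auto
      also have "\<dots> \<le> B powr (p - 1) * (\<Sum>j<n. \<bar>A $$ (i, j)\<bar> * \<bar>x $ j\<bar> powr p)"
        by (rule weighted_powr_le) (use p row[OF i] in auto)
      finally show ?thesis .
    qed
    have "(\<Sum>i<n. \<bar>(A *\<^sub>v x) $ i\<bar> powr p) \<le> (\<Sum>i<n. B powr (p - 1) * (\<Sum>j<n. \<bar>A $$ (i, j)\<bar> * \<bar>x $ j\<bar> powr p))"
      by (rule sum_mono) (use each in auto)
    also have "\<dots> = B powr (p - 1) * (\<Sum>j<n. (\<Sum>i<n. \<bar>A $$ (i, j)\<bar>) * \<bar>x $ j\<bar> powr p)"
      by (simp add: sum_distrib_left[symmetric] sum_distrib_right) (subst sum.swap, simp)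
    also have "\<dots> \<le> B powr (p - 1) * (\<Sum>j<n. B * \<bar>x $ j\<bar> powr p)"
      by (intro mult_left_mono sum_mono mult_right_mono) (use col in auto)
    also have "\<dots> = B powr (p - 1) * B" using xs by (simp add: sum_distrib_left[symmetric])
    also have "\<dots> = B powr p" using B0 by (cases "B = 0") (auto simp: powr_diff)
    finally have "(\<Sum>i<n. \<bar>(A *\<^sub>v x) $ i\<bar> powr p) \<le> B powr p" .
    then have "(\<Sum>i<n. \<bar>(A *\<^sub>v x) $ i\<bar> powr p) powr (1 / p) \<le> (B powr p) powr (1 / p)"
      using p by (intro powr_mono2) (auto intro: sum_nonneg)
    also have "\<dots> = B" using p B0 by (simp add: powr_powr)
    finally show ?thesis using A wp by (simp add: lw_norm_def)
  qed
qed

lemma lw_norm_2: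
  assumes "x \<in> carrier_vec n"
  shows "lw_norm 2 x = sqrt (x \<bullet> x)"
proof -
  have e: "real_of_ereal 2 = 2" by simp
  have "(\<Sum>i<n. \<bar>x $ i\<bar> powr 2) = x \<bullet> x"
    using scalar_prod_sum_lessThan[OF assms, of x] by (simp add: power2_eq_square)
  then show ?thesis using assms scalar_prod_self_nonneg[of x]
    unfolding lw_norm_def e by (simp add: powr_half_sqrt)
qed

lemma op_norm_2_le:
  assumes A: "A \<in> carrier_mat n n" and n: "0 < n" and B: "0 \<le> B"
    and le: "\<And>x. x \<in> carrier_vec n \<Longrightarrow> (A *\<^sub>v x) \<bullet> (A *\<^sub>v x) \<le> B\<^sup>2 * (x \<bullet> x)"
  shows "\<bar>op_norm 2 A\<bar> \<le> B"
proof (rule op_norm_le[OF A n])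
  fix x :: "real vec" assume x: "x \<in> carrier_vec n" and x1: "lw_norm 2 x = 1"
  have "x \<bullet> x = 1" using x1 unfolding lw_norm_2[OF x] by simp
  then have "(A *\<^sub>v x) \<bullet> (A *\<^sub>v x) \<le> B\<^sup>2" using le[OF x] by simp
  then have "sqrt ((A *\<^sub>v x) \<bullet> (A *\<^sub>v x)) \<le> B" using B by (metis real_sqrt_le_mono real_sqrt_abs abs_of_nonneg)
  then show "lw_norm 2 (A *\<^sub>v x) \<le> B" using lw_norm_2[of "A *\<^sub>v x" n] A x by simp
qed

text \<open>The Schur test at exponent 2, as an inequality for all vectors: the perturbation
  argument for the inverse uses it at vectors that are not normalized.\<close>

lemma sq_norm_le_row_col_sums:
  fixes A :: "real mat"
  assumes A: "A \<in> carrier_mat n n"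
    and row: "\<And>i. i < n \<Longrightarrow> (\<Sum>j<n. \<bar>A $$ (i, j)\<bar>) \<le> B"
    and col: "\<And>j. j < n \<Longrightarrow> (\<Sum>i<n. \<bar>A $$ (i, j)\<bar>) \<le> B" and B: "0 \<le> B"
    and x: "x \<in> carrier_vec n"
  shows "(A *\<^sub>v x) \<bullet> (A *\<^sub>v x) \<le> B\<^sup>2 * (x \<bullet> x)"
proof -
  have each: "((A *\<^sub>v x) $ i)\<^sup>2 \<le> B * (\<Sum>j<n. \<bar>A $$ (i, j)\<bar> * (x $ j)\<^sup>2)" if i: "i < n" for i
  proof -
    have nn: "0 \<le> (\<Sum>j<n. \<bar>A $$ (i, j)\<bar> * \<bar>x $ j\<bar>)" by (simp add: sum_nonneg)
    have "((A *\<^sub>v x) $ i)\<^sup>2 \<le> (\<Sum>j<n. \<bar>A $$ (i, j)\<bar> * \<bar>x $ j\<bar>)\<^sup>2"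
      using abs_mult_mat_vec_le[OF A x i] nn by (simp add: abs_le_square_iff[symmetric])
    also have "\<dots> = (\<Sum>j<n. \<bar>A $$ (i, j)\<bar> * \<bar>x $ j\<bar>) powr 2" using nn by simp
    also have "\<dots> \<le> B powr (2 - 1) * (\<Sum>j<n. \<bar>A $$ (i, j)\<bar> * \<bar>x $ j\<bar> powr 2)"
      by (rule weighted_powr_le) (use row[OF i] in auto)
    finally show ?thesis using B by simp
  qed
  have "(A *\<^sub>v x) \<bullet> (A *\<^sub>v x) = (\<Sum>i<n. ((A *\<^sub>v x) $ i)\<^sup>2)"
    using scalar_prod_sum_lessThan[of "A *\<^sub>v x" n "A *\<^sub>v x"] A x by (simp add: power2_eq_square)
  also have "\<dots> \<le> (\<Sum>i<n. B * (\<Sum>j<n. \<bar>A $$ (i, j)\<bar> * (x $ j)\<^sup>2))"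
    by (rule sum_mono) (use each in auto)
  also have "\<dots> = B * (\<Sum>j<n. (\<Sum>i<n. \<bar>A $$ (i, j)\<bar>) * (x $ j)\<^sup>2)"
    by (simp add: sum_distrib_left[symmetric] sum_distrib_right) (subst sum.swap, simp)
  also have "\<dots> \<le> B * (\<Sum>j<n. B * (x $ j)\<^sup>2)"
    by (intro mult_left_mono sum_mono mult_right_mono) (use col B in auto)
  also have "\<dots> = B\<^sup>2 * (x \<bullet> x)"
    by (simp add: sum_distrib_left[symmetric] power2_eq_square scalar_prod_sum_lessThan[OF x])
  finally show ?thesis .
qed

subsection \<open>Error bound for the graphical Lasso\<close>

text \<open>The product \<open>C A C\<close> with the diagonal matrix \<open>C\<close> of the
  numbers \<open>c i\<close>. Written entrywise, it visibly keeps the zero pattern of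
  \<open>A\<close> when no \<open>c i\<close> vanishes.\<close>

definition diag_scale :: "nat \<Rightarrow> (nat \<Rightarrow> real) \<Rightarrow> real mat \<Rightarrow> real mat" where
  "diag_scale n c A = mat n n (\<lambda>(i, j). c i * c j * A $$ (i, j))"

lemma diag_scale_carrier [simp]: "diag_scale n c A \<in> carrier_mat n n"
  by (simp add: diag_scale_def)

lemma diag_scale_index: "i < n \<Longrightarrow> j < n \<Longrightarrow> diag_scale n c A $$ (i, j) = c i * c j * A $$ (i, j)"
  by (simp add: diag_scale_def)

lemma diag_scale_quad:
  assumes A: "A \<in> carrier_mat n n" and y: "y \<in> carrier_vec n"
  shows "y \<bullet> (diag_scale n c A *\<^sub>v y) = vec n (\<lambda>i. c i * y $ i) \<bullet> (A *\<^sub>v vec n (\<lambda>i. c i * y $ i))"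
proof -
  have v: "vec n (\<lambda>i. c i * y $ i) \<in> carrier_vec n" by simp
  show ?thesis unfolding bilinear_sum[OF diag_scale_carrier y y] bilinear_sum[OF A v v]
    by (intro sum.cong refl) (auto simp: diag_scale_index)
qed

lemma diag_scale_pd:
  assumes A: "pd_mat n A" and c: "\<And>i. i < n \<Longrightarrow> c i \<noteq> 0"
  shows "pd_mat n (diag_scale n c A)"
proof -
  have Ac: "A \<in> carrier_mat n n" and s: "sym_mat n A" using A by (auto simp: pd_mat_def sym_mat_def)
  have "sym_mat n (diag_scale n c A)" unfolding sym_mat_def
    using sym_index[OF s] by (auto intro!: eq_matI simp: diag_scale_def)
  moreover have "0 < y \<bullet> (diag_scale n c A *\<^sub>v y)" if y: "y \<in> carrier_vec n" "y \<noteq> 0\<^sub>v n" for y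
  proof -
    obtain i where i: "i < n" "y $ i \<noteq> 0" using y by (metis carrier_vecD eq_vecI index_zero_vec)
    have "vec n (\<lambda>i. c i * y $ i) \<noteq> 0\<^sub>v n"
    proof
      assume "vec n (\<lambda>i. c i * y $ i) = 0\<^sub>v n"
      from arg_cong[OF this, of "\<lambda>v. v $ i"] show False using i c by simp
    qed
    then show ?thesis unfolding diag_scale_quad[OF Ac y(1)] using A by (auto simp: pd_mat_def)
  qed
  ultimately show ?thesis by (auto simp: pd_mat_def)
qed

lemma diag_scale_inverse:
  assumes A: "A \<in> carrier_mat n n" and B: "B \<in> carrier_mat n n" and AB: "A * B = 1\<^sub>m n"
    and c: "\<And>i. i < n \<Longrightarrow> c i \<noteq> 0"
  shows "diag_scale n c A * diag_scale n (\<lambda>i. 1 / c i) B = 1\<^sub>m n"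
proof (rule eq_matI)
  fix i j assume "i < dim_row (1\<^sub>m n :: real mat)" "j < dim_col (1\<^sub>m n :: real mat)"
  then have ij: "i < n" "j < n" by auto
  have "(\<Sum>k<n. A $$ (i, k) * B $$ (k, j)) = (A * B) $$ (i, j)"
    using A B ij by (simp add: scalar_prod_def lessThan_atLeast0)
  then have AB': "(\<Sum>k<n. A $$ (i, k) * B $$ (k, j)) = (if i = j then 1 else 0)" unfolding AB using ij by simp
  have "(diag_scale n c A * diag_scale n (\<lambda>i. 1 / c i) B) $$ (i, j) =
      (\<Sum>k<n. (c i * c k * A $$ (i, k)) * (1 / c k * (1 / c j) * B $$ (k, j)))"
    using ij by (simp add: diag_scale_def scalar_prod_def lessThan_atLeast0)
  also have "\<dots> = (\<Sum>k<n. c i / c j * (A $$ (i, k) * B $$ (k, j)))"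
    by (rule sum.cong) (use c in \<open>auto simp: field_simps\<close>)
  also have "\<dots> = c i / c j * (if i = j then 1 else 0)" by (simp only: sum_distrib_left[symmetric] AB')
  also have "\<dots> = 1\<^sub>m n $$ (i, j)" using ij c by simp
  finally show "(diag_scale n c A * diag_scale n (\<lambda>i. 1 / c i) B) $$ (i, j) = 1\<^sub>m n $$ (i, j)" .
qed (auto simp: diag_scale_def)

lemma geometric_mean_bounds:
  fixes x y :: real
  assumes "0 \<le> l" "l \<le> x" "x \<le> u" "l \<le> y" "y \<le> u"
  shows "l \<le> sqrt (x * y)" "sqrt (x * y) \<le> u"
proof -
  have "l * l \<le> x * y" using assms by (intro mult_mono) auto
  then show "l \<le> sqrt (x * y)" using assms by (intro real_le_rsqrt) (simp add: power2_eq_square)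
  have "x * y \<le> u * u" using assms by (intro mult_mono) auto
  then show "sqrt (x * y) \<le> u" using assms by (intro real_le_lsqrt) (auto simp: power2_eq_square)
qed

text \<open>Since the diagonals of \<open>S\<close> and \<open>Sig\<close> agree, the unpenalized diagonal entries produce no
  noise term, which is why the bound involves off-diagonal entries only.\<close>

lemma glasso_basic_inequality:
  assumes S: "S \<in> carrier_mat n n" and lam: "0 < lam" and sol: "glasso_solution n S lam H"
    and T: "pd_mat n T" and Sig: "Sig \<in> carrier_mat n n" "T * Sig = 1\<^sub>m n"
    and diag: "\<And>i. i < n \<Longrightarrow> Sig $$ (i, i) = S $$ (i, i)"
    and noise: "\<And>i j. i < n \<Longrightarrow> j < n \<Longrightarrow> \<bar>Sig $$ (i, j) - S $$ (i, j)\<bar> \<le> N"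
    and wt: "\<And>i j. i < n \<Longrightarrow> j < n \<Longrightarrow> l \<le> sqrt (S $$ (i, i) * S $$ (j, j))"
      "\<And>i j. i < n \<Longrightarrow> j < n \<Longrightarrow> sqrt (S $$ (i, i) * S $$ (j, j)) \<le> u"
    and a: "0 \<le> a" "\<And>y. y \<in> carrier_vec n \<Longrightarrow> y \<bullet> (T *\<^sub>v y) \<le> a * (y \<bullet> y)"
  obtains x where "0 \<le> x" "frob_sq (H - T) \<le> a\<^sup>2 * x\<^sup>2"
    "x\<^sup>2 / (2 * (1 + x)) \<le>
      (N + lam * u) * (\<Sum>(i, j)\<in>{(i, j)\<in>offdiag n. T $$ (i, j) \<noteq> 0}. \<bar>H $$ (i, j) - T $$ (i, j)\<bar>)
      - (lam * l - N) * (\<Sum>(i, j)\<in>{(i, j)\<in>offdiag n. T $$ (i, j) = 0}. \<bar>H $$ (i, j) - T $$ (i, j)\<bar>)"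
proof -
  have pdH: "pd_mat n H" and opt: "glasso_objective n S lam H \<le> glasso_objective n S lam T"
    using sol T by (auto simp: glasso_solution_def)
  have Hc: "H \<in> carrier_mat n n" and Tc: "T \<in> carrier_mat n n" and sH: "sym_mat n H" and sT: "sym_mat n T"
    using pdH T by (auto simp: pd_mat_def sym_mat_def)
  let ?D = "\<lambda>i j. H $$ (i, j) - T $$ (i, j)"
  let ?w = "\<lambda>i j. sqrt (S $$ (i, i) * S $$ (j, j))"
  let ?A = "{(i, j)\<in>offdiag n. T $$ (i, j) \<noteq> 0}" and ?B = "{(i, j)\<in>offdiag n. T $$ (i, j) = 0}"
  obtain x where x: "0 \<le> x" "frob_sq (H - T) \<le> a\<^sup>2 * x\<^sup>2"
    "ln (det H) - ln (det T) + x\<^sup>2 / (2 * (1 + x)) \<le> mat_trace (Sig * (H - T))"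
    by (rule ln_det_bregman[OF T pdH Sig a(1)], rule a(2), assumption, rule that)
  have "mat_trace (Sig * (H - T)) = (\<Sum>i<n. \<Sum>j<n. Sig $$ (i, j) * (H - T) $$ (j, i))"
    by (rule mat_trace_mult_sum[OF Sig(1) minus_carrier_mat[OF Tc]])
  also have "\<dots> = (\<Sum>i<n. \<Sum>j<n. Sig $$ (j, i) * ?D i j)"
    by (subst sum.swap) (use Hc Tc in auto)
  finally have tr: "mat_trace (Sig * (H - T)) = (\<Sum>i<n. \<Sum>j<n. Sig $$ (j, i) * ?D i j)" .
  \<comment> \<open>The log-determinants of the Bregman bound and of the two objectives cancel,
    leaving traces and penalties.\<close>
  have "x\<^sup>2 / (2 * (1 + x)) \<le> (\<Sum>i<n. \<Sum>j<n. Sig $$ (j, i) * ?D i j)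
      - ((\<Sum>i<n. \<Sum>j<n. H $$ (i, j) * S $$ (j, i)) - (\<Sum>i<n. \<Sum>j<n. T $$ (i, j) * S $$ (j, i)))
      + (lam * (\<Sum>(i, j)\<in>offdiag n. ?w i j * \<bar>T $$ (i, j)\<bar>) - lam * (\<Sum>(i, j)\<in>offdiag n. ?w i j * \<bar>H $$ (i, j)\<bar>))"
    using x(3) opt unfolding tr glasso_objective_sum[OF Hc S] glasso_objective_sum[OF Tc S] by linarith
  also have "\<dots> = (\<Sum>i<n. \<Sum>j<n. (Sig $$ (j, i) - S $$ (j, i)) * ?D i j)
      + (\<Sum>(i, j)\<in>offdiag n. lam * ?w i j * (\<bar>T $$ (i, j)\<bar> - \<bar>H $$ (i, j)\<bar>))"
    by (simp add: sum_subtractf sum_distrib_left case_prod_unfold algebra_simps)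
  also have "\<dots> = (\<Sum>(i, j)\<in>offdiag n. (Sig $$ (j, i) - S $$ (j, i)) * ?D i j
      + lam * ?w i j * (\<bar>T $$ (i, j)\<bar> - \<bar>H $$ (i, j)\<bar>))"
    unfolding sum_diag_offdiag using diag by (simp add: sum.distrib case_prod_unfold)
  \<comment> \<open>On the support of \<open>T\<close> the penalty difference is estimated by the
    triangle inequality and acts against the bound. Off the support \<open>T\<close> vanishes, so
    the penalty difference is the full negative error and can absorb the noise.\<close>
  also have "\<dots> \<le> (\<Sum>(i, j)\<in>offdiag n. if T $$ (i, j) \<noteq> 0 then (N + lam * u) * \<bar>?D i j\<bar> else - ((lam * l - N) * \<bar>?D i j\<bar>))"
  proof (rule sum_mono, clarify)
    fix i j assume "(i, j) \<in> offdiag n"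
    then have ij: "i < n" "j < n" by (auto simp: offdiag_def)
    have n1: "(Sig $$ (j, i) - S $$ (j, i)) * ?D i j \<le> N * \<bar>?D i j\<bar>"
    proof -
      have "(Sig $$ (j, i) - S $$ (j, i)) * ?D i j \<le> \<bar>Sig $$ (j, i) - S $$ (j, i)\<bar> * \<bar>?D i j\<bar>"
        unfolding abs_mult[symmetric] by (rule abs_ge_self)
      also have "\<dots> \<le> N * \<bar>?D i j\<bar>" by (rule mult_right_mono[OF noise]) (use ij in auto)
      finally show ?thesis .
    qed
    have w: "l \<le> ?w i j" "?w i j \<le> u" using wt[OF ij] .
    have w0: "0 \<le> lam * ?w i j"
    proof -
      have "0 \<le> S $$ (i, i) * S $$ (j, j)"
        using sol \<open>(i, j) \<in> offdiag n\<close> by (auto simp: glasso_solution_def offdiag_def)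
      then show ?thesis using lam by simp
    qed
    show "(Sig $$ (j, i) - S $$ (j, i)) * ?D i j + lam * ?w i j * (\<bar>T $$ (i, j)\<bar> - \<bar>H $$ (i, j)\<bar>)
      \<le> (if T $$ (i, j) \<noteq> 0 then (N + lam * u) * \<bar>?D i j\<bar> else - ((lam * l - N) * \<bar>?D i j\<bar>))"
    proof (cases "T $$ (i, j) = 0")
      case True
      have "lam * l * \<bar>?D i j\<bar> \<le> lam * ?w i j * \<bar>?D i j\<bar>"
        using w lam by (intro mult_right_mono mult_left_mono) auto
      then show ?thesis using n1 True by (simp add: algebra_simps)
    next
      case False
      have "lam * ?w i j * (\<bar>T $$ (i, j)\<bar> - \<bar>H $$ (i, j)\<bar>) \<le> lam * ?w i j * \<bar>?D i j\<bar>"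
        by (rule mult_left_mono[OF _ w0]) linarith
      also have "\<dots> \<le> lam * u * \<bar>?D i j\<bar>"
        using w lam by (intro mult_right_mono mult_left_mono) auto
      finally show ?thesis using n1 False by (simp add: distrib_right)
    qed
  qed
  also have "\<dots> = (\<Sum>(i, j)\<in>?A. (N + lam * u) * \<bar>?D i j\<bar>) + (\<Sum>(i, j)\<in>?B. - ((lam * l - N) * \<bar>?D i j\<bar>))"
  proof -
    have "offdiag n = ?A \<union> ?B" by auto
    then have "(\<Sum>(i, j)\<in>offdiag n. if T $$ (i, j) \<noteq> 0 then (N + lam * u) * \<bar>?D i j\<bar> else - ((lam * l - N) * \<bar>?D i j\<bar>)) =
      (\<Sum>(i, j)\<in>?A \<union> ?B. if T $$ (i, j) \<noteq> 0 then (N + lam * u) * \<bar>?D i j\<bar> else - ((lam * l - N) * \<bar>?D i j\<bar>))" by simp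
    also have "\<dots> = (\<Sum>(i, j)\<in>?A. if T $$ (i, j) \<noteq> 0 then (N + lam * u) * \<bar>?D i j\<bar> else - ((lam * l - N) * \<bar>?D i j\<bar>))
      + (\<Sum>(i, j)\<in>?B. if T $$ (i, j) \<noteq> 0 then (N + lam * u) * \<bar>?D i j\<bar> else - ((lam * l - N) * \<bar>?D i j\<bar>))"
      by (rule sum.union_disjoint) (auto intro: finite_subset[OF _ finite_offdiag[of n]])
    also have "\<dots> = (\<Sum>(i, j)\<in>?A. (N + lam * u) * \<bar>?D i j\<bar>) + (\<Sum>(i, j)\<in>?B. - ((lam * l - N) * \<bar>?D i j\<bar>))"
      by (intro arg_cong2[of _ _ _ _ "(+)"] sum.cong) auto
    finally show ?thesis .
  qed
  also have "\<dots> = (N + lam * u) * (\<Sum>(i, j)\<in>?A. \<bar>?D i j\<bar>) - (lam * l - N) * (\<Sum>(i, j)\<in>?B. \<bar>?D i j\<bar>)"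
    by (simp add: sum_distrib_left sum_negf case_prod_unfold)
  finally show ?thesis using that[OF x(1,2)] by simp
qed

text \<open>Since the modulus grows only linearly, a linear right-hand side confines
  \<open>x\<close> only if its slope is small. Cancelling \<open>x\<close> gives
  \<open>x \<le> g * (1 + x)\<close>, and \<open>g \<le> 1 / 2\<close> absorbs the product
  \<open>g * x\<close>.\<close>

lemma self_bounded_solve:
  fixes x g :: real
  assumes "0 \<le> x" "0 \<le> g" "g \<le> 1 / 2" "x\<^sup>2 / (2 * (1 + x)) \<le> g / 2 * x"
  shows "x \<le> 2 * g"
proof (cases "x = 0")
  case True
  then show ?thesis using assms by simp
next
  case False
  then have x: "0 < x" using assms by simp
  then have "x * x \<le> x * (g * (1 + x))" using assms(4) by (simp add: field_simps power2_eq_square)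
  then have "x \<le> g * (1 + x)" using x by simp
  moreover have "g * x \<le> x / 2" using mult_right_mono[OF assms(3) assms(1)] by simp
  ultimately show ?thesis by (simp add: distrib_left)
qed

lemma sum_abs_le_sqrt_card:
  fixes f :: "'b \<Rightarrow> real"
  shows "(\<Sum>i\<in>I. \<bar>f i\<bar>) \<le> sqrt (real (card I)) * sqrt (\<Sum>i\<in>I. (f i)\<^sup>2)"
proof -
  have "(\<Sum>i\<in>I. 1 * \<bar>f i\<bar>)\<^sup>2 \<le> (\<Sum>i\<in>I. 1\<^sup>2) * (\<Sum>i\<in>I. \<bar>f i\<bar>\<^sup>2)"
    by (rule Cauchy_Schwarz_ineq_sum)
  then have "(\<Sum>i\<in>I. \<bar>f i\<bar>)\<^sup>2 \<le> real (card I) * (\<Sum>i\<in>I. (f i)\<^sup>2)" by simp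
  then have "sqrt ((\<Sum>i\<in>I. \<bar>f i\<bar>)\<^sup>2) \<le> sqrt (real (card I) * (\<Sum>i\<in>I. (f i)\<^sup>2))"
    by (rule real_sqrt_le_mono)
  then show ?thesis by (simp add: real_sqrt_mult sum_nonneg)
qed

lemma offdiag_nonzeros_card:
  assumes "A \<in> carrier_mat n n"
  shows "offdiag_nonzeros A = card {(i, j)\<in>offdiag n. A $$ (i, j) \<noteq> 0}"
  unfolding offdiag_nonzeros_def offdiag_def using assms by (intro arg_cong[of _ _ card]) auto

lemma frob_sq_subset:
  assumes "A \<in> carrier_mat n n" "I \<subseteq> {..<n} \<times> {..<n}"
  shows "(\<Sum>(i, j)\<in>I. (A $$ (i, j))\<^sup>2) \<le> frob_sq A"
proof -
  have "frob_sq A = (\<Sum>(i, j)\<in>{..<n} \<times> {..<n}. (A $$ (i, j))\<^sup>2)"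
    using assms(1) by (simp add: frob_sq_def sum.cartesian_product)
  then show ?thesis using assms(2) by (auto intro!: sum_mono2)
qed

text \<open>A single row may hold all the nonzero entries, so it is charged with the total count;
  the additional 1 is for the diagonal entry.\<close>

lemma row_sum_le_nonzeros:
  assumes A: "A \<in> carrier_mat n n" and i: "i < n" and K: "0 \<le> K"
    and le: "\<And>j. j < n \<Longrightarrow> \<bar>A $$ (i, j)\<bar> \<le> K"
  shows "(\<Sum>j<n. \<bar>A $$ (i, j)\<bar>) \<le> K * (1 + real (offdiag_nonzeros A))"
proof -
  let ?J = "{j. j < n \<and> j \<noteq> i \<and> A $$ (i, j) \<noteq> 0}"
  have fJ: "finite ?J" by simp
  have "(\<Sum>j<n. \<bar>A $$ (i, j)\<bar>) = (\<Sum>j\<in>insert i ?J. \<bar>A $$ (i, j)\<bar>)"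
    by (rule sum.mono_neutral_right) (use i in auto)
  also have "\<dots> \<le> (\<Sum>j\<in>insert i ?J. K)" by (rule sum_mono) (use le i in auto)
  also have "\<dots> = K * (1 + real (card ?J))" by (simp add: algebra_simps)
  also have "\<dots> \<le> K * (1 + real (offdiag_nonzeros A))"
  proof -
    have "card ?J = card ((\<lambda>j. (i, j)) ` ?J)" by (subst card_image) (auto simp: inj_on_def)
    also have "\<dots> \<le> card {(i, j)\<in>offdiag n. A $$ (i, j) \<noteq> 0}"
      by (rule card_mono) (use i in \<open>auto intro: finite_subset[OF _ finite_offdiag[of n]] simp: offdiag_def\<close>)
    finally show ?thesis using K unfolding offdiag_nonzeros_card[OF A] by (intro mult_left_mono) auto
  qed
  finally show ?thesis .
qed

text \<open>The comparison matrix \<open>diag_scale n c Th\<close> is chosen so that its inverse has the diagonal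
  of \<open>S\<close>.\<close>

lemma glasso_rate:
  assumes n: "0 < n" and K: "1 \<le> K" and Sig: "pd_mat n Sig"
    and low: "\<And>y. y \<in> carrier_vec n \<Longrightarrow> y \<bullet> y \<le> K * (y \<bullet> (Sig *\<^sub>v y))"
    and up: "\<And>y. y \<in> carrier_vec n \<Longrightarrow> y \<bullet> (Sig *\<^sub>v y) \<le> K * (y \<bullet> y)"
    and Th: "Th \<in> carrier_mat n n" "Sig * Th = 1\<^sub>m n"
    and S: "psd_mat n S" and lam: "0 < lam" and \<delta>: "0 \<le> \<delta>"
    and close: "\<And>i j. i < n \<Longrightarrow> j < n \<Longrightarrow> \<bar>S $$ (i, j) - Sig $$ (i, j)\<bar> \<le> \<delta> * lam"
    and m: "real (offdiag_nonzeros Th) \<le> m" "1 \<le> m"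
    and small: "\<delta> * lam * K \<le> 1 / 2" "\<delta> * (1 + K\<^sup>2) \<le> 1 / (4 * K)" "12 * K\<^sup>2 * lam * m \<le> 1 / 2"
    and sol: "glasso_solution n S lam H" and i: "i < n"
  shows "(\<Sum>j<n. \<bar>H $$ (i, j) - Th $$ (i, j)\<bar>) \<le> (48 * K ^ 3 * (2 + 12 * K\<^sup>2) + 4 * K\<^sup>2) * m * lam"
proof -
  have K0: "0 < K" using K by simp
  have Sc: "S \<in> carrier_mat n n" using S by (auto simp: psd_mat_def sym_mat_def)
  have Sigc: "Sig \<in> carrier_mat n n" using Sig by (auto simp: pd_mat_def sym_mat_def)
  have ThSig: "Th * Sig = 1\<^sub>m n" by (rule mat_mult_left_right_inverse[OF Sigc Th])
  have pdTh: "pd_mat n Th" by (rule inverse_pd[OF Sig Th])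
  have Thup: "y \<bullet> (Th *\<^sub>v y) \<le> K * (y \<bullet> y)" if "y \<in> carrier_vec n" for y
    by (rule inverse_quad_upper[OF Sig Th K0 low that])
  have e1: "unit_vec n i \<bullet> unit_vec n i = (1 :: real)" if "i < n" for i using that by simp
  have Sig_ii: "1 / K \<le> Sig $$ (i, i)" "Sig $$ (i, i) \<le> K" if "i < n" for i
    using low[of "unit_vec n i"] up[of "unit_vec n i"] unit_bilinear[OF Sigc that that] e1[OF that] K0
    by (auto simp: field_simps)
  have Th_ii: "Th $$ (i, i) \<le> K" if "i < n" for i
    using Thup[of "unit_vec n i"] unit_bilinear[OF Th(1) that that] e1[OF that] by simp
  have Sig_ij: "\<bar>Sig $$ (i, j)\<bar> \<le> K" if "i < n" "j < n" for i j
    using psd_entry_bound[OF pd_imp_psd[OF Sig] that]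
      geometric_mean_bounds(2)[of 0 "Sig $$ (i, i)" K "Sig $$ (j, j)"] Sig_ii that pd_diag_pos[OF Sig]
    by (meson less_imp_le order_refl order_trans)
  have Th_ij: "\<bar>Th $$ (i, j)\<bar> \<le> K" if "i < n" "j < n" for i j
    using psd_entry_bound[OF pd_imp_psd[OF pdTh] that]
      geometric_mean_bounds(2)[of 0 "Th $$ (i, i)" K "Th $$ (j, j)"] Th_ii that pd_diag_pos[OF pdTh]
    by (meson less_imp_le order_refl order_trans)
  \<comment> \<open>A bound on the relative error of the diagonal of \<open>S\<close>: the absolute
    error is at most \<open>\<delta> * lam\<close>, and the diagonal of \<open>Sig\<close> is at
    least \<open>1 / K\<close>.\<close>
  define \<kappa> where "\<kappa> = \<delta> * lam * K"
  have \<kappa>: "0 \<le> \<kappa>" "\<kappa> \<le> 1 / 2" using \<delta> lam K0 small(1) by (auto simp: \<kappa>_def)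
  define q where "q i = S $$ (i, i) / Sig $$ (i, i)" for i
  have q: "1 - \<kappa> \<le> q i" "q i \<le> 1 + \<kappa>" if "i < n" for i
  proof -
    have p: "0 < Sig $$ (i, i)" using pd_diag_pos[OF Sig that] .
    have "q i - 1 = (S $$ (i, i) - Sig $$ (i, i)) / Sig $$ (i, i)" using p by (simp add: q_def diff_divide_distrib)
    then have "\<bar>q i - 1\<bar> = \<bar>S $$ (i, i) - Sig $$ (i, i)\<bar> / Sig $$ (i, i)" using p by simp
    also have "\<dots> \<le> (\<delta> * lam) / (1 / K)"
      using close[OF that that] Sig_ii(1)[OF that] K0 \<delta> lam by (intro frac_le) auto
    finally have "\<bar>q i - 1\<bar> \<le> \<kappa>" by (simp add: \<kappa>_def)
    then show "1 - \<kappa> \<le> q i" "q i \<le> 1 + \<kappa>" by linarith+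
  qed
  have q0: "0 < q i" if "i < n" for i using q(1)[OF that] \<kappa>(2) by linarith
  \<comment> \<open>The inverse of \<open>diag_scale n c Th\<close> multiplies the diagonal of
    \<open>Sig\<close> by \<open>1 / (c i)^2 = q i\<close>, which is exactly the passage to the
    diagonal of \<open>S\<close>.\<close>
  define c where "c i = 1 / sqrt (q i)" for i
  have c0: "c i \<noteq> 0" if "i < n" for i using q0[OF that] by (simp add: c_def)
  define g where "g i j = sqrt (q i * q j)" for i j
  have g: "1 - \<kappa> \<le> g i j" "g i j \<le> 1 + \<kappa>" if "i < n" "j < n" for i j
    unfolding g_def using geometric_mean_bounds[of "1 - \<kappa>" "q i" "1 + \<kappa>" "q j"] q that \<kappa> by auto
  have g0: "0 < g i j" if "i < n" "j < n" for i j using g(1)[OF that] \<kappa>(2) by linarith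
  have cc: "c i * c j = 1 / g i j" for i j by (simp add: c_def g_def real_sqrt_mult)
  define T where "T = diag_scale n c Th"
  define Sg where "Sg = diag_scale n (\<lambda>i. 1 / c i) Sig"
  have pdT: "pd_mat n T" unfolding T_def by (rule diag_scale_pd[OF pdTh c0])
  have Tc: "T \<in> carrier_mat n n" unfolding T_def by simp
  have TSg: "T * Sg = 1\<^sub>m n" unfolding T_def Sg_def by (rule diag_scale_inverse[OF Th(1) Sigc ThSig c0])
  have Sgc: "Sg \<in> carrier_mat n n" unfolding Sg_def by simp
  have Sgij: "Sg $$ (i, j) = g i j * Sig $$ (i, j)" if "i < n" "j < n" for i j
    unfolding Sg_def using that by (simp add: diag_scale_index c_def g_def real_sqrt_mult)
  have Sgdiag: "Sg $$ (i, i) = S $$ (i, i)" if "i < n" for i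
  proof -
    have "g i i = q i" unfolding g_def using q0[OF that] by simp
    then show ?thesis unfolding Sgij[OF that that] using pd_diag_pos[OF Sig that] by (simp add: q_def)
  qed
  \<comment> \<open>The rescaling moves each entry of \<open>Sig\<close> by at most
    \<open>\<kappa> * K = \<delta> * lam * K^2\<close>, and the distance from \<open>Sig\<close> to
    \<open>S\<close> adds \<open>\<delta> * lam\<close>.\<close>
  define N where "N = \<delta> * lam * (1 + K\<^sup>2)"
  have noise: "\<bar>Sg $$ (i, j) - S $$ (i, j)\<bar> \<le> N" if "i < n" "j < n" for i j
  proof -
    have "\<bar>Sg $$ (i, j) - S $$ (i, j)\<bar> \<le> \<bar>(g i j - 1) * Sig $$ (i, j)\<bar> + \<bar>S $$ (i, j) - Sig $$ (i, j)\<bar>"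
      unfolding Sgij[OF that] by (simp add: left_diff_distrib)
    also have "\<bar>(g i j - 1) * Sig $$ (i, j)\<bar> \<le> \<kappa> * K"
      unfolding abs_mult using g[OF that] Sig_ij[OF that] \<kappa> by (intro mult_mono) auto
    finally show ?thesis using close[OF that] by (simp add: N_def \<kappa>_def power2_eq_square algebra_simps)
  qed
  have Nle: "N \<le> lam / (4 * K)"
    using mult_left_mono[OF small(2), of lam] lam by (simp add: N_def mult_ac)
  have S_ii: "1 / (2 * K) \<le> S $$ (i, i)" "S $$ (i, i) \<le> 2 * K" if "i < n" for i
  proof -
    have p: "0 < Sig $$ (i, i)" using pd_diag_pos[OF Sig that] .
    have e: "S $$ (i, i) = q i * Sig $$ (i, i)" using p by (simp add: q_def)
    have "(1 / 2) * (1 / K) \<le> q i * Sig $$ (i, i)"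
      using q(1)[OF that] \<kappa>(2) Sig_ii(1)[OF that] K0 by (intro mult_mono) auto
    then show "1 / (2 * K) \<le> S $$ (i, i)" unfolding e by simp
    have "q i * Sig $$ (i, i) \<le> 2 * K"
      using q(2)[OF that] \<kappa>(2) Sig_ii(2)[OF that] K0 p by (intro mult_mono) auto
    then show "S $$ (i, i) \<le> 2 * K" unfolding e .
  qed
  have wt: "1 / (2 * K) \<le> sqrt (S $$ (i, i) * S $$ (j, j))" "sqrt (S $$ (i, i) * S $$ (j, j)) \<le> 2 * K"
    if "i < n" "j < n" for i j
    using geometric_mean_bounds[of "1 / (2 * K)" "S $$ (i, i)" "2 * K" "S $$ (j, j)"] S_ii that K0 by auto
  have Tup: "y \<bullet> (T *\<^sub>v y) \<le> (2 * K) * (y \<bullet> y)" if y: "y \<in> carrier_vec n" for y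
  proof -
    let ?z = "vec n (\<lambda>i. c i * y $ i)"
    have z: "?z \<in> carrier_vec n" by simp
    have "y \<bullet> (T *\<^sub>v y) \<le> K * (?z \<bullet> ?z)"
      unfolding T_def diag_scale_quad[OF Th(1) y] by (rule Thup[OF z])
    also have "?z \<bullet> ?z = (\<Sum>i<n. (c i)\<^sup>2 * (y $ i)\<^sup>2)"
      unfolding scalar_prod_sum_lessThan[OF z] by (intro sum.cong) (auto simp: power2_eq_square)
    also have "K * \<dots> \<le> K * (\<Sum>i<n. 2 * (y $ i)\<^sup>2)"
    proof (intro mult_left_mono sum_mono mult_right_mono)
      fix i assume "i \<in> {..<n}"
      then have "1 / 2 \<le> q i" "0 < q i" using q(1)[of i] \<kappa>(2) q0[of i] by auto
      then show "(c i)\<^sup>2 \<le> 2" by (simp add: c_def power_divide field_simps)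
    qed (use K0 in auto)
    also have "\<dots> = 2 * K * (y \<bullet> y)"
      by (simp add: sum_distrib_left[symmetric] scalar_prod_sum_lessThan[OF y] power2_eq_square)
    finally show ?thesis .
  qed
  let ?A = "{(i, j)\<in>offdiag n. T $$ (i, j) \<noteq> 0}" and ?B = "{(i, j)\<in>offdiag n. T $$ (i, j) = 0}"
  let ?D = "\<lambda>i j. H $$ (i, j) - T $$ (i, j)"
  define DA where "DA = (\<Sum>(i, j)\<in>?A. \<bar>?D i j\<bar>)"
  define DB where "DB = (\<Sum>(i, j)\<in>?B. \<bar>?D i j\<bar>)"
  have DA0: "0 \<le> DA" and DB0: "0 \<le> DB" by (auto simp: DA_def DB_def intro!: sum_nonneg)
  have K2: "0 \<le> 2 * K" using K0 by simp
  obtain x where x: "0 \<le> x" "frob_sq (H - T) \<le> (2 * K)\<^sup>2 * x\<^sup>2"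
    "x\<^sup>2 / (2 * (1 + x)) \<le> (N + lam * (2 * K)) * DA - (lam * (1 / (2 * K)) - N) * DB"
    unfolding DA_def DB_def
    by (rule glasso_basic_inequality[OF Sc lam sol pdT Sgc TSg Sgdiag noise wt K2 Tup]; (assumption | rule that))
  have HTc: "H - T \<in> carrier_mat n n" by (rule minus_carrier_mat[OF Tc])
  have Hc: "H \<in> carrier_mat n n" using sol by (auto simp: glasso_solution_def pd_mat_def sym_mat_def)
  have HT: "(H - T) $$ (i, j) = ?D i j" if "i < n" "j < n" for i j using that Hc Tc by simp
  have sqf: "sqrt (frob_sq (H - T)) \<le> 2 * K * x"
    using real_sqrt_le_mono[OF x(2)] x(1) K0 by (simp add: real_sqrt_mult)
  \<comment> \<open>Rescaling by nonzero factors preserves the support, so the sparsity of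
    \<open>Th\<close> is that of \<open>T\<close>.\<close>
  have supp: "?A = {(i, j)\<in>offdiag n. Th $$ (i, j) \<noteq> 0}"
    using c0 by (auto simp: T_def diag_scale_index offdiag_def)
  have cardA: "real (card ?A) \<le> m" using m(1) unfolding supp offdiag_nonzeros_card[OF Th(1)] .
  have DAle: "DA \<le> sqrt m * (2 * K * x)"
  proof -
    have "DA \<le> sqrt (real (card ?A)) * sqrt (\<Sum>p\<in>?A. (case p of (i, j) \<Rightarrow> ?D i j)\<^sup>2)"
      using sum_abs_le_sqrt_card[of "\<lambda>p. case p of (i, j) \<Rightarrow> ?D i j" ?A]
      unfolding DA_def by (simp add: case_prod_unfold)
    also have "(\<Sum>p\<in>?A. (case p of (i, j) \<Rightarrow> ?D i j)\<^sup>2) = (\<Sum>(i, j)\<in>?A. ((H - T) $$ (i, j))\<^sup>2)"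
      by (rule sum.cong) (auto simp: HT offdiag_def)
    also have "sqrt (real (card ?A)) * sqrt (\<Sum>(i, j)\<in>?A. ((H - T) $$ (i, j))\<^sup>2) \<le> sqrt m * (2 * K * x)"
    proof (intro mult_mono)
      have "sqrt (\<Sum>(i, j)\<in>?A. ((H - T) $$ (i, j))\<^sup>2) \<le> sqrt (frob_sq (H - T))"
        by (intro real_sqrt_le_mono frob_sq_subset[OF HTc]) (auto simp: offdiag_def)
      then show "sqrt (\<Sum>(i, j)\<in>?A. ((H - T) $$ (i, j))\<^sup>2) \<le> 2 * K * x" using sqf by linarith
    qed (use cardA m in \<open>auto intro!: sum_nonneg\<close>)
    finally show ?thesis .
  qed
  have coefA: "N + lam * (2 * K) \<le> 3 * K * lam"
  proof -
    have "lam / (4 * K) \<le> lam * K"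
    proof -
      have "1 \<le> 4 * K * K" using mult_mono[OF K K] K0 by simp
      then show ?thesis using lam K0 by (simp add: divide_le_eq mult_ac)
    qed
    then show ?thesis using Nle by (simp add: algebra_simps)
  qed
  \<comment> \<open>Off the support the penalty has strength at least \<open>lam / (2 * K)\<close>,
    and the noise takes at most half of it.\<close>
  have coefB: "lam / (4 * K) \<le> lam * (1 / (2 * K)) - N"
    using Nle K0 by (simp add: field_simps)
  have lK: "0 \<le> lam / (4 * K)" using lam K0 by simp
  have main: "x\<^sup>2 / (2 * (1 + x)) + lam / (4 * K) * DB \<le> 3 * K * lam * DA"
    using x(3) mult_right_mono[OF coefA DA0] mult_right_mono[OF coefB DB0] by linarith
  \<comment> \<open>Inserting the Frobenius bound on \<open>DA\<close> into the right side
    \<open>3 * K * lam * DA\<close> gives \<open>6 * K^2 * lam * sqrt m * x\<close>, which is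
    \<open>gg / 2 * x\<close>, the form needed to solve for \<open>x\<close>.\<close>
  define gg where "gg = 12 * K\<^sup>2 * lam * sqrt m"
  have sm: "sqrt m \<le> m" "1 \<le> sqrt m"
    using m(2) real_le_lsqrt[of m m] by (auto simp: power2_eq_square)
  have gg0: "0 \<le> gg" using lam m by (simp add: gg_def)
  have "gg \<le> 12 * K\<^sup>2 * lam * m" unfolding gg_def using sm lam by (intro mult_left_mono) auto
  then have gg1: "gg \<le> 1 / 2" using small(3) by linarith
  have "x\<^sup>2 / (2 * (1 + x)) \<le> 3 * K * lam * DA" using main mult_nonneg_nonneg[OF lK DB0] by linarith
  also have "\<dots> \<le> 3 * K * lam * (sqrt m * (2 * K * x))" using K0 lam by (intro mult_left_mono[OF DAle]) auto
  also have "\<dots> = gg / 2 * x" by (simp add: gg_def power2_eq_square)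
  finally have xle: "x \<le> 2 * gg" by (rule self_bounded_solve[OF x(1) gg0 gg1])
  have xm: "2 * K * x \<le> 48 * K ^ 3 * lam * sqrt m"
    using mult_left_mono[OF xle K2] by (simp add: gg_def power2_eq_square power3_eq_cube mult_ac)
  have DAm: "DA \<le> 48 * K ^ 3 * lam * m"
  proof -
    have "DA \<le> sqrt m * (48 * K ^ 3 * lam * sqrt m)"
      by (rule order_trans[OF DAle mult_left_mono[OF xm]]) (use m in simp)
    also have "\<dots> = 48 * K ^ 3 * lam * (sqrt m * sqrt m)" by (simp add: mult_ac)
    finally show ?thesis using m by simp
  qed
  \<comment> \<open>With the quadratic term discarded, the basic inequality is the cone condition of
    Lasso theory: the error off the support is dominated by the error on it.\<close>
  have DBm: "DB \<le> 12 * K\<^sup>2 * DA"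
  proof -
    have "0 \<le> x\<^sup>2 / (2 * (1 + x))" using x(1) by simp
    then have "lam / (4 * K) * DB \<le> 3 * K * lam * DA" using main by linarith
    then have "lam * DB \<le> lam * (12 * K\<^sup>2 * DA)" using K0 by (simp add: field_simps power2_eq_square)
    then show ?thesis using lam by simp
  qed
  have diagD: "\<bar>?D i i\<bar> \<le> 48 * K ^ 3 * lam * m"
  proof -
    have "(\<Sum>(i, j)\<in>{(i, i)}. ((H - T) $$ (i, j))\<^sup>2) \<le> frob_sq (H - T)"
      by (rule frob_sq_subset[OF HTc]) (use i in auto)
    then have "sqrt ((?D i i)\<^sup>2) \<le> sqrt (frob_sq (H - T))" using HT[OF i i] by (intro real_sqrt_le_mono) simp
    then have "\<bar>?D i i\<bar> \<le> sqrt (frob_sq (H - T))" by simp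
    also have "\<dots> \<le> 48 * K ^ 3 * lam * sqrt m" by (rule order_trans[OF sqf xm])
    finally have "\<bar>?D i i\<bar> \<le> 48 * K ^ 3 * lam * sqrt m" .
    also have "\<dots> \<le> 48 * K ^ 3 * lam * m" using sm lam K0 by (intro mult_left_mono) auto
    finally show ?thesis .
  qed
  have "(\<Sum>j<n. \<bar>?D i j\<bar>) = \<bar>?D i i\<bar> + (\<Sum>j\<in>{..<n} - {i}. \<bar>?D i j\<bar>)"
    using i by (subst sum.remove[of _ i]) auto
  also have "(\<Sum>j\<in>{..<n} - {i}. \<bar>?D i j\<bar>) = (\<Sum>(i, j)\<in>Pair i ` ({..<n} - {i}). \<bar>?D i j\<bar>)"
    by (subst sum.reindex) (auto simp: inj_on_def)
  also have "\<dots> \<le> (\<Sum>(i, j)\<in>?A \<union> ?B. \<bar>?D i j\<bar>)"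
    by (rule sum_mono2) (use i in \<open>auto simp: offdiag_def intro!: finite_subset[OF _ finite_offdiag[of n, unfolded offdiag_def]]\<close>)
  also have "\<dots> = DA + DB" unfolding DA_def DB_def
    by (rule sum.union_disjoint) (auto intro: finite_subset[OF _ finite_offdiag[of n]])
  finally have row0: "(\<Sum>j<n. \<bar>?D i j\<bar>) \<le> \<bar>?D i i\<bar> + (DA + DB)" by simp
  have rowD: "(\<Sum>j<n. \<bar>?D i j\<bar>) \<le> 48 * K ^ 3 * lam * m * (2 + 12 * K\<^sup>2)"
  proof -
    have "12 * K\<^sup>2 * DA \<le> 12 * K\<^sup>2 * (48 * K ^ 3 * lam * m)" by (rule mult_left_mono[OF DAm]) simp
    then have "\<bar>?D i i\<bar> + (DA + DB) \<le> 48 * K ^ 3 * lam * m + (48 * K ^ 3 * lam * m + 12 * K\<^sup>2 * (48 * K ^ 3 * lam * m))"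
      using diagD DAm DBm by linarith
    also have "\<dots> = 48 * K ^ 3 * lam * m * (2 + 12 * K\<^sup>2)" by (simp add: algebra_simps)
    finally show ?thesis using row0 by linarith
  qed
  \<comment> \<open>The cost of replacing \<open>Th\<close> by \<open>T\<close>: every entry changes
    by a relative error of at most \<open>2 * \<kappa>\<close>, so a row changes by that fraction of
    a row sum of \<open>Th\<close>.\<close>
  have rowT: "(\<Sum>j<n. \<bar>T $$ (i, j) - Th $$ (i, j)\<bar>) \<le> 4 * K\<^sup>2 * m * lam"
  proof -
    have "(\<Sum>j<n. \<bar>T $$ (i, j) - Th $$ (i, j)\<bar>) \<le> (\<Sum>j<n. 2 * \<kappa> * \<bar>Th $$ (i, j)\<bar>)"
    proof (rule sum_mono)
      fix j assume "j \<in> {..<n}"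
      then have j: "j < n" by simp
      have "1 / g i j - 1 = (1 - g i j) / g i j" using g0[OF i j] by (simp add: field_simps)
      then have "\<bar>1 / g i j - 1\<bar> = \<bar>1 - g i j\<bar> / g i j" using g0[OF i j] by simp
      also have "\<dots> \<le> \<kappa> / (1 / 2)" using g[OF i j] \<kappa> by (intro frac_le) auto
      finally have "\<bar>1 / g i j - 1\<bar> \<le> 2 * \<kappa>" by simp
      then have "\<bar>1 / g i j - 1\<bar> * \<bar>Th $$ (i, j)\<bar> \<le> 2 * \<kappa> * \<bar>Th $$ (i, j)\<bar>" by (rule mult_right_mono) simp
      then show "\<bar>T $$ (i, j) - Th $$ (i, j)\<bar> \<le> 2 * \<kappa> * \<bar>Th $$ (i, j)\<bar>"
        unfolding T_def using i j by (simp add: diag_scale_index cc abs_mult[symmetric] left_diff_distrib)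
    qed
    also have "\<dots> = 2 * \<kappa> * (\<Sum>j<n. \<bar>Th $$ (i, j)\<bar>)" by (simp add: sum_distrib_left)
    also have "\<dots> \<le> 2 * \<kappa> * (K * (1 + real (offdiag_nonzeros Th)))"
      using \<kappa> by (intro mult_left_mono row_sum_le_nonzeros[OF Th(1) i] Th_ij[OF i]) (use K0 in auto)
    also have "\<dots> \<le> 2 * \<kappa> * (K * (2 * m))"
      using \<kappa> K0 m by (intro mult_left_mono) auto
    also have "\<dots> = \<delta> * (4 * K\<^sup>2 * m * lam)" by (simp add: \<kappa>_def power2_eq_square)
    also have "\<dots> \<le> 1 * (4 * K\<^sup>2 * m * lam)"
    proof (rule mult_right_mono)
      have "\<delta> * 1 \<le> \<delta> * (1 + K\<^sup>2)" by (rule mult_left_mono[OF _ \<delta>]) simp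
      also have "\<dots> \<le> 1 / (4 * K)" by (rule small(2))
      also have "\<dots> \<le> 1" using K by simp
      finally show "\<delta> \<le> 1" by simp
    qed (use m lam in simp)
    finally show ?thesis by simp
  qed
  have "(\<Sum>j<n. \<bar>H $$ (i, j) - Th $$ (i, j)\<bar>) \<le> (\<Sum>j<n. \<bar>?D i j\<bar> + \<bar>T $$ (i, j) - Th $$ (i, j)\<bar>)"
    by (rule sum_mono) linarith
  also have "\<dots> \<le> 48 * K ^ 3 * lam * m * (2 + 12 * K\<^sup>2) + 4 * K\<^sup>2 * m * lam"
    using rowD rowT by (simp add: sum.distrib)
  finally show ?thesis by (simp add: algebra_simps)
qed

text \<open>The identity behind the bound is
  \<open>mat_inv H - Sig = - (mat_inv H * (H - Th) * Sig)\<close>, with spectral norms at most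
  \<open>2 * K^3\<close>, \<open>R\<close> and \<open>K\<close> for the three factors.\<close>

lemma inverse_perturbation:
  assumes n: "0 < n" and K: "1 \<le> K" and Sig: "pd_mat n Sig"
    and low: "\<And>y. y \<in> carrier_vec n \<Longrightarrow> y \<bullet> y \<le> K * (y \<bullet> (Sig *\<^sub>v y))"
    and up: "\<And>y. y \<in> carrier_vec n \<Longrightarrow> y \<bullet> (Sig *\<^sub>v y) \<le> K * (y \<bullet> y)"
    and Th: "Th \<in> carrier_mat n n" "Sig * Th = 1\<^sub>m n" and H: "pd_mat n H"
    and R: "0 \<le> R" "K ^ 3 * R \<le> 1 / 2"
    and D: "\<And>x. x \<in> carrier_vec n \<Longrightarrow> ((H - Th) *\<^sub>v x) \<bullet> ((H - Th) *\<^sub>v x) \<le> R\<^sup>2 * (x \<bullet> x)"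
  shows "\<bar>op_norm 2 (mat_inv H - Sig)\<bar> \<le> 2 * K ^ 3 * R * K"
proof (rule op_norm_2_le)
  have K0: "0 < K" using K by simp
  have Sigc: "Sig \<in> carrier_mat n n" and Hc: "H \<in> carrier_mat n n" using Sig H by (auto simp: pd_mat_def sym_mat_def)
  have ThSig: "Th * Sig = 1\<^sub>m n" by (rule mat_mult_left_right_inverse[OF Sigc Th])
  have HTc: "H - Th \<in> carrier_mat n n" by (rule minus_carrier_mat[OF Th(1)])
  note Hi = pd_mat_inv[OF H]
  show "mat_inv H - Sig \<in> carrier_mat n n" by (rule minus_carrier_mat[OF Sigc])
  show "0 < n" by fact
  show "0 \<le> 2 * K ^ 3 * R * K" using K0 R by simp
  \<comment> \<open>The form of \<open>Th\<close> is at least \<open>K^(-3)\<close> times the square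
    norm, and the perturbation uses up at most half of this because
    \<open>K ^ 3 * R \<le> 1 / 2\<close>.\<close>
  have Hlow: "z \<bullet> z \<le> 2 * K ^ 3 * (z \<bullet> (H *\<^sub>v z))" if z: "z \<in> carrier_vec n" for z
  proof -
    let ?w = "(H - Th) *\<^sub>v z"
    have w: "?w \<in> carrier_vec n" by (rule mult_mat_vec_carrier[OF HTc z])
    have zz: "0 \<le> z \<bullet> z" by (rule scalar_prod_self_nonneg)
    have "(z \<bullet> ?w)\<^sup>2 \<le> (z \<bullet> z) * (?w \<bullet> ?w)" by (rule Cauchy_Schwarz_vec[OF z w])
    also have "\<dots> \<le> (z \<bullet> z) * (R\<^sup>2 * (z \<bullet> z))" by (rule mult_left_mono[OF D[OF z] zz])
    also have "\<dots> = (R * (z \<bullet> z))\<^sup>2" by (simp add: power2_eq_square)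
    finally have "\<bar>z \<bullet> ?w\<bar> \<le> R * (z \<bullet> z)" using R zz by (simp add: abs_le_square_iff[symmetric])
    moreover have "z \<bullet> ?w = z \<bullet> (H *\<^sub>v z) - z \<bullet> (Th *\<^sub>v z)"
      using minus_mult_distrib_mat_vec[OF Hc Th(1) z] scalar_prod_minus_distrib[OF z, of "H *\<^sub>v z" "Th *\<^sub>v z"] Hc Th z by simp
    ultimately have 1: "z \<bullet> (Th *\<^sub>v z) - R * (z \<bullet> z) \<le> z \<bullet> (H *\<^sub>v z)" by linarith
    have 2: "z \<bullet> z \<le> K ^ 3 * (z \<bullet> (Th *\<^sub>v z))" by (rule inverse_quad_lower[OF Sig Th K0 low up z])
    have 3: "K ^ 3 * R * (z \<bullet> z) \<le> 1 / 2 * (z \<bullet> z)" by (rule mult_right_mono[OF R(2) zz])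
    have "K ^ 3 * (z \<bullet> (Th *\<^sub>v z) - R * (z \<bullet> z)) \<le> K ^ 3 * (z \<bullet> (H *\<^sub>v z))"
      by (rule mult_left_mono[OF 1]) (use K0 in simp)
    then show ?thesis using 2 3 by (simp add: right_diff_distrib)
  qed
  have K3: "0 < 2 * K ^ 3" using K0 by simp
  have Hiup: "y \<bullet> (mat_inv H *\<^sub>v y) \<le> 2 * K ^ 3 * (y \<bullet> y)" if "y \<in> carrier_vec n" for y
    by (rule inverse_quad_upper[OF H Hi(1,2) K3 Hlow that])
  have Hisq: "(mat_inv H *\<^sub>v y) \<bullet> (mat_inv H *\<^sub>v y) \<le> (2 * K ^ 3)\<^sup>2 * (y \<bullet> y)" if "y \<in> carrier_vec n" for y
    by (rule psd_sq_bound[OF pd_imp_psd[OF inverse_pd[OF H Hi(1,2)]] less_imp_le[OF K3] Hiup that])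
  fix x :: "real vec" assume x: "x \<in> carrier_vec n"
  let ?y = "Sig *\<^sub>v x"
  let ?w = "(H - Th) *\<^sub>v ?y"
  have y: "?y \<in> carrier_vec n" using Sigc x by simp
  have w: "?w \<in> carrier_vec n" by (rule mult_mat_vec_carrier[OF HTc y])
  have Thy: "Th *\<^sub>v ?y = x" using assoc_mult_mat_vec[OF Th(1) Sigc x] ThSig x by simp
  have HiH: "mat_inv H *\<^sub>v (H *\<^sub>v ?y) = ?y" using assoc_mult_mat_vec[OF Hi(1) Hc y] Hi(3) y by simp
  have "mat_inv H *\<^sub>v ?w = ?y - mat_inv H *\<^sub>v x"
    unfolding minus_mult_distrib_mat_vec[OF Hc Th(1) y] Thy
    using mult_minus_distrib_mat_vec[OF Hi(1), of "H *\<^sub>v ?y" x] HiH Hc y x by simp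
  then have "(mat_inv H - Sig) *\<^sub>v x = - (mat_inv H *\<^sub>v ?w)"
    unfolding minus_mult_distrib_mat_vec[OF Hi(1) Sigc x] using Hi(1) Sigc x by (intro eq_vecI) auto
  then have "((mat_inv H - Sig) *\<^sub>v x) \<bullet> ((mat_inv H - Sig) *\<^sub>v x) = (mat_inv H *\<^sub>v ?w) \<bullet> (mat_inv H *\<^sub>v ?w)"
    using Hi(1) w by simp
  also have "\<dots> \<le> (2 * K ^ 3)\<^sup>2 * (?w \<bullet> ?w)" by (rule Hisq[OF w])
  also have "\<dots> \<le> (2 * K ^ 3)\<^sup>2 * (R\<^sup>2 * (?y \<bullet> ?y))" by (rule mult_left_mono[OF D[OF y]]) simp
  also have "\<dots> \<le> (2 * K ^ 3)\<^sup>2 * (R\<^sup>2 * (K\<^sup>2 * (x \<bullet> x)))"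
    by (intro mult_left_mono psd_sq_bound[OF pd_imp_psd[OF Sig] less_imp_le[OF K0] up x]) auto
  also have "\<dots> = (2 * K ^ 3 * R * K)\<^sup>2 * (x \<bullet> x)" by (simp add: power_mult_distrib mult_ac)
  finally show "((mat_inv H - Sig) *\<^sub>v x) \<bullet> ((mat_inv H - Sig) *\<^sub>v x) \<le> (2 * K ^ 3 * R * K)\<^sup>2 * (x \<bullet> x)" .
qed

subsection \<open>The residual covariance estimator\<close>

lemma max_norm_entry:
  assumes "A \<in> carrier_mat n m" "i < n" "j < m"
  shows "\<bar>A $$ (i, j)\<bar> \<le> max_norm A"
  unfolding max_norm_def elements_mat_def using assms
  by (intro Max_ge) (auto intro!: imageI finite_imageI finite_subset[of _ "(\<lambda>(i, j). A $$ (i, j)) ` ({..<n} \<times> {..<m})"])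

text \<open>An entrywise error \<open>\<eta>\<close> changes the form by at most
  \<open>\<eta>\<close> times the squared sum of the absolute coordinates, hence by at most
  \<open>n * \<eta>\<close> times the square norm. This is one source of the condition on
  \<open>r * lam\<close>.\<close>

lemma quad_lower_perturb:
  fixes A B :: "real mat"
  assumes A: "A \<in> carrier_mat n n" and B: "B \<in> carrier_mat n n" and K: "0 < K" and \<eta>: "0 \<le> \<eta>"
    and close: "\<And>i j. i < n \<Longrightarrow> j < n \<Longrightarrow> \<bar>A $$ (i, j) - B $$ (i, j)\<bar> \<le> \<eta>"
    and low: "\<And>y. y \<in> carrier_vec n \<Longrightarrow> y \<bullet> y \<le> K * (y \<bullet> (B *\<^sub>v y))"
    and small: "K * (real n * \<eta>) \<le> 1 / 2" and y: "y \<in> carrier_vec n"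
  shows "y \<bullet> y \<le> 2 * K * (y \<bullet> (A *\<^sub>v y))"
proof -
  have "(\<Sum>i<n. \<bar>y $ i\<bar>)\<^sup>2 \<le> (sqrt (real n) * sqrt (\<Sum>i<n. (y $ i)\<^sup>2))\<^sup>2"
    using sum_abs_le_sqrt_card[of "\<lambda>i. y $ i" "{..<n}"] by (intro power_mono) (auto intro: sum_nonneg)
  also have "\<dots> = real n * (y \<bullet> y)"
    by (simp add: power_mult_distrib sum_nonneg scalar_prod_sum_lessThan[OF y] power2_eq_square[symmetric])
  finally have sq: "(\<Sum>i<n. \<bar>y $ i\<bar>)\<^sup>2 \<le> real n * (y \<bullet> y)" .
  have "y \<bullet> (B *\<^sub>v y) - y \<bullet> (A *\<^sub>v y) = (\<Sum>i<n. \<Sum>j<n. y $ i * (B $$ (i, j) - A $$ (i, j)) * y $ j)"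
    unfolding bilinear_sum[OF A y y] bilinear_sum[OF B y y] sum_subtractf[symmetric]
    by (intro sum.cong refl) (simp add: algebra_simps)
  also have "\<dots> \<le> (\<Sum>i<n. \<Sum>j<n. \<eta> * (\<bar>y $ i\<bar> * \<bar>y $ j\<bar>))"
  proof (intro sum_mono)
    fix i j assume ij: "i \<in> {..<n}" "j \<in> {..<n}"
    have "y $ i * (B $$ (i, j) - A $$ (i, j)) * y $ j \<le> \<bar>y $ i * (B $$ (i, j) - A $$ (i, j)) * y $ j\<bar>" by simp
    also have "\<dots> = \<bar>A $$ (i, j) - B $$ (i, j)\<bar> * (\<bar>y $ i\<bar> * \<bar>y $ j\<bar>)"
      by (simp add: abs_mult abs_minus_commute mult_ac)
    also have "\<dots> \<le> \<eta> * (\<bar>y $ i\<bar> * \<bar>y $ j\<bar>)" using close ij by (intro mult_right_mono) auto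
    finally show "y $ i * (B $$ (i, j) - A $$ (i, j)) * y $ j \<le> \<eta> * (\<bar>y $ i\<bar> * \<bar>y $ j\<bar>)" .
  qed
  also have "\<dots> = \<eta> * (\<Sum>i<n. \<bar>y $ i\<bar>)\<^sup>2"
    unfolding power2_eq_square sum_product by (simp only: sum_distrib_left)
  also have "\<dots> \<le> \<eta> * (real n * (y \<bullet> y))" by (rule mult_left_mono[OF sq \<eta>])
  finally have "K * (y \<bullet> (B *\<^sub>v y) - y \<bullet> (A *\<^sub>v y)) \<le> K * (\<eta> * (real n * (y \<bullet> y)))"
    using K by (intro mult_left_mono) auto
  also have "\<dots> = K * (real n * \<eta>) * (y \<bullet> y)" by simp
  also have "\<dots> \<le> 1 / 2 * (y \<bullet> y)" by (rule mult_right_mono[OF small scalar_prod_self_nonneg])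
  finally show ?thesis using low[OF y] by (simp add: right_diff_distrib)
qed

text \<open>For fixed \<open>y\<close>, the block form is evaluated at
  \<open>x = - Xi (transpose V y)\<close>, the minimizer over the first component. The first block
  row then vanishes, and what remains is the form of the Schur complement at
  \<open>y\<close>.\<close>

lemma schur_complement_psd:
  fixes X V Y Xi :: "real mat"
  assumes X: "pd_mat r X" and Xi: "Xi \<in> carrier_mat r r" "X * Xi = 1\<^sub>m r" and V: "V \<in> carrier_mat d r"
    and Y: "sym_mat d Y" and psd: "psd_mat (r + d) (four_block_mat X (transpose_mat V) V Y)"
  shows "psd_mat d (Y - V * Xi * transpose_mat V)"
proof -
  have Xc: "X \<in> carrier_mat r r" and Yc: "Y \<in> carrier_mat d d" using X Y by (auto simp: pd_mat_def sym_mat_def)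
  have pdXi: "pd_mat r Xi" by (rule inverse_pd[OF X Xi])
  have sXi: "transpose_mat Xi = Xi" using pdXi by (auto simp: pd_mat_def sym_mat_def)
  let ?U = "transpose_mat V"
  have U: "?U \<in> carrier_mat r d" using V by simp
  have VXiU: "V * Xi * ?U \<in> carrier_mat d d" using V Xi(1) by simp
  have Wc: "Y - V * Xi * ?U \<in> carrier_mat d d" by (rule minus_carrier_mat[OF VXiU])
  have tW: "transpose_mat (V * Xi * ?U) = V * Xi * ?U"
  proof -
    have "transpose_mat (V * Xi * ?U) = transpose_mat ?U * transpose_mat (V * Xi)"
      by (rule transpose_mult[of _ d r]) (use V Xi in auto)
    also have "transpose_mat (V * Xi) = transpose_mat Xi * ?U" by (rule transpose_mult[OF V Xi(1)])
    finally show ?thesis unfolding sXi using assoc_mult_mat[OF V Xi(1) U] by simp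
  qed
  have "transpose_mat (Y - V * Xi * ?U) = transpose_mat Y - transpose_mat (V * Xi * ?U)"
    by (rule transpose_minus[OF Yc VXiU])
  then have sW: "sym_mat d (Y - V * Xi * ?U)" using Y Wc unfolding tW sym_mat_def by simp
  have "0 \<le> y \<bullet> ((Y - V * Xi * ?U) *\<^sub>v y)" if y: "y \<in> carrier_vec d" for y
  proof -
    let ?u = "?U *\<^sub>v y"
    define x where "x = - (Xi *\<^sub>v ?u)"
    have u: "?u \<in> carrier_vec r" using U y by simp
    have Xiu: "Xi *\<^sub>v ?u \<in> carrier_vec r" using Xi u by simp
    have x: "x \<in> carrier_vec r" unfolding x_def using Xiu by simp
    have neg: "M *\<^sub>v x = - (M *\<^sub>v (Xi *\<^sub>v ?u))" if "M \<in> carrier_mat k r" for M k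
    proof -
      have "M *\<^sub>v x = M *\<^sub>v ((- 1) \<cdot>\<^sub>v (Xi *\<^sub>v ?u))" unfolding x_def by (intro arg_cong[of _ _ "(*\<^sub>v) M"] eq_vecI) auto
      also have "\<dots> = (- 1) \<cdot>\<^sub>v (M *\<^sub>v (Xi *\<^sub>v ?u))" by (rule mult_mat_vec[OF that Xiu])
      finally show ?thesis by (auto intro!: eq_vecI)
    qed
    have Xx: "X *\<^sub>v x = - ?u"
      unfolding neg[OF Xc] using assoc_mult_mat_vec[OF Xc Xi(1) u] Xi(2) u by simp
    have Vx: "V *\<^sub>v x = - ((V * Xi * ?U) *\<^sub>v y)"
      unfolding neg[OF V] using assoc_mult_mat_vec[OF V Xi(1) u] assoc_mult_mat_vec[of "V * Xi" d r ?U d y] V Xi(1) U y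
      by simp
    have Xxc: "X *\<^sub>v x \<in> carrier_vec r" and Vxc: "V *\<^sub>v x \<in> carrier_vec d" and Yy: "Y *\<^sub>v y \<in> carrier_vec d"
      using Xc x V Yc y by auto
    have "0 \<le> (x @\<^sub>v y) \<bullet> (four_block_mat X ?U V Y *\<^sub>v (x @\<^sub>v y))"
      using psd x y by (auto simp: psd_mat_def)
    also have "four_block_mat X ?U V Y *\<^sub>v (x @\<^sub>v y) = (X *\<^sub>v x + ?u) @\<^sub>v (V *\<^sub>v x + Y *\<^sub>v y)"
      by (rule four_block_mat_mult_vec[OF Xc U V Yc x y])
    also have "(x @\<^sub>v y) \<bullet> \<dots> = x \<bullet> (X *\<^sub>v x + ?u) + y \<bullet> (V *\<^sub>v x + Y *\<^sub>v y)"
      by (rule scalar_prod_append[OF x y]) (use Xxc u Vxc Yy in auto)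
    also have "X *\<^sub>v x + ?u = 0\<^sub>v r" unfolding Xx using u by (intro eq_vecI) auto
    also have "V *\<^sub>v x + Y *\<^sub>v y = (Y - V * Xi * ?U) *\<^sub>v y"
      unfolding Vx minus_mult_distrib_mat_vec[OF Yc VXiU y] using V Yc VXiU y by (intro eq_vecI) auto
    finally show ?thesis using x by simp
  qed
  then show ?thesis using sW by (auto simp: psd_mat_def)
qed

text \<open>The correction to the oracle estimator (the one that uses the true \<open>b\<close>) is quadratic in the
  error \<open>V - b X\<close>, so it is of smaller order than \<open>lam\<close>.\<close>

lemma residual_identity:
  fixes X V Y Xi b :: "real mat"
  assumes X: "sym_mat r X" and Xi: "sym_mat r Xi" "X * Xi = 1\<^sub>m r" and V: "V \<in> carrier_mat d r"
    and Y: "Y \<in> carrier_mat d d" and b: "b \<in> carrier_mat d r"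
  shows "Y - V * Xi * transpose_mat V =
    (Y - V * transpose_mat b - b * transpose_mat V + b * X * transpose_mat b)
      - (V - b * X) * Xi * transpose_mat (V - b * X)"
proof -
  have Xc: "X \<in> carrier_mat r r" and Xic: "Xi \<in> carrier_mat r r" and tX: "transpose_mat X = X"
    using X Xi by (auto simp: sym_mat_def)
  have XiX: "Xi * X = 1\<^sub>m r" by (rule mat_mult_left_right_inverse[OF Xc Xic Xi(2)])
  let ?U = "transpose_mat V" and ?c = "transpose_mat b"
  have U: "?U \<in> carrier_mat r d" and c: "?c \<in> carrier_mat r d" using V b by auto
  have bX: "b * X \<in> carrier_mat d r" and Xct: "X * ?c \<in> carrier_mat r d" using b Xc c by auto
  have VXi: "V * Xi \<in> carrier_mat d r" using V Xic by auto
  have 1: "(V - b * X) * Xi = V * Xi - b"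
    using minus_mult_distrib_mat[OF V bX Xic] assoc_mult_mat[OF b Xc Xic] Xi(2) b by simp
  have 2: "transpose_mat (V - b * X) = ?U - X * ?c"
    using transpose_minus[OF V bX] transpose_mult[OF b Xc] tX by simp
  have UX: "?U - X * ?c \<in> carrier_mat r d" by (rule minus_carrier_mat[OF Xct])
  have 3: "(V * Xi - b) * (?U - X * ?c) = V * Xi * (?U - X * ?c) - b * (?U - X * ?c)"
    by (rule minus_mult_distrib_mat[OF VXi b UX])
  have 4: "V * Xi * (?U - X * ?c) = V * Xi * ?U - V * ?c"
  proof -
    have "V * Xi * (X * ?c) = V * (Xi * (X * ?c))" by (rule assoc_mult_mat[OF V Xic Xct])
    also have "Xi * (X * ?c) = ?c" using assoc_mult_mat[OF Xic Xc c] XiX c by simp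
    finally show ?thesis using mult_minus_distrib_mat[OF VXi U Xct] by simp
  qed
  have 5: "b * (?U - X * ?c) = b * ?U - b * X * ?c"
    using mult_minus_distrib_mat[OF b U Xct] assoc_mult_mat[OF b Xc c] by simp
  have "V * Xi * ?U \<in> carrier_mat d d" "V * ?c \<in> carrier_mat d d" "b * ?U \<in> carrier_mat d d" "b * X * ?c \<in> carrier_mat d d"
    using VXi U V c b bX by auto
  then show ?thesis unfolding 1 2 3 4 5
    using Y by (intro eq_matI) (auto simp del: index_mult_mat)
qed

section \<open>The deterministic bound at a single outcome\<close>

lemma pd_Lambda_bounds:
  assumes A: "pd_mat n A" and n: "0 < n" and y: "y \<in> carrier_vec n"
  shows "0 < Lambda_min A" "0 < Lambda_max A"
    "1 / Lambda_min A \<le> K \<Longrightarrow> y \<bullet> y \<le> K * (y \<bullet> (A *\<^sub>v y))"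
    "Lambda_max A \<le> K \<Longrightarrow> y \<bullet> (A *\<^sub>v y) \<le> K * (y \<bullet> y)"
proof -
  have s: "sym_mat n A" using A by (simp add: pd_mat_def)
  show l0: "0 < Lambda_min A" by (rule pd_spectrum_pos[OF A Lambda_min_bound(1)[OF s n]])
  show "0 < Lambda_max A" by (rule pd_spectrum_pos[OF A Lambda_max_bound(1)[OF s n]])
  have yy: "0 \<le> y \<bullet> y" by (rule scalar_prod_self_nonneg)
  {
    assume k: "1 / Lambda_min A \<le> K"
    then have "1 \<le> K * Lambda_min A" using l0 by (simp add: field_simps)
    then have "1 * (y \<bullet> y) \<le> K * Lambda_min A * (y \<bullet> y)" by (rule mult_right_mono[OF _ yy])
    also have "\<dots> = K * (Lambda_min A * (y \<bullet> y))" by simp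
    also have "\<dots> \<le> K * (y \<bullet> (A *\<^sub>v y))"
      by (rule mult_left_mono[OF Lambda_min_bound(2)[OF s n y]])
        (use k l0 in \<open>auto intro: order_trans[of 0 "1 / Lambda_min A"]\<close>)
    finally show "y \<bullet> y \<le> K * (y \<bullet> (A *\<^sub>v y))" by simp
  next
    assume "Lambda_max A \<le> K"
    then show "y \<bullet> (A *\<^sub>v y) \<le> K * (y \<bullet> y)"
      by (rule order_trans[OF Lambda_max_bound(2)[OF s n y] mult_right_mono[OF _ yy]])
  }
qed

text \<open>In \<open>glasso_rate\<close>, \<open>48 * K ^ 3\<close> bounds both the diagonal entry
  and the error on the support, \<open>12 * K^2\<close> passes from the support to its complement,
  and \<open>4 * K^2\<close> pays for the diagonal rescaling.\<close>

definition rate_const :: "real \<Rightarrow> real" where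
  "rate_const K = 48 * K ^ 3 * (2 + 12 * K\<^sup>2) + 4 * K\<^sup>2"

text \<open>The conditions on \<open>e\<close> correspond to separate steps.
  \<open>2 * K * e\<close> makes \<open>hatX\<close> invertible, \<open>6 * K^2 * e\<close> keeps
  the diagonal of \<open>S\<close> within a factor 2 of that of \<open>SigZ\<close>,
  \<open>12 * K^2 * (1 + K^2) * e\<close> keeps the noise below the penalty,
  \<open>24 * K^2 * L * e\<close> keeps the Bregman inequality in its quadratic regime, and the last
  one controls the inverse of \<open>H\<close>.\<close>

lemma glasso_pointwise_bound:
  fixes SigX SigZ hatX hatY V Xdag b H S \<beta> :: "real mat"
  assumes d: "0 < d" and r: "0 < r" and K: "1 \<le> K" and L: "1 \<le> L" and s: "1 \<le> s" and lam: "0 < lam"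
    and e: "0 < e" "e \<le> 1" "2 * K * e \<le> 1" "6 * K\<^sup>2 * e \<le> 1" "12 * K\<^sup>2 * (1 + K\<^sup>2) * e \<le> 1"
      "24 * K\<^sup>2 * L * e \<le> 1" "2 * K ^ 3 * rate_const K * L * e \<le> 1"
    and SigZ: "psd_mat d SigZ" "invertible_mat SigZ" "Lambda_max SigZ + 1 / Lambda_min SigZ \<le> K"
    and SigX: "psd_mat r SigX" "invertible_mat SigX" "max_norm SigX + 1 / Lambda_min SigX \<le> K"
    and nz: "real (offdiag_nonzeros (mat_inv SigZ)) \<le> L * s"
    and \<beta>: "\<beta> \<in> carrier_mat d r"
    and hatX: "psd_mat r hatX" and hatY: "sym_mat d hatY" and V: "V \<in> carrier_mat d r"
    and closeX: "max_norm (hatX - SigX) \<le> e * lam"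
    and closeV: "max_norm (V - \<beta> * hatX) \<le> e * lam"
    and closeZ: "max_norm (hatY - V * transpose_mat \<beta> - \<beta> * transpose_mat V + \<beta> * hatX * transpose_mat \<beta> - SigZ) \<le> e * lam"
    and sl: "(s + real r) * lam \<le> e"
    and psd: "psd_mat (r + d) (four_block_mat hatX (transpose_mat V) V hatY)"
    and Xdag: "invertible_mat hatX \<Longrightarrow> Xdag = mat_inv hatX"
    and b: "b = V * Xdag" and S: "S = hatY - b * hatX * transpose_mat b"
    and H: "pd_mat d H" "\<exists>!\<Theta>. glasso_solution d S lam \<Theta> \<Longrightarrow> glasso_solution d S lam H"
  shows "1 \<le> w \<Longrightarrow> \<bar>op_norm w (H - mat_inv SigZ)\<bar> \<le> rate_const K * (L * s) * lam"
    and "\<bar>op_norm 2 (mat_inv H - SigZ)\<bar> \<le> 2 * K ^ 3 * (rate_const K * (L * s) * lam) * K"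
proof -
  have K0: "0 < K" using K by simp
  have Zc: "SigZ \<in> carrier_mat d d" and Xc: "SigX \<in> carrier_mat r r" and hXc: "hatX \<in> carrier_mat r r"
    and hYc: "hatY \<in> carrier_mat d d" and Hc: "H \<in> carrier_mat d d" and sX: "sym_mat r hatX"
    using SigZ SigX hatX hatY H by (auto simp: psd_mat_def pd_mat_def sym_mat_def)
  have pdZ: "pd_mat d SigZ" by (rule psd_det_imp_pd[OF SigZ(1) invertible_mat_det[OF Zc SigZ(2)]])
  have pdX: "pd_mat r SigX" by (rule psd_det_imp_pd[OF SigX(1) invertible_mat_det[OF Xc SigX(2)]])
  have z0: "0\<^sub>v d \<in> carrier_vec d" "0\<^sub>v r \<in> carrier_vec r" by auto
  note lz = pd_Lambda_bounds(1,2)[OF pdZ d z0(1)] and lx = pd_Lambda_bounds(1,2)[OF pdX r z0(2)]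
  have "1 / Lambda_min SigZ \<le> K" "Lambda_max SigZ \<le> K"
    using SigZ(3) lz by (auto intro: order_trans[rotated])
  then have low: "y \<bullet> y \<le> K * (y \<bullet> (SigZ *\<^sub>v y))" and up: "y \<bullet> (SigZ *\<^sub>v y) \<le> K * (y \<bullet> y)"
    if "y \<in> carrier_vec d" for y
    using pd_Lambda_bounds(3,4)[OF pdZ d that] by auto
  have "0 \<le> max_norm SigX" using max_norm_entry[OF Xc r r] by linarith
  then have "1 / Lambda_min SigX \<le> K" using SigX(3) by linarith
  then have lowX: "y \<bullet> y \<le> K * (y \<bullet> (SigX *\<^sub>v y))" if "y \<in> carrier_vec r" for y
    using pd_Lambda_bounds(3)[OF pdX r that] by auto
  have rl: "real r * lam \<le> e" and slam: "s * lam \<le> e" and lame: "lam \<le> e"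
  proof -
    have "0 \<le> s * lam" "0 \<le> real r * lam" "lam \<le> s * lam" using s lam by auto
    then show "real r * lam \<le> e" "s * lam \<le> e" "lam \<le> e" using sl by (auto simp: distrib_right)
  qed
  have ee: "e * e \<le> e" using mult_left_mono[OF e(2), of e] e(1) by simp
  define \<eta> where "\<eta> = e * lam"
  have \<eta>0: "0 \<le> \<eta>" using e lam by (simp add: \<eta>_def)
  have closeX': "\<bar>hatX $$ (i, j) - SigX $$ (i, j)\<bar> \<le> \<eta>" if "i < r" "j < r" for i j
    using max_norm_entry[OF minus_carrier_mat[OF Xc] that, of hatX] closeX hXc Xc that by (simp add: \<eta>_def)
  have r\<eta>: "real r * \<eta> \<le> e * e" using mult_left_mono[OF rl, of e] e by (simp add: \<eta>_def mult_ac)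
  have "K * (real r * \<eta>) \<le> K * e" using K0 r\<eta> ee by (intro mult_left_mono) auto
  then have smallX: "K * (real r * \<eta>) \<le> 1 / 2" using e(3) by linarith
  have hXlow: "y \<bullet> y \<le> 2 * K * (y \<bullet> (hatX *\<^sub>v y))" if "y \<in> carrier_vec r" for y
    by (rule quad_lower_perturb[OF hXc Xc K0 \<eta>0 closeX' lowX smallX that])
  have pdhX: "pd_mat r hatX" unfolding pd_mat_def
  proof (intro conjI ballI impI)
    show "sym_mat r hatX" by (rule sX)
    fix y :: "real vec" assume y: "y \<in> carrier_vec r" "y \<noteq> 0\<^sub>v r"
    have "0 < 2 * K * (y \<bullet> (hatX *\<^sub>v y))" using hXlow[OF y(1)] scalar_prod_self_pos[OF y] by linarith
    then show "0 < y \<bullet> (hatX *\<^sub>v y)" using K0 by (simp add: zero_less_mult_iff)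
  qed
  define Xi where "Xi = mat_inv hatX"
  have Xi: "Xi \<in> carrier_mat r r" "hatX * Xi = 1\<^sub>m r" "Xi * hatX = 1\<^sub>m r" unfolding Xi_def using pd_mat_inv[OF pdhX] by auto
  have pdXi: "pd_mat r Xi" by (rule inverse_pd[OF pdhX Xi(1,2)])
  have sXi: "sym_mat r Xi" using pdXi by (simp add: pd_mat_def)
  have bV: "b = V * Xi" unfolding b Xi_def using Xdag[OF pd_invertible[OF pdhX]] by simp
  have Ut: "transpose_mat V \<in> carrier_mat r d" using V by simp
  have S_eq: "S = hatY - V * Xi * transpose_mat V"
  proof -
    have VXi: "V * Xi \<in> carrier_mat d r" using V Xi by simp
    have bt: "transpose_mat b = Xi * transpose_mat V"
      unfolding bV transpose_mult[OF V Xi(1)] using sXi by (simp add: sym_mat_def)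
    have "V * Xi * hatX = V" using assoc_mult_mat[OF V Xi(1) hXc] Xi(3) V by simp
    then show ?thesis unfolding S bt unfolding bV using assoc_mult_mat[OF V Xi(1) Ut] by simp
  qed
  have psdS: "psd_mat d S" unfolding S_eq by (rule schur_complement_psd[OF pdhX Xi(1,2) V hatY psd])
  have Sc: "S \<in> carrier_mat d d" using psdS by (auto simp: psd_mat_def sym_mat_def)
  define E where "E = V - \<beta> * hatX"
  have Ec: "E \<in> carrier_mat d r" unfolding E_def by (rule minus_carrier_mat) (use \<beta> hXc in simp)
  define Br where "Br = hatY - V * transpose_mat \<beta> - \<beta> * transpose_mat V + \<beta> * hatX * transpose_mat \<beta>"
  have Brc: "Br \<in> carrier_mat d d" unfolding Br_def using \<beta> hXc by (intro add_carrier_mat) auto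
  have S_Br: "S = Br - E * Xi * transpose_mat E"
    unfolding S_eq Br_def E_def by (rule residual_identity[OF sX sXi Xi(2) V hYc \<beta>])
  have Eij: "\<bar>E $$ (i, k)\<bar> \<le> \<eta>" if "i < d" "k < r" for i k
    using max_norm_entry[OF Ec that] closeV unfolding E_def[symmetric] \<eta>_def by linarith
  \<comment> \<open>Cauchy-Schwarz for the form of \<open>Xi\<close> at two rows of
    \<open>E\<close>. A row has square norm at most \<open>r * \<eta>^2\<close>, and
    \<open>r * \<eta> \<le> e\<close> removes both the dimension and one of the two factors
    \<open>\<eta>\<close>.\<close>
  have EXE: "\<bar>(E * Xi * transpose_mat E) $$ (i, j)\<bar> \<le> 2 * K * e * e * lam" if ij: "i < d" "j < d" for i j
  proof -
    have Et: "transpose_mat E \<in> carrier_mat r d" using Ec by simp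
    let ?v = "\<lambda>i. col (transpose_mat E) i"
    have vc: "?v i \<in> carrier_vec r" for i using Ec by (intro carrier_vecI) simp
    have q: "?v i \<bullet> (Xi *\<^sub>v ?v i) \<le> 2 * K * (real r * \<eta>\<^sup>2)" if "i < d" for i
    proof -
      have "?v i \<bullet> (Xi *\<^sub>v ?v i) \<le> 2 * K * (?v i \<bullet> ?v i)"
        by (rule inverse_quad_upper[OF pdhX Xi(1,2) _ hXlow vc]) (use K0 in auto)
      also have "?v i \<bullet> ?v i = (\<Sum>k<r. (E $$ (i, k))\<^sup>2)"
        unfolding scalar_prod_sum_lessThan[OF vc] using Ec that by (auto intro!: sum.cong simp: power2_eq_square)
      also have "\<dots> \<le> (\<Sum>k<r. \<eta>\<^sup>2)"
        by (rule sum_mono) (use Eij[OF that] \<eta>0 in \<open>auto simp: abs_le_square_iff[symmetric]\<close>)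
      finally show ?thesis using K0 by simp
    qed
    have q0: "0 \<le> ?v i \<bullet> (Xi *\<^sub>v ?v i)" for i using pd_imp_psd[OF pdXi] vc by (simp add: psd_mat_def)
    have "(E * Xi * transpose_mat E) $$ (i, j) = ?v i \<bullet> (Xi *\<^sub>v ?v j)"
      using index_congruence[OF Et Xi(1) ij] by simp
    also have "(?v i \<bullet> (Xi *\<^sub>v ?v j))\<^sup>2 \<le> (2 * K * (real r * \<eta>\<^sup>2))\<^sup>2"
    proof -
      have "(?v i \<bullet> (Xi *\<^sub>v ?v j))\<^sup>2 \<le> (?v i \<bullet> (Xi *\<^sub>v ?v i)) * (?v j \<bullet> (Xi *\<^sub>v ?v j))"
        by (rule psd_Cauchy_Schwarz[OF pd_imp_psd[OF pdXi] vc vc])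
      also have "\<dots> \<le> (2 * K * (real r * \<eta>\<^sup>2)) * (2 * K * (real r * \<eta>\<^sup>2))"
        using q ij q0 K0 by (intro mult_mono) auto
      finally show ?thesis by (simp add: power2_eq_square)
    qed
    finally have "\<bar>(E * Xi * transpose_mat E) $$ (i, j)\<bar> \<le> 2 * K * (real r * \<eta>\<^sup>2)"
      using K0 by (simp add: abs_le_square_iff[symmetric])
    also have "\<dots> = 2 * K * (real r * \<eta>) * \<eta>" by (simp add: power2_eq_square)
    also have "\<dots> \<le> 2 * K * e * \<eta>"
      using K0 \<eta>0 order_trans[OF r\<eta> ee] by (intro mult_right_mono mult_left_mono) auto
    finally show ?thesis by (simp add: \<eta>_def)
  qed
  \<comment> \<open>One part \<open>K * e\<close> majorizes the error \<open>e\<close> of the oracle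
    estimator, and \<open>2 * K * e\<close> is for the correction term.\<close>
  define \<delta> where "\<delta> = 3 * K * e"
  have \<delta>0: "0 \<le> \<delta>" using K0 e by (simp add: \<delta>_def)
  have close: "\<bar>S $$ (i, j) - SigZ $$ (i, j)\<bar> \<le> \<delta> * lam" if ij: "i < d" "j < d" for i j
  proof -
    have "\<bar>(Br - SigZ) $$ (i, j)\<bar> \<le> e * lam"
      using max_norm_entry[OF minus_carrier_mat[OF Zc] ij, of Br] closeZ unfolding Br_def[symmetric] by linarith
    then have 1: "\<bar>Br $$ (i, j) - SigZ $$ (i, j)\<bar> \<le> e * lam" using Brc Zc ij by simp
    have 2: "S $$ (i, j) = Br $$ (i, j) - (E * Xi * transpose_mat E) $$ (i, j)"
      unfolding S_Br using Ec ij by (simp del: index_mult_mat(1))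
    have "2 * K * e * e * lam \<le> 2 * K * e * lam"
      using mult_left_mono[OF e(2), of "2 * K * e"] K0 e lam by (intro mult_right_mono) auto
    moreover have "e * lam \<le> K * e * lam" using K e lam by simp
    moreover have "\<delta> * lam = K * e * lam + 2 * K * e * lam" by (simp add: \<delta>_def algebra_simps)
    ultimately show ?thesis using 1 EXE[OF ij] unfolding 2 by linarith
  qed
  have small1: "\<delta> * lam * K \<le> 1 / 2"
  proof -
    have "\<delta> * lam * K = 3 * K\<^sup>2 * e * lam" by (simp add: \<delta>_def power2_eq_square)
    also have "\<dots> \<le> 3 * K\<^sup>2 * e * 1" using lame e by (intro mult_left_mono) auto
    finally show ?thesis using e(4) by linarith
  qed
  have small2: "\<delta> * (1 + K\<^sup>2) \<le> 1 / (4 * K)"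
    using e(5) K0 by (simp add: \<delta>_def field_simps power2_eq_square)
  have small3: "12 * K\<^sup>2 * lam * (L * s) \<le> 1 / 2"
  proof -
    have "12 * K\<^sup>2 * lam * (L * s) = 12 * K\<^sup>2 * L * (s * lam)" by simp
    also have "\<dots> \<le> 12 * K\<^sup>2 * L * e" using L by (intro mult_left_mono[OF slam]) auto
    finally show ?thesis using e(6) by linarith
  qed
  have Sdiag: "0 < S $$ (i, i)" if "i < d" for i
  proof -
    have "1 \<le> K * SigZ $$ (i, i)" using low[of "unit_vec d i"] unit_bilinear[OF Zc that that] that by simp
    moreover have "K * \<bar>S $$ (i, i) - SigZ $$ (i, i)\<bar> \<le> 1 / 2"
    proof -
      have "K * \<bar>S $$ (i, i) - SigZ $$ (i, i)\<bar> \<le> K * (\<delta> * lam)"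
        using K0 by (intro mult_left_mono[OF close[OF that that]]) simp
      also have "\<dots> = \<delta> * lam * K" by (rule mult.commute)
      finally show ?thesis using small1 by linarith
    qed
    moreover have "K * SigZ $$ (i, i) - K * S $$ (i, i) \<le> K * \<bar>S $$ (i, i) - SigZ $$ (i, i)\<bar>"
      unfolding right_diff_distrib[symmetric] using K0 by (intro mult_left_mono) auto
    ultimately have "0 < K * S $$ (i, i)" by linarith
    then show ?thesis using K0 by (simp add: zero_less_mult_iff)
  qed
  \<comment> \<open>\<open>H(2)\<close> speaks only about the case of a unique solution, so
    existence and uniqueness are both supplied here.\<close>
  have sol: "glasso_solution d S lam H"
    using glasso_exists[OF d psdS Sdiag lam] glasso_unique[OF Sc less_imp_le[OF lam]]
    by (intro H(2)) blast
  let ?Th = "mat_inv SigZ"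
  note Th = pd_mat_inv[OF pdZ]
  have pdTh: "pd_mat d ?Th" by (rule inverse_pd[OF pdZ Th(1,2)])
  have Ls: "1 \<le> L * s" using mult_mono[OF L s] L by simp
  define R where "R = rate_const K * (L * s) * lam"
  have C0: "0 \<le> rate_const K" using K0 by (simp add: rate_const_def)
  have R0: "0 \<le> R" using C0 Ls lam by (simp add: R_def)
  have HTc: "H - ?Th \<in> carrier_mat d d" by (rule minus_carrier_mat[OF Th(1)])
  have HTij: "(H - ?Th) $$ (i, j) = H $$ (i, j) - ?Th $$ (i, j)" if "i < d" "j < d" for i j
    using that Th(1) by simp
  have row: "(\<Sum>j<d. \<bar>(H - ?Th) $$ (i, j)\<bar>) \<le> R" if i: "i < d" for i
  proof -
    have "(\<Sum>j<d. \<bar>H $$ (i, j) - ?Th $$ (i, j)\<bar>) \<le> R"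
      unfolding R_def rate_const_def
      by (rule glasso_rate[OF d K pdZ low up Th(1,2) psdS lam \<delta>0 close nz Ls small1 small2 small3 sol i])
    then show ?thesis using HTij[OF i] by simp
  qed
  have col: "(\<Sum>i<d. \<bar>(H - ?Th) $$ (i, j)\<bar>) \<le> R" if j: "j < d" for j
  proof -
    have "(\<Sum>i<d. \<bar>(H - ?Th) $$ (i, j)\<bar>) = (\<Sum>i<d. \<bar>(H - ?Th) $$ (j, i)\<bar>)"
      using sym_index[of d H, OF _ _ j] sym_index[of d ?Th, OF _ _ j] H(1) pdTh j
      by (intro sum.cong) (auto simp: HTij pd_mat_def)
    then show ?thesis using row[OF j] by simp
  qed
  show "\<bar>op_norm w (H - ?Th)\<bar> \<le> rate_const K * (L * s) * lam" if "1 \<le> w"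
    using op_norm_le_row_col_sums[OF HTc d that row col] by (simp add: R_def)
  have KR: "K ^ 3 * R \<le> 1 / 2"
  proof -
    have "K ^ 3 * R = K ^ 3 * rate_const K * L * (s * lam)" by (simp add: R_def)
    also have "\<dots> \<le> K ^ 3 * rate_const K * L * e" using L K0 C0 by (intro mult_left_mono[OF slam]) auto
    finally show ?thesis using e(7) by linarith
  qed
  have D: "((H - ?Th) *\<^sub>v x) \<bullet> ((H - ?Th) *\<^sub>v x) \<le> R\<^sup>2 * (x \<bullet> x)" if "x \<in> carrier_vec d" for x
    by (rule sq_norm_le_row_col_sums[OF HTc row col R0 that])
  show "\<bar>op_norm 2 (mat_inv H - SigZ)\<bar> \<le> 2 * K ^ 3 * (rate_const K * (L * s) * lam) * K"
    using inverse_perturbation[OF d K pdZ low up Th(1,2) H(1) R0 KR D] by (simp add: R_def)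
qed

subsection \<open>Outer probabilities\<close>

text \<open>Each set is replaced by a measurable cover that attains its outer measure, and the
  covers satisfy the usual subadditivity.\<close>

lemma outer_measure_of_Un_le:
  assumes "A \<subseteq> space M" "B \<subseteq> space M"
  shows "outer_measure_of M (A \<union> B) \<le> outer_measure_of M A + outer_measure_of M B"
proof -
  obtain E where E: "E \<in> sets M" "A \<subseteq> E" "outer_measure_of M A = emeasure M E"
    using outer_measure_of_attain[OF assms(1)] by blast
  obtain G where G: "G \<in> sets M" "B \<subseteq> G" "outer_measure_of M B = emeasure M G"
    using outer_measure_of_attain[OF assms(2)] by blast
  have "outer_measure_of M (A \<union> B) \<le> outer_measure_of M (E \<union> G)"
    using E G by (intro outer_measure_of_mono) auto
  also have "\<dots> = emeasure M (E \<union> G)" using E G by (intro outer_measure_of_eq) auto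
  also have "\<dots> \<le> emeasure M E + emeasure M G" using E G by (intro emeasure_subadditive) auto
  finally show ?thesis using E G by simp
qed

lemma outer_measure_of_UN_le:
  assumes "finite I" "\<And>i. i \<in> I \<Longrightarrow> A i \<subseteq> space M"
  shows "outer_measure_of M (\<Union>i\<in>I. A i) \<le> (\<Sum>i\<in>I. outer_measure_of M (A i))"
  using assms
proof (induction I rule: finite_induct)
  case empty
  then show ?case by (simp add: outer_measure_of_eq)
next
  case (insert i I)
  have "outer_measure_of M (A i \<union> (\<Union>i\<in>I. A i)) \<le> outer_measure_of M (A i) + outer_measure_of M (\<Union>i\<in>I. A i)"
    by (rule outer_measure_of_Un_le) (use insert.prems in auto)
  also have "\<dots> \<le> outer_measure_of M (A i) + (\<Sum>i\<in>I. outer_measure_of M (A i))"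
    by (rule add_left_mono) (use insert in auto)
  finally show ?case using insert.hyps by simp
qed

lemma AE_iff_outer_measure_zero:
  "(AE \<omega> in M. P \<omega>) \<longleftrightarrow> outer_measure_of M {\<omega> \<in> space M. \<not> P \<omega>} = 0"
proof
  assume "AE \<omega> in M. P \<omega>"
  then obtain N where N: "{\<omega> \<in> space M. \<not> P \<omega>} \<subseteq> N" "emeasure M N = 0" "N \<in> sets M" by (rule AE_E)
  have "outer_measure_of M {\<omega> \<in> space M. \<not> P \<omega>} \<le> outer_measure_of M N" by (rule outer_measure_of_mono[OF N(1)])
  then show "outer_measure_of M {\<omega> \<in> space M. \<not> P \<omega>} = 0" using N outer_measure_of_eq[OF N(3)] by simp
next
  assume "outer_measure_of M {\<omega> \<in> space M. \<not> P \<omega>} = 0"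
  then obtain E where "E \<in> sets M" "{\<omega> \<in> space M. \<not> P \<omega>} \<subseteq> E" "emeasure M E = 0"
    using outer_measure_of_attain[of "{\<omega> \<in> space M. \<not> P \<omega>}" M] by auto
  then show "AE \<omega> in M. P \<omega>" by (intro AE_I) auto
qed

lemma le_zero_of_le_divide_Suc:
  fixes a c :: real
  assumes "\<And>m. a \<le> c / real (Suc m)"
  shows "a \<le> 0"
proof (rule LIMSEQ_le_const)
  show "(\<lambda>m. c / real (Suc m)) \<longlonglongrightarrow> 0"
    using LIMSEQ_Suc[OF lim_const_over_n[of c]] by simp
qed (use assms in auto)

text \<open>Realized covariation matrices are Gram matrices, hence positive semidefinite, and this
  survives the limit in probability.\<close>

lemma qcov_mat_psd:
  assumes Q: "qcov_mat M n n U U S"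
  shows "AE \<omega> in M. psd_mat n (S \<omega>)"
proof -
  \<comment> \<open>Uniform partitions are enough: the limit in probability is assumed along all
    deterministic partitions of vanishing mesh.\<close>
  define p where "p k i = real i / real (Suc k)" for k i
  define D where "D k l i \<omega> = U (p k (Suc l)) \<omega> $ i - U (p k l) \<omega> $ i" for k l i \<omega>
  define R where "R k i j \<omega> = (\<Sum>l<Suc k. D k l i \<omega> * D k l j \<omega>)" for k i j \<omega>
  have grid: "grid 1 (Suc k) (p k)" for k
    by (auto simp: grid_def p_def divide_right_mono)
  have "mesh (Suc k) (p k) = 1 / real (Suc k)" for k
  proof -
    have "(\<lambda>i. p k (Suc i) - p k i) ` {..<Suc k} = {1 / real (Suc k)}"
      by (auto simp: p_def diff_divide_distrib[symmetric])
    then show ?thesis by (simp add: mesh_def)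
  qed
  then have mesh: "(\<lambda>k. mesh (Suc k) (p k)) \<longlonglongrightarrow> 0"
    using LIMSEQ_Suc[OF lim_const_over_n[of 1]] by simp
  have lim: "(\<lambda>k. outer_measure_of M {\<omega> \<in> space M. e < \<bar>R k i j \<omega> - S \<omega> $$ (i, j)\<bar>}) \<longlonglongrightarrow> 0"
    if "0 < e" "i < n" "j < n" for e i j
  proof -
    have "quad_covariation M (\<lambda>t \<omega>. U t \<omega> $ i) (\<lambda>t \<omega>. U t \<omega> $ j) 1 (\<lambda>\<omega>. S \<omega> $$ (i, j))"
      using Q that by (auto simp: qcov_mat_def)
    then have "tendsto_zero_p (\<lambda>_. M) (\<lambda>k \<omega>. (\<Sum>l<Suc k. (U (p k (Suc l)) \<omega> $ i - U (p k l) \<omega> $ i) *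
        (U (p k (Suc l)) \<omega> $ j - U (p k l) \<omega> $ j)) - S \<omega> $$ (i, j))"
      using grid mesh unfolding quad_covariation_def by blast
    then show ?thesis using that(1) unfolding tendsto_zero_p_def R_def D_def by blast
  qed
  \<comment> \<open>No pathwise convergence is needed. At almost every outcome some partition, which
    may depend on the outcome, must approximate all entries within \<open>e\<close>; the exceptional
    event lies, for every \<open>k\<close>, in an event whose outer measure tends to 0 with
    \<open>k\<close>.\<close>
  define Bad where "Bad e = {\<omega> \<in> space M. \<not> (\<exists>k. \<forall>i<n. \<forall>j<n. \<bar>R k i j \<omega> - S \<omega> $$ (i, j)\<bar> \<le> e)}" for e
  have bad0: "outer_measure_of M (Bad e) = 0" if e: "0 < e" for e
  proof -
    let ?X = "\<lambda>k q. {\<omega> \<in> space M. e < \<bar>R k (fst q) (snd q) \<omega> - S \<omega> $$ (fst q, snd q)\<bar>}"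
    have le: "outer_measure_of M (Bad e) \<le> (\<Sum>q\<in>{..<n} \<times> {..<n}. outer_measure_of M (?X k q))" for k
    proof -
      have "outer_measure_of M (Bad e) \<le> outer_measure_of M (\<Union>q\<in>{..<n} \<times> {..<n}. ?X k q)"
        by (rule outer_measure_of_mono) (fastforce simp: Bad_def not_le)
      also have "\<dots> \<le> (\<Sum>q\<in>{..<n} \<times> {..<n}. outer_measure_of M (?X k q))"
        by (rule outer_measure_of_UN_le) auto
      finally show ?thesis .
    qed
    have "(\<lambda>k. \<Sum>q\<in>{..<n} \<times> {..<n}. outer_measure_of M (?X k q)) \<longlonglongrightarrow> (\<Sum>q\<in>{..<n} \<times> {..<n}. 0)"
      by (rule tendsto_sum) (use lim[OF e] in auto)
    then have "outer_measure_of M (Bad e) \<le> (\<Sum>q\<in>{..<n} \<times> {..<n}. 0)"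
      by (rule LIMSEQ_le_const) (use le in auto)
    then show ?thesis by simp
  qed
  have ae: "AE \<omega> in M. \<exists>k. \<forall>i<n. \<forall>j<n. \<bar>R k i j \<omega> - S \<omega> $$ (i, j)\<bar> \<le> 1 / real (Suc m)" for m
    unfolding AE_iff_outer_measure_zero by (rule bad0[of "1 / real (Suc m)", unfolded Bad_def]) simp
  have "AE \<omega> in M. \<forall>m. \<exists>k. \<forall>i<n. \<forall>j<n. \<bar>R k i j \<omega> - S \<omega> $$ (i, j)\<bar> \<le> 1 / real (Suc m)"
    unfolding AE_all_countable by (rule allI, rule ae)
  then show ?thesis
  proof (rule AE_mp, intro AE_I2 impI)
    fix \<omega> assume \<omega>: "\<omega> \<in> space M" and appr: "\<forall>m. \<exists>k. \<forall>i<n. \<forall>j<n. \<bar>R k i j \<omega> - S \<omega> $$ (i, j)\<bar> \<le> 1 / real (Suc m)"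
    have Sc: "S \<omega> \<in> carrier_mat n n" using Q \<omega> by (auto simp: qcov_mat_def random_mat_def)
    have sym: "S \<omega> $$ (j, i) = S \<omega> $$ (i, j)" if ij: "i < n" "j < n" for i j
    proof -
      have "\<bar>S \<omega> $$ (j, i) - S \<omega> $$ (i, j)\<bar> \<le> 0"
      proof (rule le_zero_of_le_divide_Suc)
        fix m
        obtain k where "\<forall>i<n. \<forall>j<n. \<bar>R k i j \<omega> - S \<omega> $$ (i, j)\<bar> \<le> 1 / real (Suc m)" using appr by blast
        then have "\<bar>R k i j \<omega> - S \<omega> $$ (i, j)\<bar> \<le> 1 / real (Suc m)" "\<bar>R k j i \<omega> - S \<omega> $$ (j, i)\<bar> \<le> 1 / real (Suc m)"
          using ij by blast+
        moreover have "R k i j \<omega> = R k j i \<omega>" by (simp add: R_def mult.commute)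
        moreover have "2 / real (Suc m) = 1 / real (Suc m) + 1 / real (Suc m)" by (simp add: add_divide_distrib[symmetric])
        ultimately show "\<bar>S \<omega> $$ (j, i) - S \<omega> $$ (i, j)\<bar> \<le> 2 / real (Suc m)" by linarith
      qed
      then show ?thesis by simp
    qed
    have pos: "0 \<le> x \<bullet> (S \<omega> *\<^sub>v x)" if x: "x \<in> carrier_vec n" for x
    proof -
      have "- (x \<bullet> (S \<omega> *\<^sub>v x)) \<le> 0"
      proof (rule le_zero_of_le_divide_Suc)
        fix m
        obtain k where k: "\<And>i j. i < n \<Longrightarrow> j < n \<Longrightarrow> \<bar>R k i j \<omega> - S \<omega> $$ (i, j)\<bar> \<le> 1 / real (Suc m)" using appr by blast
        \<comment> \<open>Moving the sum over partition intervals to the outside exhibits the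
          realized form as a sum of squares, one per interval.\<close>
        have "(\<Sum>i<n. \<Sum>j<n. x $ i * R k i j \<omega> * x $ j) = (\<Sum>i<n. \<Sum>j<n. \<Sum>l<Suc k. (x $ i * D k l i \<omega>) * (x $ j * D k l j \<omega>))"
          unfolding R_def sum_distrib_left sum_distrib_right by (intro sum.cong refl) (simp add: mult_ac)
        also have "\<dots> = (\<Sum>i<n. \<Sum>l<Suc k. \<Sum>j<n. (x $ i * D k l i \<omega>) * (x $ j * D k l j \<omega>))"
          by (intro sum.cong refl sum.swap)
        also have "\<dots> = (\<Sum>l<Suc k. \<Sum>i<n. \<Sum>j<n. (x $ i * D k l i \<omega>) * (x $ j * D k l j \<omega>))"
          by (rule sum.swap)
        also have "\<dots> = (\<Sum>l<Suc k. (\<Sum>i<n. x $ i * D k l i \<omega>)\<^sup>2)"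
          by (simp only: power2_eq_square sum_product)
        finally have Rpos: "0 \<le> (\<Sum>i<n. \<Sum>j<n. x $ i * R k i j \<omega> * x $ j)" by (simp only: sum_nonneg zero_le_power2)
        have "- (x \<bullet> (S \<omega> *\<^sub>v x)) \<le> (\<Sum>i<n. \<Sum>j<n. x $ i * R k i j \<omega> * x $ j) - x \<bullet> (S \<omega> *\<^sub>v x)"
          using Rpos by simp
        also have "\<dots> = (\<Sum>i<n. \<Sum>j<n. x $ i * (R k i j \<omega> - S \<omega> $$ (i, j)) * x $ j)"
          unfolding bilinear_sum[OF Sc x x] sum_subtractf[symmetric] by (intro sum.cong refl) (simp add: algebra_simps)
        also have "\<dots> \<le> (\<Sum>i<n. \<Sum>j<n. 1 / real (Suc m) * (\<bar>x $ i\<bar> * \<bar>x $ j\<bar>))"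
        proof (intro sum_mono)
          fix i j assume ij: "i \<in> {..<n}" "j \<in> {..<n}"
          have "x $ i * (R k i j \<omega> - S \<omega> $$ (i, j)) * x $ j \<le> \<bar>x $ i * (R k i j \<omega> - S \<omega> $$ (i, j)) * x $ j\<bar>" by simp
          also have "\<dots> = \<bar>R k i j \<omega> - S \<omega> $$ (i, j)\<bar> * (\<bar>x $ i\<bar> * \<bar>x $ j\<bar>)" by (simp add: abs_mult mult_ac)
          also have "\<dots> \<le> 1 / real (Suc m) * (\<bar>x $ i\<bar> * \<bar>x $ j\<bar>)"
            by (rule mult_right_mono[OF k]) (use ij in auto)
          finally show "x $ i * (R k i j \<omega> - S \<omega> $$ (i, j)) * x $ j \<le> 1 / real (Suc m) * (\<bar>x $ i\<bar> * \<bar>x $ j\<bar>)" .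
        qed
        also have "\<dots> = (\<Sum>i<n. \<Sum>j<n. \<bar>x $ i\<bar> * \<bar>x $ j\<bar>) / real (Suc m)" by (simp only: sum_divide_distrib divide_real_def mult.left_neutral mult.commute sum_distrib_left)
        finally show "- (x \<bullet> (S \<omega> *\<^sub>v x)) \<le> (\<Sum>i<n. \<Sum>j<n. \<bar>x $ i\<bar> * \<bar>x $ j\<bar>) / real (Suc m)" .
      qed
      then show ?thesis by simp
    qed
    show "psd_mat n (S \<omega>)" using Sc sym pos by (auto simp: psd_mat_def sym_mat_def intro!: eq_matI)
  qed
qed

lemma outer_measure_of_disj_le:
  assumes "outer_measure_of M {\<omega> \<in> space M. P \<omega>} \<le> ennreal a"
    and "outer_measure_of M {\<omega> \<in> space M. Q \<omega>} \<le> ennreal b" and "0 \<le> a" "0 \<le> b"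
  shows "outer_measure_of M {\<omega> \<in> space M. P \<omega> \<or> Q \<omega>} \<le> ennreal (a + b)"
proof -
  have "{\<omega> \<in> space M. P \<omega> \<or> Q \<omega>} = {\<omega> \<in> space M. P \<omega>} \<union> {\<omega> \<in> space M. Q \<omega>}" by auto
  then have "outer_measure_of M {\<omega> \<in> space M. P \<omega> \<or> Q \<omega>} \<le>
      outer_measure_of M {\<omega> \<in> space M. P \<omega>} + outer_measure_of M {\<omega> \<in> space M. Q \<omega>}"
    using outer_measure_of_Un_le[of "{\<omega> \<in> space M. P \<omega>}" M "{\<omega> \<in> space M. Q \<omega>}"] by auto
  also have "\<dots> \<le> ennreal a + ennreal b" using assms by (intro add_mono) auto
  finally show ?thesis using assms by (simp add: ennreal_plus)
qed

section \<open>From limits in probability to exceptional events of small outer measure\<close>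

lemma tendsto_zero_p_eventually:
  assumes "tendsto_zero_p M \<xi>" "0 < e" "0 < \<eta>"
  shows "\<forall>\<^sub>F n in sequentially. outer_measure_of (M n) {\<omega> \<in> space (M n). e < \<bar>\<xi> n \<omega>\<bar>} \<le> ennreal \<eta>"
proof -
  have "(\<lambda>n. outer_measure_of (M n) {\<omega> \<in> space (M n). e < \<bar>\<xi> n \<omega>\<bar>}) \<longlonglongrightarrow> 0"
    using assms unfolding tendsto_zero_p_def by blast
  from order_tendstoD(2)[OF this, of "ennreal \<eta>"] assms(3) show ?thesis
    by (auto elim!: eventually_mono simp: less_imp_le)
qed

lemma prob_tendsto_one_eventually:
  assumes M: "\<And>n. prob_space (M n)" and lim: "(\<lambda>n. measure (M n) {\<omega> \<in> space (M n). P n \<omega>}) \<longlonglongrightarrow> 1" and \<eta>: "0 < \<eta>"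
  shows "\<forall>\<^sub>F n in sequentially. outer_measure_of (M n) {\<omega> \<in> space (M n). \<not> P n \<omega>} \<le> ennreal \<eta>"
proof -
  \<comment> \<open>The minimum with 1 keeps the threshold nonnegative, so that exceeding it forces
    a positive measure.\<close>
  have "1 - min \<eta> 1 < 1" using \<eta> by auto
  from order_tendstoD(1)[OF lim this] show ?thesis
  proof (rule eventually_mono)
    fix n
    let ?G = "{\<omega> \<in> space (M n). P n \<omega>}"
    interpret prob_space "M n" by (rule M)
    assume gt: "1 - min \<eta> 1 < measure (M n) ?G"
    \<comment> \<open>Positive measure implies measurability here, because \<open>measure\<close> is
      0 on non-measurable sets; only then can the complement be taken.\<close>
    then have "measure (M n) ?G \<noteq> 0" by (auto simp: min_def split: if_splits)
    then have G: "?G \<in> sets (M n)" using measure_notin_sets by blast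
    have "{\<omega> \<in> space (M n). \<not> P n \<omega>} = space (M n) - ?G" by auto
    then have "outer_measure_of (M n) {\<omega> \<in> space (M n). \<not> P n \<omega>} = emeasure (M n) (space (M n) - ?G)"
      using G by (simp add: outer_measure_of_eq)
    also have "\<dots> = ennreal (1 - measure (M n) ?G)"
      using G by (simp add: emeasure_eq_measure prob_compl)
    also have "\<dots> \<le> ennreal \<eta>" using gt by (intro ennreal_leI) (auto simp: min_def split: if_splits)
    finally show "outer_measure_of (M n) {\<omega> \<in> space (M n). \<not> P n \<omega>} \<le> ennreal \<eta>" .
  qed
qed

lemma le_mult_of_abs_divide_le:
  fixes a lam e :: real
  assumes "\<bar>a / lam\<bar> \<le> e" "0 < lam"
  shows "a \<le> e * lam"
proof -
  have "a / lam \<le> e" using assms by linarith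
  then show ?thesis using assms(2) by (simp add: pos_divide_le_eq)
qed

theorem proposition3p1:
  fixes M :: "nat \<Rightarrow> 'a measure"
    and F :: "nat \<Rightarrow> real \<Rightarrow> 'a measure"
    and d r :: "nat \<Rightarrow> nat"
    and X Y Z :: "nat \<Rightarrow> real \<Rightarrow> 'a \<Rightarrow> real vec"
    and \<beta> :: "nat \<Rightarrow> real mat"
    and SigY SigX SigZ :: "nat \<Rightarrow> 'a \<Rightarrow> real mat"
    and hatY hatX hatYX hatXdag hatbeta hatZ hatTheta :: "nat \<Rightarrow> 'a \<Rightarrow> real mat"
    and lam :: "nat \<Rightarrow> 'a \<Rightarrow> real"
    and s :: "nat \<Rightarrow> real"
  assumes basis: "\<And>n. stochastic_basis (M n) (F n)"
    and dims: "\<And>n. 2 \<le> d n" "\<And>n. 1 \<le> r n"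
    and semimart_X: "\<And>n. vec_semimartingale (M n) (F n) (r n) (X n)"
    and semimart_Z: "\<And>n. vec_semimartingale (M n) (F n) (d n) (Z n)"
    and ZX: "\<And>n. qcov_mat (M n) (d n) (r n) (Z n) (X n) (\<lambda>_. 0\<^sub>m (d n) (r n))"
    and beta: "\<And>n. \<beta> n \<in> carrier_mat (d n) (r n)"
    and Y: "\<And>n t \<omega>. t \<in> {0..1} \<Longrightarrow> \<omega> \<in> space (M n) \<Longrightarrow> Y n t \<omega> = \<beta> n *\<^sub>v X n t \<omega> + Z n t \<omega>"
    and SigY: "\<And>n. qcov_mat (M n) (d n) (d n) (Y n) (Y n) (SigY n)"
    and SigX: "\<And>n. qcov_mat (M n) (r n) (r n) (X n) (X n) (SigX n)"
    and SigZ: "\<And>n. qcov_mat (M n) (d n) (d n) (Z n) (Z n) (SigZ n)"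
    and invertible:
      "\<And>n. AE \<omega> in M n. invertible_mat (SigY n \<omega>)"
      "\<And>n. AE \<omega> in M n. invertible_mat (SigX n \<omega>)"
      "\<And>n. AE \<omega> in M n. invertible_mat (SigZ n \<omega>)"
    and hatY: "\<And>n. random_mat (M n) (d n) (d n) (hatY n)"
      "\<And>n \<omega>. \<omega> \<in> space (M n) \<Longrightarrow> sym_mat (d n) (hatY n \<omega>)"
    and hatX: "\<And>n. random_mat (M n) (r n) (r n) (hatX n)"
      "\<And>n \<omega>. \<omega> \<in> space (M n) \<Longrightarrow> psd_mat (r n) (hatX n \<omega>)"
    and hatYX: "\<And>n. random_mat (M n) (d n) (r n) (hatYX n)"
    and hatXdag: "\<And>n. random_mat (M n) (r n) (r n) (hatXdag n)"
      "\<And>n \<omega>. \<omega> \<in> space (M n) \<Longrightarrow> pd_mat (r n) (hatXdag n \<omega>)"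
      "\<And>n \<omega>. \<omega> \<in> space (M n) \<Longrightarrow> invertible_mat (hatX n \<omega>) \<Longrightarrow> hatXdag n \<omega> = mat_inv (hatX n \<omega>)"
    and hatbeta: "\<And>n \<omega>. \<omega> \<in> space (M n) \<Longrightarrow> hatbeta n \<omega> = hatYX n \<omega> * hatXdag n \<omega>"
    and hatZ: "\<And>n \<omega>. \<omega> \<in> space (M n) \<Longrightarrow>
        hatZ n \<omega> = hatY n \<omega> - hatbeta n \<omega> * hatX n \<omega> * transpose_mat (hatbeta n \<omega>)"
    and lambda: "\<And>n. lam n \<in> borel_measurable (M n)"
      "\<And>n \<omega>. \<omega> \<in> space (M n) \<Longrightarrow> 0 < lam n \<omega>"
    and hatTheta: "\<And>n. random_mat (M n) (d n) (d n) (hatTheta n)"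
      "\<And>n \<omega>. \<omega> \<in> space (M n) \<Longrightarrow> pd_mat (d n) (hatTheta n \<omega>)"
      "\<And>n \<omega>. \<omega> \<in> space (M n) \<Longrightarrow> \<exists>!\<Theta>. glasso_solution (d n) (hatZ n \<omega>) (lam n \<omega>) \<Theta> \<Longrightarrow>
        glasso_solution (d n) (hatZ n \<omega>) (lam n \<omega>) (hatTheta n \<omega>)"
    and A1: "bigO_p M (\<lambda>n \<omega>. max_norm (SigY n \<omega>)) (\<lambda>_. 1)"
      "(\<lambda>n. max_norm (\<beta> n)) \<in> O(\<lambda>_. 1)"
    and A2: "bigO_p M (\<lambda>n \<omega>. Lambda_max (SigZ n \<omega>) + 1 / Lambda_min (SigZ n \<omega>)) (\<lambda>_. 1)"
    and A3: "bigO_p M (\<lambda>n \<omega>. max_norm (SigX n \<omega>) + 1 / Lambda_min (SigX n \<omega>)) (\<lambda>_. 1)"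
    and A4: "\<And>n. 1 \<le> s n"
      "bigO_p M (\<lambda>n \<omega>. real (offdiag_nonzeros (mat_inv (SigZ n \<omega>)))) s"
    and A5: "tendsto_zero_p M (\<lambda>n \<omega>. max_norm (hatX n \<omega> - SigX n \<omega>) / lam n \<omega>)"
      "tendsto_zero_p M (\<lambda>n \<omega>. max_norm (hatYX n \<omega> - \<beta> n * hatX n \<omega>) / lam n \<omega>)"
      "tendsto_zero_p M (\<lambda>n \<omega>. max_norm
         (hatY n \<omega> - hatYX n \<omega> * transpose_mat (\<beta> n) - \<beta> n * transpose_mat (hatYX n \<omega>)
            + \<beta> n * hatX n \<omega> * transpose_mat (\<beta> n) - SigZ n \<omega>) / lam n \<omega>)"
    and A6: "tendsto_zero_p M (\<lambda>n \<omega>. (s n + real (r n)) * lam n \<omega>)"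
    and A7: "(\<lambda>n. measure (M n) {\<omega> \<in> space (M n).
         psd_mat (r n + d n)
           (four_block_mat (hatX n \<omega>) (transpose_mat (hatYX n \<omega>)) (hatYX n \<omega>) (hatY n \<omega>))})
       \<longlonglongrightarrow> 1"
  shows "(\<forall>w\<ge>1. bigO_p M (\<lambda>n \<omega>. op_norm w (hatTheta n \<omega> - mat_inv (SigZ n \<omega>)) / lam n \<omega>) s) \<and>
         bigO_p M (\<lambda>n \<omega>. op_norm 2 (mat_inv (hatTheta n \<omega>) - SigZ n \<omega>) / lam n \<omega>) s"
proof -
  \<comment> \<open>The exponent \<open>w\<close> is quantified inside the event, so one exceptional
    set and one constant serve all operator norms together.\<close>
  define good where "good C n \<omega> \<longleftrightarrow>
      (\<forall>w\<ge>1. \<bar>op_norm w (hatTheta n \<omega> - mat_inv (SigZ n \<omega>)) / lam n \<omega>\<bar> \<le> C * s n) \<and>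
      \<bar>op_norm 2 (mat_inv (hatTheta n \<omega>) - SigZ n \<omega>) / lam n \<omega>\<bar> \<le> C * s n" for C n \<omega>
  \<comment> \<open>The covariation matrices are known only up to null sets, so their
    semidefiniteness, like their invertibility, holds almost surely.\<close>
  define Null where "Null n \<omega> \<longleftrightarrow> \<not> (psd_mat (d n) (SigZ n \<omega>) \<and> psd_mat (r n) (SigX n \<omega>) \<and>
      invertible_mat (SigX n \<omega>) \<and> invertible_mat (SigZ n \<omega>))" for n \<omega>
  have null: "outer_measure_of (M n) {\<omega> \<in> space (M n). Null n \<omega>} \<le> ennreal 0" for n
  proof -
    have "AE \<omega> in M n. psd_mat (d n) (SigZ n \<omega>) \<and> psd_mat (r n) (SigX n \<omega>) \<and>
      invertible_mat (SigX n \<omega>) \<and> invertible_mat (SigZ n \<omega>)"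
      using qcov_mat_psd[OF SigZ] qcov_mat_psd[OF SigX] invertible(2,3) by (auto intro: AE_conjI)
    then show ?thesis unfolding AE_iff_outer_measure_zero Null_def by simp
  qed
  have prob: "prob_space (M n)" for n using basis[of n] by (simp add: stochastic_basis_def)
  have main: "\<exists>C. \<forall>\<^sub>F n in sequentially.
      outer_measure_of (M n) {\<omega> \<in> space (M n). \<not> good C n \<omega>} \<le> ennreal \<epsilon>" if \<epsilon>: "0 < \<epsilon>" for \<epsilon>
  proof -
    \<comment> \<open>Apart from the null event, eight exceptional events enter: three for the
      stochastic bounds, three for the estimation errors, one for the rate and one for the block
      matrix.\<close>
    define \<eta> where "\<eta> = \<epsilon> / 8"
    have \<eta>: "0 < \<eta>" using \<epsilon> by (simp add: \<eta>_def)
    obtain K2 where K2: "\<forall>\<^sub>F n in sequentially. outer_measure_of (M n) {\<omega> \<in> space (M n).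
        K2 * 1 < \<bar>Lambda_max (SigZ n \<omega>) + 1 / Lambda_min (SigZ n \<omega>)\<bar>} \<le> ennreal \<eta>"
      using A2 \<eta> unfolding bigO_p_def by blast
    obtain K3 where K3: "\<forall>\<^sub>F n in sequentially. outer_measure_of (M n) {\<omega> \<in> space (M n).
        K3 * 1 < \<bar>max_norm (SigX n \<omega>) + 1 / Lambda_min (SigX n \<omega>)\<bar>} \<le> ennreal \<eta>"
      using A3 \<eta> unfolding bigO_p_def by blast
    obtain K4 where K4: "\<forall>\<^sub>F n in sequentially. outer_measure_of (M n) {\<omega> \<in> space (M n).
        K4 * s n < \<bar>real (offdiag_nonzeros (mat_inv (SigZ n \<omega>)))\<bar>} \<le> ennreal \<eta>"
      using A4(2) \<eta> unfolding bigO_p_def by blast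
    define K where "K = max 1 (max K2 K3)"
    define L where "L = max 1 K4"
    have K: "1 \<le> K" "K2 \<le> K" "K3 \<le> K" and L: "1 \<le> L" "K4 \<le> L" by (auto simp: K_def L_def)
    have C0: "0 \<le> rate_const K" using K by (simp add: rate_const_def)
    \<comment> \<open>\<open>Q\<close> dominates every coefficient of \<open>e\<close> in the
      conditions of \<open>glasso_pointwise_bound\<close>, so that \<open>e = 1 / Q\<close>
      satisfies all of them.\<close>
    define Q where "Q = 1 + 2 * K + 6 * K\<^sup>2 + 12 * K\<^sup>2 * (1 + K\<^sup>2) + 24 * K\<^sup>2 * L + 2 * K ^ 3 * rate_const K * L"
    define e where "e = 1 / Q"
    have nn: "0 \<le> 2 * K" "0 \<le> 6 * K\<^sup>2" "0 \<le> 12 * K\<^sup>2 * (1 + K\<^sup>2)" "0 \<le> 24 * K\<^sup>2 * L" "0 \<le> 2 * K ^ 3 * rate_const K * L"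
      using K L C0 by auto
    have Q1: "1 \<le> Q" unfolding Q_def using nn by linarith
    have e0: "0 < e" using Q1 by (simp add: e_def)
    have eQ: "c * e \<le> 1" if "c \<le> Q" for c using that Q1 by (simp add: e_def divide_le_eq)
    have e: "e \<le> 1" "2 * K * e \<le> 1" "6 * K\<^sup>2 * e \<le> 1" "12 * K\<^sup>2 * (1 + K\<^sup>2) * e \<le> 1"
      "24 * K\<^sup>2 * L * e \<le> 1" "2 * K ^ 3 * rate_const K * L * e \<le> 1"
      using eQ[of 1] Q1 by simp (rule eQ, unfold Q_def, use nn in linarith)+
    \<comment> \<open>The summand 1 serves the bound on the precision matrix, and
      \<open>2 * K ^ 3 * K\<close> the bound on its inverse.\<close>
    define C where "C = rate_const K * L * (1 + 2 * K ^ 3 * K)"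
    have "\<forall>\<^sub>F n in sequentially. outer_measure_of (M n) {\<omega> \<in> space (M n). \<not> good C n \<omega>} \<le> ennreal \<epsilon>"
      using K2 K3 K4 tendsto_zero_p_eventually[OF A5(1) e0 \<eta>] tendsto_zero_p_eventually[OF A5(2) e0 \<eta>]
        tendsto_zero_p_eventually[OF A5(3) e0 \<eta>] tendsto_zero_p_eventually[OF A6 e0 \<eta>]
        prob_tendsto_one_eventually[OF prob A7 \<eta>]
    proof eventually_elim
      case (elim n)
      \<comment> \<open>The disjunction is nested to the left so that the union bound can be applied
        to two events at a time, in the order of the summands below.\<close>
      let ?bad = "\<lambda>\<omega>. (((((((Null n \<omega> \<or>
          K2 * 1 < \<bar>Lambda_max (SigZ n \<omega>) + 1 / Lambda_min (SigZ n \<omega>)\<bar>) \<or>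
          K3 * 1 < \<bar>max_norm (SigX n \<omega>) + 1 / Lambda_min (SigX n \<omega>)\<bar>) \<or>
          K4 * s n < \<bar>real (offdiag_nonzeros (mat_inv (SigZ n \<omega>)))\<bar>) \<or>
          e < \<bar>max_norm (hatX n \<omega> - SigX n \<omega>) / lam n \<omega>\<bar>) \<or>
          e < \<bar>max_norm (hatYX n \<omega> - \<beta> n * hatX n \<omega>) / lam n \<omega>\<bar>) \<or>
          e < \<bar>max_norm (hatY n \<omega> - hatYX n \<omega> * transpose_mat (\<beta> n) - \<beta> n * transpose_mat (hatYX n \<omega>)
            + \<beta> n * hatX n \<omega> * transpose_mat (\<beta> n) - SigZ n \<omega>) / lam n \<omega>\<bar>) \<or>
          e < \<bar>(s n + real (r n)) * lam n \<omega>\<bar>) \<or>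
          \<not> psd_mat (r n + d n)
           (four_block_mat (hatX n \<omega>) (transpose_mat (hatYX n \<omega>)) (hatYX n \<omega>) (hatY n \<omega>))"
      have "outer_measure_of (M n) {\<omega> \<in> space (M n). ?bad \<omega>} \<le>
          ennreal (0 + \<eta> + \<eta> + \<eta> + \<eta> + \<eta> + \<eta> + \<eta> + \<eta>)"
        by (intro outer_measure_of_disj_le null elim add_nonneg_nonneg order_refl less_imp_le[OF \<eta>])
      also have "0 + \<eta> + \<eta> + \<eta> + \<eta> + \<eta> + \<eta> + \<eta> + \<eta> = \<epsilon>" by (simp add: \<eta>_def)
      finally have bad: "outer_measure_of (M n) {\<omega> \<in> space (M n). ?bad \<omega>} \<le> ennreal \<epsilon>" .
      have "{\<omega> \<in> space (M n). \<not> good C n \<omega>} \<subseteq> {\<omega> \<in> space (M n). ?bad \<omega>}"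
      proof (rule subsetI, rule ccontr)
        fix \<omega> assume "\<omega> \<in> {\<omega> \<in> space (M n). \<not> good C n \<omega>}" "\<omega> \<notin> {\<omega> \<in> space (M n). ?bad \<omega>}"
        then have \<omega>: "\<omega> \<in> space (M n)" and ng: "\<not> good C n \<omega>" and nb: "\<not> ?bad \<omega>" by auto
        have lam0: "0 < lam n \<omega>" by (rule lambda(2)[OF \<omega>])
        have s1: "1 \<le> s n" by (rule A4(1))
        have dr: "0 < d n" "0 < r n" using dims(1)[of n] dims(2)[of n] by auto
        have psds: "psd_mat (d n) (SigZ n \<omega>)" "invertible_mat (SigZ n \<omega>)" "psd_mat (r n) (SigX n \<omega>)" "invertible_mat (SigX n \<omega>)"
          using nb by (auto simp: Null_def)
        have h: "Lambda_max (SigZ n \<omega>) + 1 / Lambda_min (SigZ n \<omega>) \<le> K"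
          "max_norm (SigX n \<omega>) + 1 / Lambda_min (SigX n \<omega>) \<le> K"
          using nb K by linarith+
        have nz: "real (offdiag_nonzeros (mat_inv (SigZ n \<omega>))) \<le> L * s n"
        proof -
          have "real (offdiag_nonzeros (mat_inv (SigZ n \<omega>))) \<le> K4 * s n" using nb by linarith
          also have "\<dots> \<le> L * s n" using L s1 by (intro mult_right_mono) auto
          finally show ?thesis .
        qed
        have cl: "max_norm (hatX n \<omega> - SigX n \<omega>) \<le> e * lam n \<omega>"
          "max_norm (hatYX n \<omega> - \<beta> n * hatX n \<omega>) \<le> e * lam n \<omega>"
          "max_norm (hatY n \<omega> - hatYX n \<omega> * transpose_mat (\<beta> n) - \<beta> n * transpose_mat (hatYX n \<omega>)
            + \<beta> n * hatX n \<omega> * transpose_mat (\<beta> n) - SigZ n \<omega>) \<le> e * lam n \<omega>"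
          using nb by (intro le_mult_of_abs_divide_le[OF _ lam0]; simp add: not_less)+
        have sl: "(s n + real (r n)) * lam n \<omega> \<le> e" using nb by linarith
        have blk: "psd_mat (r n + d n) (four_block_mat (hatX n \<omega>) (transpose_mat (hatYX n \<omega>)) (hatYX n \<omega>) (hatY n \<omega>))"
          using nb by simp
        have V: "hatYX n \<omega> \<in> carrier_mat (d n) (r n)" using hatYX[of n] \<omega> by (auto simp: random_mat_def)
        note pw = glasso_pointwise_bound[OF dr K(1) L(1) s1 lam0 e0 e psds(1,2) h(1) psds(3,4) h(2) nz beta
          hatX(2)[OF \<omega>] hatY(2)[OF \<omega>] V cl sl blk hatXdag(3)[OF \<omega>] hatbeta[OF \<omega>] hatZ[OF \<omega>]
          hatTheta(2)[OF \<omega>] hatTheta(3)[OF \<omega>]]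
        have div: "\<bar>x / lam n \<omega>\<bar> \<le> C * s n" if "\<bar>x\<bar> \<le> c * (L * s n) * lam n \<omega>" "c \<le> rate_const K * (1 + 2 * K ^ 3 * K)" for x c
        proof -
          have "\<bar>x / lam n \<omega>\<bar> \<le> c * (L * s n)" using that(1) lam0 by (simp add: pos_divide_le_eq)
          also have "\<dots> \<le> rate_const K * (1 + 2 * K ^ 3 * K) * (L * s n)"
            by (rule mult_right_mono[OF that(2)]) (use L s1 in simp)
          finally show ?thesis by (simp add: C_def mult_ac)
        qed
        have c1: "rate_const K \<le> rate_const K * (1 + 2 * K ^ 3 * K)"
          using mult_left_mono[of 1 "1 + 2 * K ^ 3 * K" "rate_const K"] C0 K by simp
        have c2: "2 * K ^ 3 * K * rate_const K \<le> rate_const K * (1 + 2 * K ^ 3 * K)"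
          using C0 by (simp add: algebra_simps)
        have "\<bar>op_norm 2 (mat_inv (hatTheta n \<omega>) - SigZ n \<omega>)\<bar> \<le> 2 * K ^ 3 * K * rate_const K * (L * s n) * lam n \<omega>"
          using pw(2) by (simp only: mult_ac)
        then have "good C n \<omega>" unfolding good_def using div[OF pw(1) c1] div[OF _ c2] by blast
        then show False using ng by simp
      qed
      then show ?case using bad outer_measure_of_mono order_trans by blast
    qed
    then show ?thesis by blast
  qed
  have fin: "bigO_p M \<xi> s" if imp: "\<And>C n \<omega>. good C n \<omega> \<Longrightarrow> \<bar>\<xi> n \<omega>\<bar> \<le> C * s n" for \<xi> :: "nat \<Rightarrow> 'a \<Rightarrow> real"
    unfolding bigO_p_def
  proof (intro allI impI)
    fix \<epsilon> :: real assume "0 < \<epsilon>"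
    then obtain C where C: "\<forall>\<^sub>F n in sequentially.
      outer_measure_of (M n) {\<omega> \<in> space (M n). \<not> good C n \<omega>} \<le> ennreal \<epsilon>" using main by blast
    have "\<forall>\<^sub>F n in sequentially. outer_measure_of (M n) {\<omega> \<in> space (M n). C * s n < \<bar>\<xi> n \<omega>\<bar>} \<le> ennreal \<epsilon>"
      using C
    proof eventually_elim
      case (elim n)
      have "{\<omega> \<in> space (M n). C * s n < \<bar>\<xi> n \<omega>\<bar>} \<subseteq> {\<omega> \<in> space (M n). \<not> good C n \<omega>}"
        using imp[of C n] by (auto simp: not_le[symmetric])
      from order_trans[OF outer_measure_of_mono[OF this] elim] show ?case .
    qed
    then show "\<exists>C. \<forall>\<^sub>F n in sequentially. outer_measure_of (M n) {\<omega> \<in> space (M n). C * s n < \<bar>\<xi> n \<omega>\<bar>} \<le> ennreal \<epsilon>" by blast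
  qed
  show ?thesis
    by (intro conjI allI impI fin) (simp_all add: good_def)
qed

end
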